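(* Let $b\in\mathbb R^m$, $C\in\mathbb S^n$, and let $\mathcal A:\mathbb S^n\to\mathbb R^m$ be linear with adjoint $\mathcal A^*$. Consider the pair of SDPs $$(P)\ \ \min_X\{C\bullet X:\mathcal AX=b,\ X\in\Delta^n\},\qquad (D)\ \ \max_{p\in\mathbb R^m,\theta\in\mathbb R}\{-b^Tp-\theta:\ C+\mathcal A^*p+\theta I\succeq0,\ \theta\ge0\},$$ and assume that $(P)$ and $(D)$ have optimal solutions $X_*$ and $(p_*,\theta_* )$, respectively, with the same optimal value. Run the HALLaR method (described in the context) with initial points $(U_0,p_0)\in\bar B_1^{s_0}\times\mathbb R^m$, tolerances $\epsilon_{\mathrm c},\epsilon_{\mathrm p}>0$, penalty parameter $\beta>0$, and parameters $\bar\rho,\lambda_0>0$. Let $X_0:=U_0U_0^T$, $\bar\epsilon:=\min\{\epsilon_{\mathrm c},\epsilon_{\mathrm p}^2\beta/6\}$ and define $$\bar{\mathcal F}_\beta:=\frac\beta2\|\mathcal AX_0-b\|^2+\frac{5\|p_*\|^2+\|p_*\|\sqrt{3\|p_*\|^2+2\beta\bar\epsilon}}{\beta}+3\bar\epsilon,$$ $$\bar{\mathcal G}_\beta:=\|C\|_F+\|\mathcal A\|\left(9\beta\|\mathcal A\|+\sqrt{4\|p_*\|^2+2\beta\bar\epsilon}+\beta\|b\|\right),$$ $$\bar\kappa_\beta:=\left\lceil\log_0^+\!\left(\lambda_0\max\{8\bar{\mathcal G}_\beta+144\beta\|\mathcal A\|^2,\,1/\lambda_0\}\right)/\log2\right\rceil,\qquad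 C_\sigma:=\frac{2(1-\sigma)^2}{1-2\sigma},$$ $$\bar{\mathcal P}_\beta(\epsilon_{\mathrm p},\epsilon_{\mathrm c}):=\left\lceil1+\frac{4\max\left\{\bar{\mathcal F}_\beta,\ \sqrt{4\beta\|\mathcal A\|^2\bar{\mathcal F}_\beta},\ 4\beta\|\mathcal A\|^2\right\}}{\min\{\epsilon_{\mathrm c},\ \epsilon_{\mathrm p}^2\beta/6\}}\right\rceil .$$ Then: (a) HALLaR terminates with an $(\epsilon_{\mathrm p},\epsilon_{\mathrm c})$-solution $(\bar X,\bar p,\bar\theta)$ of the pair of SDPs $(P)$ and $(D)$ in at most $$\mathcal J:=\left\lceil\frac{3\|p_*\|^2}{\beta^2\epsilon_{\mathrm p}^2}\right\rceil$$ iterations, where $p_*$ is an optimal solution to $(D)$; (b) HALLaR performs at most $\mathcal J\cdot\bar{\mathcal P}_\beta(\epsilon_{\mathrm p},\epsilon_{\mathrm c})$ total HLR iterations (and hence minimum eigenvector computations), and at most $$\mathcal J\left[(1+\bar\kappa_\beta)\bar{\mathcal P}_\beta(\epsilon_{\mathrm p},\epsilon_{\mathrm c})\right]+\frac{C_\sigma\bar{\mathcal F}_\beta\max\{8\bar{\mathcal G}_\beta+144\beta\|\mathcal A\|^2,\,1/\lambda_0\}}{\bar\rho^2}$$ total ADAP-FISTA calls.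
   Context: Notation. $\mathbb S^n$ is the space of real symmetric $n\times n$ matrices, $\bullet$ and $\|\cdot\|_F$ the Frobenius inner product and norm (also used on $\mathbb R^{n\times s}$); $\|\cdot\|$ is the Euclidean norm on $\mathbb R^m$ and $\|\mathcal A\|$ the induced operator norm. $\Delta^n:=\{X\in\mathbb S^n:\mathrm{tr}X\le1,\ X\succeq0\}$. $\bar B_r^s:=\{U\in\mathbb R^{n\times s}:\|U\|_F\le r\}$. $\delta_C$ is the indicator function of $C$. $\log_0^+(t)=\max\{\log t,0\}$. For $Q\in\mathbb S^n$, $\lambda_{\min}(Q)$ is its minimum eigenvalue and $v_{\min}(Q)$ a corresponding unit-norm eigenvector. For differentiable $\psi$, $\ell_\psi(u;x):=\psi(x)+\langle\nabla\psi(x),u-x\rangle$. Universal parameters $\sigma\in(0,1/2)$ and $\chi\in(0,1)$ are fixed throughout. $(\epsilon_{\mathrm p},\epsilon_{\mathrm c})$-solution: a triple $(\bar X,\bar p,\bar\theta)$ such that, with $\bar S:=C+\mathcal A^*\bar p+\bar\theta I$: $\|\mathcal A\bar X-b\|\le\epsilon_{\mathrm p}$, $\mathrm{tr}\bar X\le1$, $\bar X\succeq0$; $\bar S\succeq0$, $\bar\theta\ge0$; and $\bar X\bullet\bar S+\bar\theta(1-\mathrm{tr}\bar X)\le\epsilon_{\mathrm c}$. Augmented Lagrangian: $\mathcal L_\beta(X;p):=C\bullet X+p^T(\mathcal AX-b)+\frac\beta2\|\mathcal AX-b\|^2$. ADAP-FISTA method. Input: initial point $x_0\in\mathcal N$,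 scalars $\mu>0$, $L_0>\mu$, and a pair $(\psi_s,\psi_n)$ with $\psi_s$ differentiable and $\psi_n$ proper closed convex with bounded domain $\mathcal N$. (0) Set $y_0=x_0$, $A_0=0$, $\tau_0=1$, $i=0$. (1) Set $L_{i+1}=L_i$. (2) Compute $a_i=\frac{\tau_i+\sqrt{\tau_i^2+4\tau_iA_i(L_{i+1}-\mu)}}{2(L_{i+1}-\mu)}$, $\tilde x_i=\frac{A_iy_i+a_ix_i}{A_i+a_i}$, $y_{i+1}=\arg\min_{u\in\mathcal N}\{\ell_{\psi_s}(u;\tilde x_i)+\psi_n(u)+\frac{L_{i+1}}2\|u-\tilde x_i\|^2\}$. If $\ell_{\psi_s}(y_{i+1};\tilde x_i)+\frac{(1-\chi)L_{i+1}}4\|y_{i+1}-\tilde x_i\|^2\ge\psi_s(y_{i+1})$, go to (3); else set $L_{i+1}\leftarrow2L_{i+1}$ and repeat (2). (3) Compute $A_{i+1}=A_i+a_i$, $\tau_{i+1}=\tau_i+a_i\mu$, $s_{i+1}=(L_{i+1}-\mu)(\tilde x_i-y_{i+1})$, $x_{i+1}=\frac1{\tau_{i+1}}[\mu a_iy_{i+1}+\tau_ix_i-a_is_{i+1}]$. (4) If $\|y_{i+1}-x_0\|^2\ge\chi A_{i+1}L_{i+1}\|y_{i+1}-\tilde x_i\|^2$, go to (5); otherwise stop with failure. (5) Compute $v_{i+1}=\nabla\psi_s(y_{i+1})-\nabla\psi_s(\tilde x_i)+L_{i+1}(\tilde x_i-y_{i+1})$. If $\|v_{i+1}\|\le\sigma\|y_{i+1}-x_0\|$,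 stop with success and output $(y,v,L)=(y_{i+1},v_{i+1},L_{i+1})$; otherwise set $i\leftarrow i+1$ and go to (1). ADAP-AIPP method. Input: $(\tilde g,\lambda_0,\underline W,\bar\rho)$, where for a fixed $s$, $\tilde g(U):=g(UU^T)$ on $\mathbb R^{n\times s}$, $\lambda_0>0$, $\underline W\in\bar B_1^s$, $\bar\rho>0$. (0) Set $W_0=\underline W$, $j=1$, $\lambda=\lambda_0$, $\bar M_0=1$. (1) Choose $\underline M_j\in[1,\bar M_{j-1}]$ and call ADAP-FISTA with $x_0=W_{j-1}$, $(\mu,L_0)=(1/2,\underline M_j)$, $\psi_s=\lambda\tilde g+\frac12\|\cdot-W_{j-1}\|_F^2$, $\psi_n=\lambda\delta_{\bar B_1^s}$. (2) If ADAP-FISTA fails, or it succeeds but its output $(W,V,L)$ does not satisfy $\lambda\tilde g(W_{j-1})-[\lambda\tilde g(W)+\frac12\|W-W_{j-1}\|_F^2]\ge V\bullet(W_{j-1}-W)$, set $\lambda\leftarrow\lambda/2$ and go to (1). Otherwise set $(\lambda_j,\bar M_j)=(\lambda,L)$, $(W_j,V_j)=(W,V)$, $R_j=(V_j+W_{j-1}-W_j)/\lambda_j$ and go to (3). (3) If $\|R_j\|_F\le\bar\rho$, stop and output $(\overline W,\overline R)=(W_j,R_j)$; else go to (4). (4) Set $j\leftarrow j+1$ and go to (1). HLR method. Input $(\bar Y_0,g,\bar\epsilon,\bar\rho,\lambda_0)$ with $\bar Y_0\in\bar B_1^{s_0}$ and $g:\mathbb S^n\to\mathbb R$ convex differentiable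 with Lipschitz continuous gradient on $\Delta^n$. (0) Set $\tilde Y_0=\bar Y_0$, $s=s_0$, $k=1$. (1) Call ADAP-AIPP (with the current column dimension $s$, $\tilde g(U)=g(UU^T)$) with $\lambda_0$, $\bar\rho$ and $\underline W=\tilde Y_{k-1}$, and let $(Y_k,\mathcal R_k)$ be its output. (2) Let $G_k=\nabla g(Y_kY_k^T)$; by computing a minimum eigenpair of $G_k$ (a minimum eigenvector computation) set $\theta_k=\max\{-\lambda_{\min}(G_k),0\}$, and $y_k=v_{\min}(G_k)$ if $\theta_k>0$, $y_k=0$ otherwise. (3) Set $\epsilon_k=(G_kY_k)\bullet Y_k+\theta_k$. If $\epsilon_k\le\bar\epsilon$, stop and output $(\bar Y,\bar\theta)=(Y_k,\theta_k)$; else go to (4). (4) Compute $\alpha_k=\arg\min_\alpha\{g(\alpha y_ky_k^T+(1-\alpha)Y_kY_k^T):\alpha\in[0,1]\}$ and set $(\tilde Y_k,s)=(y_k,1)$ if $\alpha_k=1$, and $(\tilde Y_k,s)=([\sqrt{1-\alpha_k}\,Y_k,\ \sqrt{\alpha_k}\,y_k],\,s+1)$ otherwise. (5) Set $k\leftarrow k+1$ and go to (1). HALLaR method. Input: $(U_0,p_0)\in\bar B_1^{s_0}\times\mathbb R^m$, $(\epsilon_{\mathrm c},\epsilon_{\mathrm p})$, $\beta$, $(\bar\rho,\lambda_0)$. (0) Set $t=1$ and $\bar\epsilon=\min\{\epsilon_{\mathrm c},\epsilon_{\mathrm p}^2\beta/6\}$. (1) Call HLR with $g=\mathcal L_\beta(\cdot;p_{t-1})$,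 $\bar Y_0=U_{t-1}$, and $\lambda_0,\bar\epsilon,\bar\rho$; let $U_t\in\bar B_1^{s_t}$ be its output $\bar Y$. (2) Set $p_t=p_{t-1}+\beta(\mathcal A(U_tU_t^T)-b)$. (3) If $\|\mathcal A(U_tU_t^T)-b\|\le\epsilon_{\mathrm p}$, set $T=t$ and return $(\bar X,\bar p,\bar\theta)=(U_TU_T^T,\ p_T,\ \max\{-\lambda_{\min}(C+\mathcal A^*p_T),0\})$. (4) Set $t\leftarrow t+1$ and go to (1).
   Formalization: J is replaced by max{1,J}; p_0 is assumed to satisfy ‖p_0−p_*‖ ≤ ‖p_*‖ (e.g. p_0=0); in the last term of the ADAP-FISTA bound F̄_β becomes F̄_β + max{0, C•X_0+p_0^T(AX_0−b)−C•X_*}. Without these changes the stated bounds are false. *)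

theory Defs
  imports "HOL-Analysis.Analysis"
begin

section \<open>The space of real symmetric matrices\<close>

typedef ('n::finite) symmat = "{X :: real^'n^'n. transpose X = X}"
  morphisms mat_of sym_of
  by (rule exI[of _ 0]) (simp add: transpose_def vec_eq_iff)

setup_lifting type_definition_symmat

lemma symmetric_subspace: "subspace {X :: real^'n^'n. transpose X = X}"
  by (simp add: subspace_def transpose_def vec_eq_iff)

text \<open>The inner product of \<^typ>\<open>real^'n^'n\<close> is the Frobenius one, so \<open>X \<bullet> Y\<close> and
  \<open>norm X\<close> below are the Frobenius inner product and norm.\<close>

instantiation symmat :: (finite) real_inner
begin

lift_definition zero_symmat :: "'a symmat" is 0
  by (simp add: transpose_def vec_eq_iff)
lift_definition plus_symmat :: "'a symmat \<Rightarrow> 'a symmat \<Rightarrow> 'a symmat" is "(+)"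
  by (simp add: transpose_def vec_eq_iff)
lift_definition minus_symmat :: "'a symmat \<Rightarrow> 'a symmat \<Rightarrow> 'a symmat" is "(-)"
  by (simp add: transpose_def vec_eq_iff)
lift_definition uminus_symmat :: "'a symmat \<Rightarrow> 'a symmat" is "uminus"
  by (simp add: transpose_def vec_eq_iff)
lift_definition scaleR_symmat :: "real \<Rightarrow> 'a symmat \<Rightarrow> 'a symmat" is "(*\<^sub>R)"
  by (simp add: transpose_def vec_eq_iff)
lift_definition inner_symmat :: "'a symmat \<Rightarrow> 'a symmat \<Rightarrow> real" is "(\<bullet>)" .
lift_definition norm_symmat :: "'a symmat \<Rightarrow> real" is norm .

definition dist_symmat :: "'a symmat \<Rightarrow> 'a symmat \<Rightarrow> real"
  where "dist_symmat X Y = norm (X - Y)"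
definition sgn_symmat :: "'a symmat \<Rightarrow> 'a symmat"
  where "sgn_symmat X = inverse (norm X) *\<^sub>R X"
definition uniformity_symmat :: "('a symmat \<times> 'a symmat) filter"
  where "uniformity_symmat = (INF e\<in>{0<..}. principal {(X, Y). dist X Y < e})"
definition open_symmat :: "'a symmat set \<Rightarrow> bool"
  where "open_symmat S \<longleftrightarrow>
    (\<forall>X\<in>S. \<forall>\<^sub>F (X', Y) in uniformity. X' = X \<longrightarrow> Y \<in> S)"

instance
proof
  fix X Y Z :: "'a symmat" and a b :: real
  show "X + Y + Z = X + (Y + Z)" by transfer (rule add.assoc)
  show "X + Y = Y + X" by transfer (rule add.commute)
  show "0 + X = X" by transfer simp
  show "- X + X = 0" by transfer simp
  show "X - Y = X + - Y" by transfer simp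
  show "a *\<^sub>R (X + Y) = a *\<^sub>R X + a *\<^sub>R Y" by transfer (rule scaleR_add_right)
  show "(a + b) *\<^sub>R X = a *\<^sub>R X + b *\<^sub>R X" by transfer (rule scaleR_add_left)
  show "a *\<^sub>R b *\<^sub>R X = (a * b) *\<^sub>R X" by transfer simp
  show "1 *\<^sub>R X = X" by transfer simp
  show "dist X Y = norm (X - Y)" by (rule dist_symmat_def)
  show "sgn X = inverse (norm X) *\<^sub>R X" by (rule sgn_symmat_def)
  show "X \<bullet> Y = Y \<bullet> X" by transfer (rule inner_commute)
  show "(X + Y) \<bullet> Z = X \<bullet> Z + Y \<bullet> Z" by transfer (rule inner_add_left)
  show "(a *\<^sub>R X) \<bullet> Y = a * (X \<bullet> Y)" by transfer simp
  show "0 \<le> X \<bullet> X" by transfer simp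
  show "X \<bullet> X = 0 \<longleftrightarrow> X = 0" by transfer simp
  show "norm X = sqrt (X \<bullet> X)" by transfer (rule norm_eq_sqrt_inner)
qed (rule uniformity_symmat_def open_symmat_def)+

end

instantiation symmat :: (finite) euclidean_space
begin

text \<open>Any orthonormal basis will do.\<close>

definition Basis_symmat :: "'a symmat set"
  where "Basis_symmat = (SOME B. finite B \<and> B \<noteq> {} \<and>
    (\<forall>u\<in>B. \<forall>v\<in>B. u \<bullet> v = (if u = v then 1 else 0)) \<and>
    (\<forall>X. (\<forall>u\<in>B. X \<bullet> u = 0) \<longleftrightarrow> X = 0))"

instance
proof
  let ?S = "{X :: real^'a^'a. transpose X = X}"
  let ?P = "\<lambda>B :: 'a symmat set. finite B \<and> B \<noteq> {} \<and>
    (\<forall>u\<in>B. \<forall>v\<in>B. u \<bullet> v = (if u = v then 1 else 0)) \<and>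
    (\<forall>X. (\<forall>u\<in>B. X \<bullet> u = 0) \<longleftrightarrow> X = 0)"
  have "\<exists>B. ?P B"
  proof -
    obtain B where B: "B \<subseteq> ?S" "pairwise orthogonal B"
        "\<And>x. x \<in> B \<Longrightarrow> norm x = 1" "independent B"
        "card B = dim ?S" "span B = ?S"
      by (rule orthonormal_basis_subspace[OF symmetric_subspace[where 'n = 'a]], rule that)
        (assumption | simp only:)+
    have mem: "mat_of (sym_of u) = u" if "u \<in> B" for u
      using B(1) that by (intro sym_of_inverse) auto
    have inj: "inj_on sym_of B"
      by (rule inj_on_inverseI[of _ mat_of]) (rule mem)
    have "?P (sym_of ` B)"
    proof (intro conjI)
      show "finite (sym_of ` B)"
        using B(4) by (intro finite_imageI independent_imp_finite)
      show "sym_of ` B \<noteq> {}"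
      proof
        assume "sym_of ` B = {}"
        then have "?S = {0}" using B(6) by auto
        moreover have "mat 1 \<in> ?S" by (simp add: transpose_mat)
        ultimately have "(mat 1 :: real^'a^'a) = 0" by blast
        then have "(mat 1 :: real^'a^'a) $ undefined $ undefined = 0" by simp
        then show False by (simp add: mat_def)
      qed
      show "\<forall>u\<in>sym_of ` B. \<forall>v\<in>sym_of ` B. u \<bullet> v = (if u = v then 1 else 0)"
      proof (intro ballI)
        fix u v assume "u \<in> sym_of ` B" "v \<in> sym_of ` B"
        then obtain u' v' where uv: "u = sym_of u'" "v = sym_of v'" "u' \<in> B" "v' \<in> B" by auto
        have "u \<bullet> v = u' \<bullet> v'" using uv mem by (simp add: inner_symmat.rep_eq)
        also have "\<dots> = (if u' = v' then 1 else 0)"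
          using B(2,3) uv by (auto simp: pairwise_def orthogonal_def dot_square_norm)
        also have "(u' = v') = (u = v)" using uv inj by (simp add: inj_on_eq_iff)
        finally show "u \<bullet> v = (if u = v then 1 else 0)" .
      qed
      show "\<forall>X. (\<forall>u\<in>sym_of ` B. X \<bullet> u = 0) \<longleftrightarrow> X = 0"
      proof (intro allI iffI)
        fix X :: "'a symmat"
        assume "\<forall>u\<in>sym_of ` B. X \<bullet> u = 0"
        then have 1: "orthogonal (mat_of X) u" if "u \<in> B" for u
          using that mem by (auto simp: inner_symmat.rep_eq orthogonal_def)
        have 2: "mat_of X \<in> span B" using B(6) mat_of[of X] by simp
        have "orthogonal (mat_of X) (mat_of X)"
          by (rule orthogonal_to_span[OF 2 1])
        then have "mat_of X = mat_of 0"
          by (simp add: orthogonal_self zero_symmat.rep_eq)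
        then show "X = 0"
          by (simp only: mat_of_inject)
      qed simp
    qed
    then show ?thesis by (rule exI[of ?P])
  qed
  then have *: "?P Basis" unfolding Basis_symmat_def by (rule someI_ex)
  show "finite (Basis :: 'a symmat set)" "(Basis :: 'a symmat set) \<noteq> {}"
    using * by simp_all
  show "u \<bullet> v = (if u = v then 1 else 0)" if "u \<in> Basis" "v \<in> Basis" for u v :: "'a symmat"
    using * that by simp
  show "(\<forall>u\<in>Basis. X \<bullet> u = 0) \<longleftrightarrow> X = 0" for X :: "'a symmat"
    using * by simp
qed

end

lift_definition sym_id :: "'n::finite symmat" is "mat 1"
  by (rule transpose_mat)

lift_definition tr :: "'n::finite symmat \<Rightarrow> real" is trace .

lift_definition mult_vec :: "'n::finite symmat \<Rightarrow> real^'n \<Rightarrow> real^'n" is "(*v)" .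

lift_definition outer :: "real^'n \<Rightarrow> 'n::finite symmat" is "\<lambda>u. \<chi> i j. u $ i * u $ j"
  by (simp add: transpose_def vec_eq_iff)

definition psd :: "'n::finite symmat \<Rightarrow> bool"
  where "psd X \<longleftrightarrow> (\<forall>v. 0 \<le> v \<bullet> mult_vec X v)"

definition Delta :: "'n::finite symmat set"
  where "Delta = {X. tr X \<le> 1 \<and> psd X}"

definition eigenpair :: "'n::finite symmat \<Rightarrow> real \<Rightarrow> real^'n \<Rightarrow> bool"
  where "eigenpair Q l v \<longleftrightarrow> v \<noteq> 0 \<and> mult_vec Q v = l *\<^sub>R v"

definition lambda_min :: "'n::finite symmat \<Rightarrow> real"
  where "lambda_min Q = (LEAST l. \<exists>v. eigenpair Q l v)"

definition is_v_min :: "'n::finite symmat \<Rightarrow> real^'n \<Rightarrow> bool"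
  where "is_v_min Q v \<longleftrightarrow> eigenpair Q (lambda_min Q) v \<and> norm v = 1"


section \<open>Matrices with a variable number of columns\<close>

text \<open>The number of columns changes during the method, so \<open>\<real>\<^bsup>n\<times>s\<^esup>\<close> cannot be a type of
  its own. A value of type \<open>'n colmat\<close> is a sequence of columns, almost all of them zero, and
  \<open>\<real>\<^bsup>n\<times>s\<^esup>\<close> is the subspace \<open>cols s\<close> of those that vanish from column \<open>s\<close> on (columns are
  numbered from 0). The dimension \<open>s\<close> is carried along explicitly in the algorithms.\<close>

typedef ('n::finite) colmat = "{U :: nat \<Rightarrow> real^'n. finite {j. U j \<noteq> 0}}"
  morphisms col colmat_of
  by (rule exI[of _ "\<lambda>_. 0"]) simp

setup_lifting type_definition_colmat

lemma finite_col [simp]: "finite {j. col U j \<noteq> 0}"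
  using col[of U] by simp

instantiation colmat :: (finite) real_inner
begin

lift_definition zero_colmat :: "'a colmat" is "\<lambda>_. 0" by simp
lift_definition plus_colmat :: "'a colmat \<Rightarrow> 'a colmat \<Rightarrow> 'a colmat" is "\<lambda>U V j. U j + V j"
  subgoal for U V by (rule finite_subset[of _ "{j. U j \<noteq> 0} \<union> {j. V j \<noteq> 0}"]) auto
  done
lift_definition minus_colmat :: "'a colmat \<Rightarrow> 'a colmat \<Rightarrow> 'a colmat" is "\<lambda>U V j. U j - V j"
  subgoal for U V by (rule finite_subset[of _ "{j. U j \<noteq> 0} \<union> {j. V j \<noteq> 0}"]) auto
  done
lift_definition uminus_colmat :: "'a colmat \<Rightarrow> 'a colmat" is "\<lambda>U j. - U j" by simp
lift_definition scaleR_colmat :: "real \<Rightarrow> 'a colmat \<Rightarrow> 'a colmat" is "\<lambda>a U j. a *\<^sub>R U j"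
  by (rule finite_subset) auto

definition inner_colmat :: "'a colmat \<Rightarrow> 'a colmat \<Rightarrow> real"
  where "inner_colmat U V = (\<Sum>j | col U j \<noteq> 0. col U j \<bullet> col V j)"
definition norm_colmat :: "'a colmat \<Rightarrow> real"
  where "norm_colmat U = sqrt (U \<bullet> U)"
definition dist_colmat :: "'a colmat \<Rightarrow> 'a colmat \<Rightarrow> real"
  where "dist_colmat U V = norm (U - V)"
definition sgn_colmat :: "'a colmat \<Rightarrow> 'a colmat"
  where "sgn_colmat U = inverse (norm U) *\<^sub>R U"
definition uniformity_colmat :: "('a colmat \<times> 'a colmat) filter"
  where "uniformity_colmat = (INF e\<in>{0<..}. principal {(U, V). dist U V < e})"
definition open_colmat :: "'a colmat set \<Rightarrow> bool"
  where "open_colmat S \<longleftrightarrow>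
    (\<forall>U\<in>S. \<forall>\<^sub>F (U', V) in uniformity. U' = U \<longrightarrow> V \<in> S)"

lemma inner_colmat_superset:
  assumes "finite K" "{j. col U j \<noteq> 0} \<subseteq> K"
  shows "U \<bullet> V = (\<Sum>j\<in>K. col U j \<bullet> col V j)"
  unfolding inner_colmat_def using assms by (intro sum.mono_neutral_left) auto

instance
proof
  fix U V W :: "'a colmat" and a b :: real
  let ?K = "{j. col U j \<noteq> 0} \<union> {j. col V j \<noteq> 0}"
  show "U + V + W = U + (V + W)" by transfer (simp add: add.assoc)
  show "U + V = V + U" by transfer (simp add: add.commute)
  show "0 + U = U" by transfer simp
  show "- U + U = 0" by transfer simp
  show "U - V = U + - V" by transfer simp
  show "a *\<^sub>R (U + V) = a *\<^sub>R U + a *\<^sub>R V" by transfer (simp add: scaleR_add_right)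
  show "(a + b) *\<^sub>R U = a *\<^sub>R U + b *\<^sub>R U" by transfer (simp add: scaleR_add_left)
  show "a *\<^sub>R b *\<^sub>R U = (a * b) *\<^sub>R U" by transfer simp
  show "1 *\<^sub>R U = U" by transfer simp
  show "dist U V = norm (U - V)" by (rule dist_colmat_def)
  show "sgn U = inverse (norm U) *\<^sub>R U" by (rule sgn_colmat_def)
  show "norm U = sqrt (U \<bullet> U)" by (rule norm_colmat_def)
  show "U \<bullet> V = V \<bullet> U"
    by (simp add: inner_colmat_superset[of ?K] inner_commute)
  show "(U + V) \<bullet> W = U \<bullet> W + V \<bullet> W"
    by (subst (1 2 3) inner_colmat_superset[of ?K])
       (auto simp: plus_colmat.rep_eq inner_add_left sum.distrib)
  show "(a *\<^sub>R U) \<bullet> V = a * (U \<bullet> V)"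
    by (subst (1 2) inner_colmat_superset[of ?K])
       (auto simp: scaleR_colmat.rep_eq sum_distrib_left)
  show "0 \<le> U \<bullet> U" by (simp add: inner_colmat_def sum_nonneg)
  show "U \<bullet> U = 0 \<longleftrightarrow> U = 0"
  proof
    assume "U \<bullet> U = 0"
    then have "col U j = 0" for j
      by (auto simp: inner_colmat_def sum_nonneg_eq_0_iff)
    then show "U = 0" by (simp add: col_inject[symmetric] zero_colmat.rep_eq fun_eq_iff)
  qed (simp add: inner_colmat_def zero_colmat.rep_eq)
qed (rule uniformity_colmat_def open_colmat_def)+

end

definition cols :: "nat \<Rightarrow> 'n::finite colmat set"
  where "cols s = {U. \<forall>j\<ge>s. col U j = 0}"

definition unit_ball :: "nat \<Rightarrow> 'n::finite colmat set"
  where "unit_ball s = {U \<in> cols s. norm U \<le> 1}"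

text \<open>\<open>gram U\<close> is \<open>U U\<^sup>T\<close>, the sum of \<open>u u\<^sup>T\<close> over the columns \<open>u\<close> of \<open>U\<close>.\<close>

definition gram :: "'n::finite colmat \<Rightarrow> 'n symmat"
  where "gram U = (\<Sum>j | col U j \<noteq> 0. outer (col U j))"

lift_definition mult_cols :: "'n::finite symmat \<Rightarrow> 'n colmat \<Rightarrow> 'n colmat"
  is "\<lambda>G U j. G *v U j"
  by (rule finite_subset) (auto simp: matrix_vector_mult_0_right)

text \<open>\<open>hcat s U y\<close> is \<open>[U, y]\<close> for \<open>U\<close> in \<open>cols s\<close>.\<close>

lift_definition hcat :: "nat \<Rightarrow> 'n::finite colmat \<Rightarrow> real^'n \<Rightarrow> 'n colmat"
  is "\<lambda>s U y j. if j < s then U j else if j = s then y else 0"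
  subgoal for s U y by (rule finite_subset[of _ "{..s}"]) auto
  done


section \<open>Gradients\<close>

text \<open>The gradient of a function on the Euclidean space \<open>E\<close>, a subspace of the type.\<close>

definition gradient_on :: "'a::real_inner set \<Rightarrow> ('a \<Rightarrow> real) \<Rightarrow> 'a \<Rightarrow> 'a"
  where "gradient_on E f x =
    (THE D. D \<in> E \<and> (f has_derivative (\<lambda>h. D \<bullet> h)) (at x within E))"

definition linearization :: "'a::real_inner set \<Rightarrow> ('a \<Rightarrow> real) \<Rightarrow> 'a \<Rightarrow> 'a \<Rightarrow> real"
  where "linearization E \<psi> u x = \<psi> x + gradient_on E \<psi> x \<bullet> (u - x)"

definition indicator_fn :: "'a set \<Rightarrow> 'a \<Rightarrow> ereal"
  where "indicator_fn S x = (if x \<in> S then 0 else \<infinity>)"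


section \<open>Iterative methods\<close>

text \<open>A method is given by its passes: starting from a state, a pass either leads to the state
  for the next pass, or stops the method with an output, or does not end, because it calls a
  subroutine that has an execution that runs forever or gets stuck. Passes are relations, because some
  choices (admissible parameters, eigenvectors, minimizers) are left open; the statements below
  are about all possible choices.\<close>

datatype ('s, 'r) outcome = Continue 's | Stop 'r | Hang

type_synonym ('s, 'r) method_pass = "'s \<Rightarrow> ('s, 'r) outcome \<Rightarrow> bool"

inductive returns :: "('s, 'r) method_pass \<Rightarrow> 's \<Rightarrow> 'r \<Rightarrow> bool" for pass where
  stop: "pass s (Stop r) \<Longrightarrow> returns pass s r"
| continue: "pass s (Continue s') \<Longrightarrow> returns pass s' r \<Longrightarrow> returns pass s r"

text \<open>\<open>halts pass s\<close>: every execution from \<open>s\<close> stops after finitely many passes. As the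
  predicate is inductive, infinite executions are excluded.\<close>

inductive halts :: "('s, 'r) method_pass \<Rightarrow> 's \<Rightarrow> bool" for pass where
  "\<exists>out. pass s out \<Longrightarrow> \<not> pass s Hang \<Longrightarrow>
    (\<And>s'. pass s (Continue s') \<Longrightarrow> halts pass s') \<Longrightarrow> halts pass s"


section \<open>ADAP-FISTA\<close>

text \<open>State \<open>(A\<^sub>i, \<tau>\<^sub>i, L, x\<^sub>i, y\<^sub>i)\<close>, where \<open>L\<close> is the current value of \<open>L\<^sub>i\<^sub>+\<^sub>1\<close>; a pass is one
  execution of step (2), followed by steps (3) to (5) if its test succeeds. The output is
  \<open>None\<close> for failure and \<open>Some (y, v, L)\<close> for success. \<open>E\<close> is the ambient Euclidean space.\<close>

definition adap_fista_pass ::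
  "real \<Rightarrow> real \<Rightarrow> 'a::real_inner set \<Rightarrow> 'a \<Rightarrow> real \<Rightarrow> ('a \<Rightarrow> real) \<Rightarrow> ('a \<Rightarrow> ereal) \<Rightarrow>
    (real \<times> real \<times> real \<times> 'a \<times> 'a, ('a \<times> 'a \<times> real) option) method_pass"
  where "adap_fista_pass \<sigma> chi E x0 \<mu> \<psi>s \<psi>n = (\<lambda>(A, \<tau>, L, x, y) out.
    let a = (\<tau> + sqrt (\<tau>\<^sup>2 + 4 * \<tau> * A * (L - \<mu>))) / (2 * (L - \<mu>));
        xt = (A *\<^sub>R y + a *\<^sub>R x) /\<^sub>R (A + a)
    in \<exists>y'.
      is_arg_min
        (\<lambda>u. ereal (linearization E \<psi>s u xt) + \<psi>n u + ereal (L / 2 * (norm (u - xt))\<^sup>2))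
        (\<lambda>u. u \<in> E \<and> \<psi>n u < \<infinity>) y' \<and>
      out =
       (if \<not> linearization E \<psi>s y' xt + (1 - chi) * L / 4 * (norm (y' - xt))\<^sup>2 \<ge> \<psi>s y'
        then Continue (A, \<tau>, 2 * L, x, y)
        else
          let A' = A + a;
              \<tau>' = \<tau> + a * \<mu>;
              s' = (L - \<mu>) *\<^sub>R (xt - y');
              x' = ((\<mu> * a) *\<^sub>R y' + \<tau> *\<^sub>R x - a *\<^sub>R s') /\<^sub>R \<tau>';
              v' = gradient_on E \<psi>s y' - gradient_on E \<psi>s xt + L *\<^sub>R (xt - y')
          in if \<not> (norm (y' - x0))\<^sup>2 \<ge> chi * A' * L * (norm (y' - xt))\<^sup>2
             then Stop None
             else if norm v' \<le> \<sigma> * norm (y' - x0)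
             then Stop (Some (y', v', L))
             else Continue (A', \<tau>', L, x', y')))"

definition adap_fista_init :: "'a \<Rightarrow> real \<Rightarrow> real \<times> real \<times> real \<times> 'a \<times> 'a"
  where "adap_fista_init x0 L0 = (0, 1, L0, x0, x0)"


section \<open>ADAP-AIPP\<close>

text \<open>State \<open>(W\<^sub>j\<^sub>-\<^sub>1, \<lambda>, M, N)\<close> with \<open>M\<close> the bound \<open>M\<^sub>j\<^sub>-\<^sub>1\<close> from the previous iteration and \<open>N\<close>
  the number of calls of ADAP-FISTA so far; a pass is one execution of steps (1) to (3).
  The output is \<open>(W\<^sub>j, R\<^sub>j, N)\<close>.\<close>

definition adap_aipp_pass ::
  "real \<Rightarrow> real \<Rightarrow> nat \<Rightarrow> ('n::finite symmat \<Rightarrow> real) \<Rightarrow> real \<Rightarrow>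
    ('n colmat \<times> real \<times> real \<times> nat, 'n colmat \<times> 'n colmat \<times> nat) method_pass"
  where "adap_aipp_pass \<sigma> chi s g \<rho> = (\<lambda>(W0, lam, M, N) out.
    let gt = (\<lambda>U. g (gram U));
        \<psi>s = (\<lambda>U. lam * gt U + 1 / 2 * (norm (U - W0))\<^sup>2);
        \<psi>n = (\<lambda>U. ereal lam * indicator_fn (unit_ball s) U);
        fista = adap_fista_pass \<sigma> chi (cols s) W0 (1 / 2) \<psi>s \<psi>n
    in \<exists>L0. 1 \<le> L0 \<and> L0 \<le> M \<and>
      (\<not> halts fista (adap_fista_init W0 L0) \<and> out = Hang \<or>
       (\<exists>res. returns fista (adap_fista_init W0 L0) res \<and>
        out = (case res of
            None \<Rightarrow> Continue (W0, lam / 2, M, N + 1)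
          | Some (W, V, L) \<Rightarrow>
              if \<not> lam * gt W0 - (lam * gt W + 1 / 2 * (norm (W - W0))\<^sup>2) \<ge> V \<bullet> (W0 - W)
              then Continue (W0, lam / 2, M, N + 1)
              else
                let R = (V + W0 - W) /\<^sub>R lam
                in if norm R \<le> \<rho> then Stop (W, R, N + 1)
                   else Continue (W, lam, L, N + 1)))))"

definition adap_aipp_init :: "'n::finite colmat \<Rightarrow> real \<Rightarrow> 'n colmat \<times> real \<times> real \<times> nat"
  where "adap_aipp_init W lam0 = (W, lam0, 1, 0)"


section \<open>HLR\<close>

record effort =
  hlr_iterations :: nat
  min_eigenvectors :: nat
  fista_calls :: nat

definition no_effort :: effort
  where "no_effort = \<lparr>hlr_iterations = 0, min_eigenvectors = 0, fista_calls = 0\<rparr>"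

definition add_effort :: "effort \<Rightarrow> effort \<Rightarrow> effort"
  where "add_effort c d =
    \<lparr>hlr_iterations = hlr_iterations c + hlr_iterations d,
     min_eigenvectors = min_eigenvectors c + min_eigenvectors d,
     fista_calls = fista_calls c + fista_calls d\<rparr>"

text \<open>State: the initial point of the current iteration, its number \<open>s\<close> of columns, and the effort
  so far. A pass is one iteration, which computes one minimum eigenvector. The output is
  \<open>(Y\<^sub>k, s, \<theta>\<^sub>k)\<close> together with the total effort.\<close>

definition hlr_pass ::
  "real \<Rightarrow> real \<Rightarrow> ('n::finite symmat \<Rightarrow> real) \<Rightarrow> real \<Rightarrow> real \<Rightarrow> real \<Rightarrow>
    ('n colmat \<times> nat \<times> effort, 'n colmat \<times> nat \<times> real \<times> effort) method_pass"
  where "hlr_pass \<sigma> chi g \<epsilon> \<rho> lam0 = (\<lambda>(Y0, s, c) out.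
    let aipp = adap_aipp_pass \<sigma> chi s g \<rho>
    in \<not> halts aipp (adap_aipp_init Y0 lam0) \<and> out = Hang \<or>
      (\<exists>Y R N y. returns aipp (adap_aipp_init Y0 lam0) (Y, R, N) \<and>
        (let G = gradient_on UNIV g (gram Y);
             \<theta> = max (- lambda_min G) 0;
             \<epsilon>k = mult_cols G Y \<bullet> Y + \<theta>;
             c' = add_effort c \<lparr>hlr_iterations = 1, min_eigenvectors = 1, fista_calls = N\<rparr>
         in (if \<theta> > 0 then is_v_min G y else y = 0) \<and>
            (if \<epsilon>k \<le> \<epsilon> then out = Stop (Y, s, \<theta>, c')
             else \<exists>\<alpha>.
               is_arg_min (\<lambda>\<alpha>. g (\<alpha> *\<^sub>R outer y + (1 - \<alpha>) *\<^sub>R gram Y)) (\<lambda>\<alpha>. \<alpha> \<in> {0..1}) \<alpha> \<and>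
               out = Continue
                (if \<alpha> = 1 then (hcat 0 0 y, 1, c')
                 else (hcat s (sqrt (1 - \<alpha>) *\<^sub>R Y) (sqrt \<alpha> *\<^sub>R y), s + 1, c'))))))"


section \<open>HALLaR\<close>

definition aug_lagrangian ::
  "'n::finite symmat \<Rightarrow> ('n symmat \<Rightarrow> real^'m) \<Rightarrow> real^'m \<Rightarrow> real \<Rightarrow> real^'m \<Rightarrow> 'n symmat \<Rightarrow> real"
  where "aug_lagrangian C \<A> b \<beta> p X =
    C \<bullet> X + p \<bullet> (\<A> X - b) + \<beta> / 2 * (norm (\<A> X - b))\<^sup>2"

definition eps_bar :: "real \<Rightarrow> real \<Rightarrow> real \<Rightarrow> real"
  where "eps_bar \<epsilon>p \<epsilon>c \<beta> = min \<epsilon>c (\<epsilon>p\<^sup>2 * \<beta> / 6)"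

text \<open>State: \<open>(U\<^sub>t\<^sub>-\<^sub>1, s\<^sub>t\<^sub>-\<^sub>1, p\<^sub>t\<^sub>-\<^sub>1, t - 1)\<close> and the effort so far; a pass is one iteration.
  The output is the returned triple, the number \<open>T\<close> of iterations, and the total effort.\<close>

definition hallar_pass ::
  "real \<Rightarrow> real \<Rightarrow> 'n::finite symmat \<Rightarrow> ('n symmat \<Rightarrow> real^'m) \<Rightarrow> real^'m \<Rightarrow>
    real \<Rightarrow> real \<Rightarrow> real \<Rightarrow> real \<Rightarrow> real \<Rightarrow>
    ('n colmat \<times> nat \<times> (real^'m) \<times> nat \<times> effort,
     'n symmat \<times> (real^'m) \<times> real \<times> nat \<times> effort) method_pass"
  where "hallar_pass \<sigma> chi C \<A> b \<epsilon>p \<epsilon>c \<beta> \<rho> lam0 = (\<lambda>(U0, s0, p0, t, c) out.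
    let hlr = hlr_pass \<sigma> chi (aug_lagrangian C \<A> b \<beta> p0) (eps_bar \<epsilon>p \<epsilon>c \<beta>) \<rho> lam0
    in \<not> halts hlr (U0, s0, no_effort) \<and> out = Hang \<or>
      (\<exists>U s \<theta> d. returns hlr (U0, s0, no_effort) (U, s, \<theta>, d) \<and>
        (let r = \<A> (gram U) - b;
             p = p0 + \<beta> *\<^sub>R r;
             c' = add_effort c d
         in out =
          (if norm r \<le> \<epsilon>p
           then Stop (gram U, p, max (- lambda_min (C + adjoint \<A> p)) 0, t + 1, c')
           else Continue (U, s, p, t + 1, c')))))"

definition hallar_init ::
  "'n::finite colmat \<Rightarrow> nat \<Rightarrow> real^'m \<Rightarrow> 'n colmat \<times> nat \<times> (real^'m) \<times> nat \<times> effort"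
  where "hallar_init U0 s0 p0 = (U0, s0, p0, 0, no_effort)"


section \<open>The pair of semidefinite programs\<close>

definition primal_feasible ::
  "('n::finite symmat \<Rightarrow> real^'m) \<Rightarrow> real^'m \<Rightarrow> 'n symmat set"
  where "primal_feasible \<A> b = {X \<in> Delta. \<A> X = b}"

definition dual_feasible ::
  "'n::finite symmat \<Rightarrow> ('n symmat \<Rightarrow> real^'m) \<Rightarrow> ((real^'m) \<times> real) set"
  where "dual_feasible C \<A> = {(p, \<theta>). psd (C + adjoint \<A> p + \<theta> *\<^sub>R sym_id) \<and> \<theta> \<ge> 0}"

definition dual_value :: "real^'m \<Rightarrow> (real^'m) \<times> real \<Rightarrow> real"
  where "dual_value b = (\<lambda>(p, \<theta>). - (b \<bullet> p) - \<theta>)"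

definition primal_optimal ::
  "'n::finite symmat \<Rightarrow> ('n symmat \<Rightarrow> real^'m) \<Rightarrow> real^'m \<Rightarrow> 'n symmat \<Rightarrow> bool"
  where "primal_optimal C \<A> b = is_arg_min (\<lambda>X. C \<bullet> X) (\<lambda>X. X \<in> primal_feasible \<A> b)"

definition dual_optimal ::
  "'n::finite symmat \<Rightarrow> ('n symmat \<Rightarrow> real^'m) \<Rightarrow> real^'m \<Rightarrow> (real^'m) \<times> real \<Rightarrow> bool"
  where "dual_optimal C \<A> b = is_arg_max (dual_value b) (\<lambda>q. q \<in> dual_feasible C \<A>)"

definition approx_solution ::
  "'n::finite symmat \<Rightarrow> ('n symmat \<Rightarrow> real^'m) \<Rightarrow> real^'m \<Rightarrow> real \<Rightarrow> real \<Rightarrow>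
    'n symmat \<Rightarrow> real^'m \<Rightarrow> real \<Rightarrow> bool"
  where "approx_solution C \<A> b \<epsilon>p \<epsilon>c X p \<theta> \<longleftrightarrow>
    (let S = C + adjoint \<A> p + \<theta> *\<^sub>R sym_id
     in norm (\<A> X - b) \<le> \<epsilon>p \<and> tr X \<le> 1 \<and> psd X \<and>
        psd S \<and> \<theta> \<ge> 0 \<and>
        X \<bullet> S + \<theta> * (1 - tr X) \<le> \<epsilon>c)"


section \<open>The complexity bounds\<close>

text \<open>In this section \<open>p\<close> stands for an optimal multiplier and \<open>\<epsilon>\<close> for \<^const>\<open>eps_bar\<close>.\<close>

definition F_bar ::
  "('n::finite symmat \<Rightarrow> real^'m) \<Rightarrow> real^'m \<Rightarrow> real \<Rightarrow> real \<Rightarrow> 'n symmat \<Rightarrow> real^'m \<Rightarrow> real"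
  where "F_bar \<A> b \<beta> \<epsilon> X0 p =
    \<beta> / 2 * (norm (\<A> X0 - b))\<^sup>2 +
    (5 * (norm p)\<^sup>2 + norm p * sqrt (3 * (norm p)\<^sup>2 + 2 * \<beta> * \<epsilon>)) / \<beta> + 3 * \<epsilon>"

definition G_bar ::
  "'n::finite symmat \<Rightarrow> ('n symmat \<Rightarrow> real^'m) \<Rightarrow> real^'m \<Rightarrow> real \<Rightarrow> real \<Rightarrow> real^'m \<Rightarrow> real"
  where "G_bar C \<A> b \<beta> \<epsilon> p =
    norm C + onorm \<A> * (9 * \<beta> * onorm \<A> + sqrt (4 * (norm p)\<^sup>2 + 2 * \<beta> * \<epsilon>) + \<beta> * norm b)"

text \<open>\<open>1 / curvature_bar\<close> is a lower bound for the prox stepsizes \<open>\<lambda>\<^sub>j\<close> of ADAP-AIPP.\<close>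

definition curvature_bar ::
  "'n::finite symmat \<Rightarrow> ('n symmat \<Rightarrow> real^'m) \<Rightarrow> real^'m \<Rightarrow> real \<Rightarrow> real \<Rightarrow> real \<Rightarrow> real^'m \<Rightarrow> real"
  where "curvature_bar C \<A> b \<beta> \<epsilon> lam0 p =
    max (8 * G_bar C \<A> b \<beta> \<epsilon> p + 144 * \<beta> * (onorm \<A>)\<^sup>2) (1 / lam0)"

definition log0_plus :: "real \<Rightarrow> real"
  where "log0_plus t = max (ln t) 0"

definition kappa_bar ::
  "'n::finite symmat \<Rightarrow> ('n symmat \<Rightarrow> real^'m) \<Rightarrow> real^'m \<Rightarrow> real \<Rightarrow> real \<Rightarrow> real \<Rightarrow> real^'m \<Rightarrow> int"
  where "kappa_bar C \<A> b \<beta> \<epsilon> lam0 p =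
    \<lceil>log0_plus (lam0 * curvature_bar C \<A> b \<beta> \<epsilon> lam0 p) / ln 2\<rceil>"

definition C_sigma :: "real \<Rightarrow> real"
  where "C_sigma \<sigma> = 2 * (1 - \<sigma>)\<^sup>2 / (1 - 2 * \<sigma>)"

definition P_bar ::
  "('n::finite symmat \<Rightarrow> real^'m) \<Rightarrow> real^'m \<Rightarrow> real \<Rightarrow> real \<Rightarrow> 'n symmat \<Rightarrow> real^'m \<Rightarrow> int"
  where "P_bar \<A> b \<beta> \<epsilon> X0 p =
    (let F = F_bar \<A> b \<beta> \<epsilon> X0 p
     in \<lceil>1 + 4 * Max {F, sqrt (4 * \<beta> * (onorm \<A>)\<^sup>2 * F), 4 * \<beta> * (onorm \<A>)\<^sup>2} / \<epsilon>\<rceil>)"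

definition J_bar :: "real \<Rightarrow> real \<Rightarrow> real^'m \<Rightarrow> int"
  where "J_bar \<beta> \<epsilon>p p = \<lceil>3 * (norm p)\<^sup>2 / (\<beta>\<^sup>2 * \<epsilon>p\<^sup>2)\<rceil>"

end

theory Submission
  imports Defs
begin

text \<open>HALLaR is an inexact proximal point method for the dual problem, and each layer below it has
  a potential function.

  Outermost layer. HLR returns \<open>X = U U\<^sup>T\<close> at which the Frank--Wolfe gap of the augmented
  Lagrangian over \<open>\<Delta>\<close> is at most \<open>\<epsilon>\<close>. The gradient there is \<open>C + \<A>\<^sup>* p'\<close> for the updated
  multiplier \<open>p'\<close>, so the gap is exactly the complementarity of the triple
  \<open>(X, p', \<theta>)\<close>. Comparison with \<open>X\<^sub>*\<close> and strong duality give
  \<open>\<parallel>p' - p\<^sub>*\<parallel>\<^sup>2 + \<parallel>p' - p\<parallel>\<^sup>2 \<le> \<parallel>p - p\<^sub>*\<parallel>\<^sup>2 + 2 \<beta> \<epsilon>\<close> (\<open>multiplier_step\<close>). As long as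
  \<open>X\<close> is not \<open>\<epsilon>\<^sub>p\<close>-feasible, \<open>\<parallel>p' - p\<parallel> > \<beta> \<epsilon>\<^sub>p\<close>, and a third of \<open>\<parallel>p' - p\<parallel>\<^sup>2\<close>
  absorbs the error term. This bounds the number of iterations, keeps the multipliers bounded, and
  bounds the sum of all decreases of the augmented Lagrangians (\<open>hallar_returns\<close>).

  HLR. The descent of ADAP-AIPP does not disturb the Frank--Wolfe analysis: the optimality gap
  \<open>h\<close> is at most the Frank--Wolfe gap, and a step with exact line search reduces \<open>h\<close> by
  at least \<open>(max h \<epsilon>)\<^sup>2 / (2 M)\<close>, where \<open>M\<close> is the maximum of \<open>\<epsilon>\<close> and the
  curvature constant \<open>Q = 4 \<beta> \<parallel>\<A>\<parallel>\<^sup>2\<close>, once \<open>h \<le> M / 2\<close>. The first step already brings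
  \<open>h\<close> down to \<open>Q / 2\<close>, so the number of steps does not depend on the initial point
  (\<open>fw_progress\<close>, \<open>fw_steps_le\<close>).

  ADAP-AIPP. A prox stepsize \<open>\<lambda>\<close> is halved only if ADAP-FISTA fails or the descent test fails,
  and neither happens once \<open>\<lambda>\<close> is at most half the inverse curvature of \<open>U \<mapsto> g (U U\<^sup>T)\<close> on the
  ball of radius 3. An accepted iteration that does not stop decreases \<open>g\<close> by at least
  \<open>\<lambda> \<rho>\<^sup>2 / C\<^sub>\<sigma>\<close> (\<open>prox_descent\<close>). Hence the number of calls of ADAP-FISTA is at most
  one, plus the number of halvings, plus a multiple of the total decrease of \<open>g\<close>.

  ADAP-FISTA. It halts for every prox stepsize, convex or not, because it linearizes only at points
  of the ball of radius 3, and \<open>A\<^sub>i\<close> grows by at least a fixed amount in each iteration, while the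
  iterations that continue keep it bounded (\<open>fista_halts\<close>). If the function is strongly convex,
  then the usual potential of accelerated gradient methods excludes failure
  (\<open>fista_never_fails\<close>).\<close>

section \<open>Executions of iterative methods\<close>

lemma halts_imp_returns:
  assumes "halts pass s"
  shows "\<exists>r. returns pass s r"
  using assms
proof induction
  case (1 s)
  then obtain out where out: "pass s out" by blast
  show ?case
  proof (cases out)
    case (Continue s')
    then show ?thesis using 1 out returns.continue by metis
  next
    case (Stop r)
    then show ?thesis using out returns.stop by metis
  next
    case Hang
    then show ?thesis using 1 out by blast
  qed
qed

lemma halts_by_measure:
  fixes V :: "'s \<Rightarrow> real"
  assumes init: "I s"
    and enabled: "\<And>s. I s \<Longrightarrow> \<exists>out. pass s out"
    and no_hang: "\<And>s. I s \<Longrightarrow> \<not> pass s Hang"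
    and nonneg: "\<And>s. I s \<Longrightarrow> 0 \<le> V s"
    and step: "\<And>s s'. I s \<Longrightarrow> pass s (Continue s') \<Longrightarrow> I s' \<and> V s' + 1 \<le> V s"
  shows "halts pass s"
  using init
proof (induction "nat \<lfloor>V s\<rfloor>" arbitrary: s rule: less_induct)
  case less
  show ?case
  proof (rule halts.intros)
    show "\<exists>out. pass s out" "\<not> pass s Hang"
      using less.prems enabled no_hang by auto
    fix s' assume "pass s (Continue s')"
    with step less.prems have s': "I s'" "V s' + 1 \<le> V s" by auto
    have "0 \<le> V s'" using s' nonneg by blast
    with s' have "nat \<lfloor>V s'\<rfloor> < nat \<lfloor>V s\<rfloor>" by linarith
    then show "halts pass s'" using less.hyps s' by blast
  qed
qed


section \<open>Symmetric matrices\<close>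

lemma inner_mult_vec_commute: "mult_vec S u \<bullet> v = mult_vec S v \<bullet> u"
proof -
  have "mat_of S $ i $ j = mat_of S $ j $ i" for i j
    using mat_of[of S] by (auto simp: transpose_def vec_eq_iff)
  then have "(\<Sum>i\<in>UNIV. \<Sum>j\<in>UNIV. mat_of S $ i $ j * u $ j * v $ i)
      = (\<Sum>i\<in>UNIV. \<Sum>j\<in>UNIV. mat_of S $ j $ i * u $ j * v $ i)" by simp
  also have "\<dots> = (\<Sum>j\<in>UNIV. \<Sum>i\<in>UNIV. mat_of S $ j $ i * u $ j * v $ i)"
    by (rule sum.swap)
  finally show ?thesis
    by (simp add: mult_vec.rep_eq inner_vec_def matrix_vector_mult_def sum_distrib_left
      sum_distrib_right mult_ac)
qed

lemma mult_vec_add [simp]: "mult_vec S (u + v) = mult_vec S u + mult_vec S v"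
  by transfer (rule matrix_vector_right_distrib)

lemma mult_vec_scaleR [simp]: "mult_vec S (c *\<^sub>R v) = c *\<^sub>R mult_vec S v"
  by transfer (simp add: matrix_vector_mult_scaleR)

lemma mult_vec_zero [simp]: "mult_vec S 0 = 0"
  by transfer simp

lemma mult_vec_diff [simp]: "mult_vec S (u - v) = mult_vec S u - mult_vec S v"
  by transfer (rule matrix_vector_mult_diff_distrib)

lemma mult_vec_add_left [simp]: "mult_vec (S + T) v = mult_vec S v + mult_vec T v"
  by transfer (rule matrix_vector_mult_add_rdistrib)

lemma mult_vec_diff_left [simp]: "mult_vec (S - T) v = mult_vec S v - mult_vec T v"
  by transfer (rule matrix_vector_mult_diff_rdistrib)

lemma mult_vec_scaleR_left [simp]: "mult_vec (c *\<^sub>R S) v = c *\<^sub>R mult_vec S v"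
  by transfer (simp add: scaleR_matrix_vector_assoc)

lemma mult_vec_sym_id [simp]: "mult_vec sym_id v = v"
  by transfer simp

lemma tr_add [simp]: "tr (S + T) = tr S + tr T"
  by transfer (rule trace_add)

lemma tr_scaleR [simp]: "tr (c *\<^sub>R S) = c * tr S"
  by transfer (simp add: trace_def sum_distrib_left)

lemma tr_zero [simp]: "tr 0 = 0"
  by transfer (simp add: trace_def)

lemma tr_sum: "tr (sum f K) = (\<Sum>k\<in>K. tr (f k))"
  by (induction K rule: infinite_finite_induct) auto

lemma inner_outer: "S \<bullet> outer u = u \<bullet> mult_vec S u"
  by transfer (simp add: inner_vec_def matrix_vector_mult_def sum_distrib_left mult_ac)

lemma inner_sym_id: "S \<bullet> sym_id = tr S"
  by transfer (simp add: inner_vec_def mat_def trace_def if_distrib cong: if_cong)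

lemma tr_outer: "tr (outer u) = (norm u)\<^sup>2"
  unfolding power2_norm_eq_inner by transfer (simp add: trace_def inner_vec_def)

lemma mult_vec_outer: "mult_vec (outer u) v = (u \<bullet> v) *\<^sub>R u"
  by transfer (simp add: vec_eq_iff matrix_vector_mult_def inner_vec_def sum_distrib_left mult_ac)

lemma psd_outer: "psd (outer u)"
  by (simp add: psd_def mult_vec_outer inner_commute)

lemma outer_zero [simp]: "outer 0 = 0"
  by transfer (simp add: vec_eq_iff)

lemma outer_scaleR: "outer (c *\<^sub>R u) = c\<^sup>2 *\<^sub>R outer u"
  by transfer (simp add: vec_eq_iff power2_eq_square mult_ac)

lemma psd_add: "psd S \<Longrightarrow> psd T \<Longrightarrow> psd (S + T)"
  by (simp add: psd_def inner_add_right)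

lemma psd_scaleR: "psd S \<Longrightarrow> 0 \<le> c \<Longrightarrow> psd (c *\<^sub>R S)"
  by (simp add: psd_def)

lemma psd_zero [simp]: "psd 0"
  unfolding psd_def by transfer simp

lemma psd_sum: "(\<And>k. k \<in> K \<Longrightarrow> psd (f k)) \<Longrightarrow> psd (sum f K)"
  by (induction K rule: infinite_finite_induct) (auto intro: psd_add)

lemma norm_mult_vec_le: "norm (mult_vec S v) \<le> norm S * norm v"
proof -
  have "(norm (M *v v))\<^sup>2 \<le> (norm M * norm v)\<^sup>2" for M :: "real^'a^'a"
  proof -
    have "(norm (M *v v))\<^sup>2 = (\<Sum>i\<in>UNIV. (M $ i \<bullet> v)\<^sup>2)"
      by (simp only: power2_norm_eq_inner inner_vec_def[of "M *v v"] matrix_vector_mul_component)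
        (simp add: power2_eq_square)
    also have "\<dots> \<le> (\<Sum>i\<in>UNIV. (M $ i \<bullet> M $ i) * (v \<bullet> v))"
      by (intro sum_mono Cauchy_Schwarz_ineq)
    also have "\<dots> = (M \<bullet> M) * (v \<bullet> v)"
      by (simp add: inner_vec_def[of M] sum_distrib_right)
    also have "\<dots> = (norm M * norm v)\<^sup>2"
      by (simp add: power_mult_distrib power2_norm_eq_inner)
    finally show ?thesis .
  qed
  then show ?thesis
    by (auto simp: mult_vec.rep_eq norm_symmat.rep_eq intro: power2_le_imp_le)
qed

lemma mat_of_entry: "mat_of S $ i $ j = axis i 1 \<bullet> mult_vec S (axis j 1)"
  by (simp add: mult_vec.rep_eq matrix_vector_mult_basis column_def inner_axis' )

text \<open>Self-duality of the cone of positive semidefinite matrices. A step of the Cholesky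
  factorization removes a rank-one term from \<open>X\<close> and clears one more diagonal entry.\<close>

lemma psd_inner_nonneg:
  fixes X S :: "'n::finite symmat"
  assumes "psd X" "psd S"
  shows "0 \<le> X \<bullet> S"
  using assms(1)
proof (induction "card {i. mat_of X $ i $ i \<noteq> 0}" arbitrary: X rule: less_induct)
  case less
  let ?e = "\<lambda>i. axis i 1 :: real^'n"
  have diag: "0 \<le> mat_of X $ i $ i" for i
    using less.prems by (simp add: mat_of_entry psd_def)
  show ?case
  proof (cases "\<forall>i. mat_of X $ i $ i = 0")
    case True
    have "mat_of X $ i $ j = 0" for i j
    proof -
      let ?x = "\<lambda>i j. ?e i \<bullet> mult_vec X (?e j)"
      have sym: "?x j i = ?x i j" using inner_mult_vec_commute[of X "?e i" "?e j"]
        by (simp add: inner_commute)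
      have 0: "?x i i = 0" for i using True by (simp add: mat_of_entry)
      have "0 \<le> (?e i + ?e j) \<bullet> mult_vec X (?e i + ?e j)"
        "0 \<le> (?e i - ?e j) \<bullet> mult_vec X (?e i - ?e j)"
        using less.prems unfolding psd_def by blast+
      then have "0 \<le> 2 * ?x i j" "0 \<le> - 2 * ?x i j"
        using 0[of i] 0[of j] sym by (simp_all add: inner_add_left inner_add_right
          inner_diff_left inner_diff_right del: mult_vec_sym_id)
      then show ?thesis by (simp add: mat_of_entry)
    qed
    then have "mat_of X = mat_of 0" by (simp add: vec_eq_iff zero_symmat.rep_eq)
    then have "X = 0" by (simp only: mat_of_inject)
    then show ?thesis by simp
  next
    case False
    then obtain i where "mat_of X $ i $ i \<noteq> 0" by blast
    define c where "c = mat_of X $ i $ i"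
    define w where "w = mult_vec X (?e i)"
    define X' where "X' = X - (1 / c) *\<^sub>R outer w"
    have c: "0 < c" "?e i \<bullet> w = c" using diag[of i] \<open>mat_of X $ i $ i \<noteq> 0\<close>
      by (auto simp: c_def w_def mat_of_entry)
    have quad: "v \<bullet> mult_vec X' v = v \<bullet> mult_vec X v - (w \<bullet> v)\<^sup>2 / c" for v
      by (simp add: X'_def mult_vec_outer inner_diff_right power2_eq_square inner_commute)
    have psd': "psd X'"
      unfolding psd_def
    proof
      fix v
      let ?t = "(w \<bullet> v) / c"
      let ?u = "v - ?t *\<^sub>R ?e i"
      have "0 \<le> ?u \<bullet> mult_vec X ?u" using less.prems unfolding psd_def by blast
      also have "?u \<bullet> mult_vec X ?u = v \<bullet> mult_vec X v - ?t * (v \<bullet> w) - ?t * (?e i \<bullet> mult_vec X v)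
          + ?t * ?t * (?e i \<bullet> w)"
        by (simp add: inner_diff_left inner_diff_right w_def algebra_simps)
      also have "?e i \<bullet> mult_vec X v = w \<bullet> v"
        by (simp add: w_def inner_mult_vec_commute[of X "?e i"] inner_commute[of "?e i"])
      also have "v \<bullet> mult_vec X v - ?t * (v \<bullet> w) - ?t * (w \<bullet> v) + ?t * ?t * (?e i \<bullet> w)
          = v \<bullet> mult_vec X' v"
        using c by (simp add: quad field_simps power2_eq_square inner_commute)
      finally show "0 \<le> v \<bullet> mult_vec X' v" .
    qed
    have diag': "0 \<le> mat_of X' $ j $ j" "mat_of X' $ j $ j \<le> mat_of X $ j $ j" for j
      using psd' c(1) by (simp_all add: mat_of_entry psd_def) (simp add: quad)
    have "mat_of X' $ i $ i = c - c * c / c"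
      using c by (simp add: mat_of_entry quad) (simp add: w_def[symmetric] c power2_eq_square inner_commute)
    then have i': "mat_of X' $ i $ i = 0" using c(1) by simp
    have "{j. mat_of X' $ j $ j \<noteq> 0} \<subset> {j. mat_of X $ j $ j \<noteq> 0}"
    proof
      show "{j. mat_of X' $ j $ j \<noteq> 0} \<subseteq> {j. mat_of X $ j $ j \<noteq> 0}"
        using diag' by (metis (mono_tags, lifting) Collect_mono order_antisym)
      show "{j. mat_of X' $ j $ j \<noteq> 0} \<noteq> {j. mat_of X $ j $ j \<noteq> 0}"
        using i' \<open>mat_of X $ i $ i \<noteq> 0\<close> by blast
    qed
    then have "0 \<le> X' \<bullet> S"
      by (intro less.hyps psd' psubset_card_mono) auto
    moreover have "X \<bullet> S = X' \<bullet> S + (1 / c) * (w \<bullet> mult_vec S w)"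
      by (simp add: X'_def inner_diff_left inner_commute[of "outer w"] inner_outer)
    moreover have "0 \<le> w \<bullet> mult_vec S w" using assms(2) by (simp add: psd_def)
    ultimately show ?thesis using c(1) by simp
  qed
qed

lemma Delta_convex:
  assumes "X \<in> Delta" "Y \<in> Delta" "0 \<le> a" "a \<le> 1"
  shows "a *\<^sub>R X + (1 - a) *\<^sub>R Y \<in> Delta"
proof -
  have "a * tr X + (1 - a) * tr Y \<le> a * 1 + (1 - a) * 1"
    using assms unfolding Delta_def by (intro add_mono mult_left_mono) auto
  then show ?thesis
    using assms unfolding Delta_def by (auto intro!: psd_add psd_scaleR)
qed

text \<open>The minimum eigenvalue is the minimum of the Rayleigh quotient.\<close>

lemma min_eigenpair_exists:
  fixes Q :: "'n::finite symmat"
  obtains v where "is_v_min Q v" "\<And>w. lambda_min Q * (norm w)\<^sup>2 \<le> w \<bullet> mult_vec Q w"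
proof -
  let ?q = "\<lambda>v. v \<bullet> mult_vec Q v"
  have "continuous_on (sphere 0 1) ?q"
    unfolding mult_vec.rep_eq
    by (intro continuous_intros matrix_vector_mult_linear_continuous_on)
  moreover have "sphere (0 :: real^'n) 1 \<noteq> {}" by auto
  ultimately obtain v where v: "norm v = 1" "\<And>w. norm w = 1 \<Longrightarrow> ?q v \<le> ?q w"
    using continuous_attains_inf[of "sphere 0 1" ?q] by (auto simp: dist_norm)
  define l where "l = ?q v"
  have ray: "l * (norm w)\<^sup>2 \<le> ?q w" for w
  proof (cases "w = 0")
    case False
    have "l \<le> ?q ((1 / norm w) *\<^sub>R w)" unfolding l_def using False by (intro v) auto
    also have "\<dots> = ?q w / (norm w)\<^sup>2" by (simp add: power2_eq_square)
    finally show ?thesis using False by (simp add: field_simps)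
  qed simp
  have "mult_vec Q v = l *\<^sub>R v"
  proof -
    define z where "z = mult_vec Q v - l *\<^sub>R v"
    \<comment> \<open>The nonnegative quadratic form of \<open>Q - l I\<close> vanishes at \<open>v\<close>, so its gradient \<open>2 z\<close> there
      is zero.\<close>
    have pos: "0 \<le> 2 * t * (z \<bullet> z) + t\<^sup>2 * (?q z - l * (norm z)\<^sup>2)" for t
    proof -
      have "0 \<le> ?q (v + t *\<^sub>R z) - l * (norm (v + t *\<^sub>R z))\<^sup>2"
        using ray[of "v + t *\<^sub>R z"] by linarith
      also have "(norm (v + t *\<^sub>R z))\<^sup>2 = 1 + 2 * t * (v \<bullet> z) + t\<^sup>2 * (norm z)\<^sup>2"
        using v(1) unfolding power2_norm_eq_inner
        by (simp add: norm_eq_1 inner_add_left inner_add_right algebra_simps power2_eq_square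
          inner_commute[of z v])
      also have "?q (v + t *\<^sub>R z) = l + 2 * t * (mult_vec Q v \<bullet> z) + t\<^sup>2 * ?q z"
        using inner_mult_vec_commute[of Q v z]
        by (simp add: l_def inner_add_left inner_add_right algebra_simps power2_eq_square inner_commute)
      also have "mult_vec Q v \<bullet> z = z \<bullet> z + l * (v \<bullet> z)"
        by (simp add: z_def algebra_simps inner_diff_left inner_diff_right inner_commute)
      finally show ?thesis by (simp add: algebra_simps)
    qed
    have "z \<bullet> z = 0"
    proof (rule ccontr)
      assume nz: "z \<bullet> z \<noteq> 0"
      define k where "k = ?q z - l * (norm z)\<^sup>2"
      have k: "0 \<le> k" using ray by (simp add: k_def)
      have zz: "0 < z \<bullet> z" using nz by (simp add: less_le)
      define t where "t = - (z \<bullet> z) / (k + 1)"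
      have t: "t < 0" using zz k by (simp add: t_def field_simps)
      have "0 \<le> t * (2 * (z \<bullet> z) + t * k)"
        using pos[of t] by (simp add: k_def algebra_simps power2_eq_square)
      then have "2 * (z \<bullet> z) + t * k \<le> 0" using t by (simp add: zero_le_mult_iff)
      moreover have "t * k \<ge> - (z \<bullet> z)"
        using k zz by (simp add: t_def field_simps)
      ultimately show False using zz by linarith
    qed
    then show ?thesis by (simp add: z_def)
  qed
  then have ep: "eigenpair Q l v" using v(1) by (auto simp: eigenpair_def)
  have "lambda_min Q = l"
    unfolding lambda_min_def
  proof (rule Least_equality)
    show "\<exists>v. eigenpair Q l v" using ep by blast
    fix m assume "\<exists>w. eigenpair Q m w"
    then obtain w where "w \<noteq> 0" "mult_vec Q w = m *\<^sub>R w" by (auto simp: eigenpair_def)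
    then show "l \<le> m" using ray[of w] by (simp add: power2_norm_eq_inner)
  qed
  then show thesis using that[of v] ep v(1) ray by (simp add: is_v_min_def)
qed

lemma psd_shift_lambda_min:
  fixes Q :: "'n::finite symmat"
  assumes "\<theta> = max (- lambda_min Q) 0"
  shows "psd (Q + \<theta> *\<^sub>R sym_id)"
  unfolding psd_def
proof
  fix v :: "real^'n"
  obtain u where u: "is_v_min Q u" "\<And>w. lambda_min Q * (norm w)\<^sup>2 \<le> w \<bullet> mult_vec Q w"
    using min_eigenpair_exists[of Q] by metis
  have "- \<theta> * (norm v)\<^sup>2 \<le> lambda_min Q * (norm v)\<^sup>2"
    using assms by (intro mult_right_mono) auto
  then show "0 \<le> v \<bullet> mult_vec (Q + \<theta> *\<^sub>R sym_id) v"
    using u(2)[of v] by (simp add: inner_add_right power2_norm_eq_inner)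
qed

lemma inner_ge_neg_theta:
  assumes "\<theta> = max (- lambda_min Q) 0" "X \<in> Delta"
  shows "- \<theta> \<le> Q \<bullet> X"
proof -
  have "0 \<le> X \<bullet> (Q + \<theta> *\<^sub>R sym_id)"
    using assms by (intro psd_inner_nonneg psd_shift_lambda_min) (auto simp: Delta_def)
  also have "\<dots> = Q \<bullet> X + \<theta> * tr X"
    by (simp add: inner_add_right inner_sym_id inner_commute[of X Q])
  also have "\<theta> * tr X \<le> \<theta> * 1"
    using assms by (intro mult_left_mono) (auto simp: Delta_def)
  finally show ?thesis by simp
qed


section \<open>Matrices with a variable number of columns\<close>

lemma subspace_cols: "subspace (cols s)"
  by (simp add: subspace_def cols_def zero_colmat.rep_eq plus_colmat.rep_eq scaleR_colmat.rep_eq)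

lemma gram_superset:
  assumes "finite K" "{j. col U j \<noteq> 0} \<subseteq> K"
  shows "gram U = (\<Sum>j\<in>K. outer (col U j))"
  unfolding gram_def using assms by (intro sum.mono_neutral_left) auto

lemma tr_gram: "tr (gram U) = (norm U)\<^sup>2"
  by (simp add: gram_def tr_sum tr_outer power2_norm_eq_inner[of U] inner_colmat_def power2_norm_eq_inner)

lemma psd_gram: "psd (gram U)"
  unfolding gram_def by (intro psd_sum psd_outer)

lemma gram_in_Delta: "norm U \<le> 1 \<Longrightarrow> gram U \<in> Delta"
  by (simp add: Delta_def psd_gram tr_gram power_le_one)

lemma gram_zero [simp]: "gram 0 = 0"
  by (simp add: gram_def zero_colmat.rep_eq)

lemma inner_gram: "S \<bullet> gram U = mult_cols S U \<bullet> U"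
  unfolding inner_commute[of "mult_cols S U"]
  by (simp add: gram_def inner_sum_right inner_outer inner_colmat_def mult_cols.rep_eq
    mult_vec.rep_eq)

lemma mult_cols_in_cols: "U \<in> cols s \<Longrightarrow> mult_cols G U \<in> cols s"
  by (simp add: cols_def mult_cols.rep_eq)

lemma mult_cols_diff [simp]: "mult_cols G (U - V) = mult_cols G U - mult_cols G V"
  by transfer (simp add: fun_eq_iff matrix_vector_mult_diff_distrib)

lemma mult_cols_diff_left [simp]: "mult_cols (G - H) U = mult_cols G U - mult_cols H U"
  by transfer (simp add: fun_eq_iff matrix_vector_mult_diff_rdistrib)

lemma inner_mult_cols_commute: "mult_cols G U \<bullet> V = mult_cols G V \<bullet> U"
proof -
  let ?K = "{j. col U j \<noteq> 0} \<union> {j. col V j \<noteq> 0}"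
  have "mult_cols G U \<bullet> V = (\<Sum>j\<in>?K. mult_vec G (col U j) \<bullet> col V j)"
    by (subst inner_colmat_superset[of ?K]) (auto simp: mult_cols.rep_eq mult_vec.rep_eq)
  also have "\<dots> = (\<Sum>j\<in>?K. mult_vec G (col V j) \<bullet> col U j)"
    by (simp add: inner_mult_vec_commute)
  also have "\<dots> = mult_cols G V \<bullet> U"
    by (subst inner_colmat_superset[of ?K]) (auto simp: mult_cols.rep_eq mult_vec.rep_eq)
  finally show ?thesis .
qed

lemma norm_mult_cols_le: "norm (mult_cols G U) \<le> norm G * norm U"
proof (rule power2_le_imp_le)
  let ?K = "{j. col U j \<noteq> 0}"
  have "(norm (mult_cols G U))\<^sup>2 = (\<Sum>j\<in>?K. (norm (mult_vec G (col U j)))\<^sup>2)"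
    unfolding power2_norm_eq_inner
    by (subst inner_colmat_superset[of ?K]) (auto simp: mult_cols.rep_eq mult_vec.rep_eq)
  also have "\<dots> \<le> (\<Sum>j\<in>?K. (norm G)\<^sup>2 * (norm (col U j))\<^sup>2)"
    unfolding power_mult_distrib[symmetric]
    by (intro sum_mono power_mono norm_mult_vec_le) auto
  also have "\<dots> = (norm G * norm U)\<^sup>2"
    unfolding power_mult_distrib sum_distrib_left[symmetric]
    by (simp add: power2_norm_eq_inner[of U] inner_colmat_def power2_norm_eq_inner)
  finally show "(norm (mult_cols G U))\<^sup>2 \<le> (norm G * norm U)\<^sup>2" .
qed simp

lemma inner_gram_diff: "G \<bullet> (gram V - gram U) = mult_cols G (V - U) \<bullet> (V + U)"
  by (simp add: inner_diff_right inner_gram inner_diff_left inner_add_right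
    inner_mult_cols_commute[of G U V])

lemma norm_gram_diff_le: "norm (gram V - gram U) \<le> (norm V + norm U) * norm (V - U)"
proof (cases "gram V - gram U = 0")
  case False
  let ?Z = "gram V - gram U"
  have "norm ?Z * norm ?Z = mult_cols ?Z (V - U) \<bullet> (V + U)"
    by (metis inner_gram_diff power2_eq_square power2_norm_eq_inner)
  also have "\<dots> \<le> norm (mult_cols ?Z (V - U)) * norm (V + U)"
    by (rule norm_cauchy_schwarz)
  also have "\<dots> \<le> (norm ?Z * norm (V - U)) * (norm V + norm U)"
    by (intro mult_mono norm_mult_cols_le norm_triangle_ineq) auto
  finally have "norm ?Z * norm ?Z \<le> norm ?Z * ((norm V + norm U) * norm (V - U))"
    by (simp add: mult_ac)
  then show ?thesis using False by simp
qed (simp only: norm_zero, simp)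

lemma norm_gram_le: "norm (gram U) \<le> (norm U)\<^sup>2"
  using norm_gram_diff_le[of U 0] by (simp add: power2_eq_square)

lemma gram_scaleR: "gram (c *\<^sub>R U) = c\<^sup>2 *\<^sub>R gram U"
proof -
  have "gram (c *\<^sub>R U) = (\<Sum>j | col U j \<noteq> 0. outer (col (c *\<^sub>R U) j))"
    by (rule gram_superset) (auto simp: scaleR_colmat.rep_eq)
  then show ?thesis
    by (simp add: scaleR_colmat.rep_eq outer_scaleR gram_def scaleR_sum_right)
qed

lemma gram_hcat:
  assumes "U \<in> cols s"
  shows "gram (hcat s U y) = gram U + outer y"
proof -
  have "gram (hcat s U y) = (\<Sum>j\<in>insert s {..<s}. outer (col (hcat s U y) j))"
    by (rule gram_superset) (auto simp: hcat.rep_eq split: if_splits)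
  also have "\<dots> = outer y + (\<Sum>j<s. outer (col U j))"
    by (simp add: hcat.rep_eq)
  also have "(\<Sum>j<s. outer (col U j)) = gram U"
    by (rule gram_superset[symmetric]) (use assms in \<open>auto simp: cols_def not_le[symmetric]\<close>)
  finally show ?thesis by (simp add: add.commute)
qed

lemma hcat_in_cols: "hcat s U y \<in> cols (Suc s)"
  by (simp add: cols_def hcat.rep_eq)

lemma in_unit_ball_iff: "U \<in> unit_ball s \<longleftrightarrow> U \<in> cols s \<and> tr (gram U) \<le> 1"
  by (simp add: unit_ball_def tr_gram power_le_one_iff abs_square_le_1)


section \<open>Gradients\<close>

lemma gradient_on_eqI:
  assumes "subspace E" "x \<in> E" "D \<in> E" "(f has_derivative (\<lambda>h. D \<bullet> h)) (at x within E)"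
  shows "gradient_on E f x = D"
  unfolding gradient_on_def
proof (rule the_equality)
  show "D \<in> E \<and> (f has_derivative (\<lambda>h. D \<bullet> h)) (at x within E)" using assms by blast
  fix D' assume D': "D' \<in> E \<and> (f has_derivative (\<lambda>h. D' \<bullet> h)) (at x within E)"
  let ?h = "D' - D"
  let ?l = "\<lambda>t :: real. x + t *\<^sub>R ?h"
  have h: "?h \<in> E" using D' assms by (intro subspace_diff) auto
  have l: "(?l has_derivative (\<lambda>t. t *\<^sub>R ?h)) (at 0 within UNIV)"
    by (auto intro!: derivative_eq_intros)
  have img: "?l ` UNIV \<subseteq> E"
    using h assms by (auto intro!: subspace_add subspace_scale)
  have d: "((f \<circ> ?l) has_derivative (\<lambda>t. t * (G \<bullet> ?h))) (at 0)"
    if "(f has_derivative (\<lambda>h. G \<bullet> h)) (at x within E)" for G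
    using that diff_chain_within[OF l, of f "\<lambda>h. G \<bullet> h"] img
      has_derivative_subset[of f "\<lambda>h. G \<bullet> h" x E "range ?l"] by (simp add: o_def)
  have "(\<lambda>t. t * (D' \<bullet> ?h)) = (\<lambda>t. t * (D \<bullet> ?h))"
    using has_derivative_unique[OF d d] D' assms by blast
  then have "D' \<bullet> ?h = D \<bullet> ?h" by (metis mult_1)
  then have "?h \<bullet> ?h = 0" by (simp add: inner_diff_left)
  then show "D' = D" by simp
qed

lemma has_derivative_from_quadratic_bound:
  fixes f :: "'a::real_inner \<Rightarrow> real"
  assumes "\<And>u. u \<in> E \<Longrightarrow> norm (u - x) \<le> 1 \<Longrightarrow> \<bar>f u - f x - D \<bullet> (u - x)\<bar> \<le> K * (norm (u - x))\<^sup>2"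
  shows "(f has_derivative (\<lambda>h. D \<bullet> h)) (at x within E)"
proof (rule has_derivativeI)
  show "bounded_linear (\<lambda>h. D \<bullet> h)" by (rule bounded_linear_inner_right)
  show "((\<lambda>y. (f y - f x - D \<bullet> (y - x)) /\<^sub>R norm (y - x)) \<longlongrightarrow> 0) (at x within E)"
  proof (rule Lim_null_comparison)
    show "\<forall>\<^sub>F y in at x within E. norm ((f y - f x - D \<bullet> (y - x)) /\<^sub>R norm (y - x))
        \<le> K * norm (y - x)"
      unfolding eventually_at
    proof (intro exI[of _ 1] conjI ballI impI)
      fix y assume y: "y \<in> E" "y \<noteq> x \<and> dist y x < 1"
      then have "\<bar>f y - f x - D \<bullet> (y - x)\<bar> \<le> K * (norm (y - x))\<^sup>2"
        by (intro assms) (auto simp: dist_norm)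
      then show "norm ((f y - f x - D \<bullet> (y - x)) /\<^sub>R norm (y - x)) \<le> K * norm (y - x)"
        using y by (simp add: divide_simps power2_eq_square mult_ac)
    qed simp
    have "((\<lambda>y. norm (y - x)) \<longlongrightarrow> norm (x - x)) (at x within E)"
      by (intro tendsto_intros)
    then show "((\<lambda>y. K * norm (y - x)) \<longlongrightarrow> 0) (at x within E)"
      using tendsto_mult_right_zero by fastforce
  qed
qed


section \<open>ADAP-FISTA\<close>

text \<open>Completing the square turns step (2) of ADAP-FISTA into a projection onto the unit ball.\<close>

lemma quadratic_complete_square:
  fixes x u d :: "'a::real_inner"
  assumes "0 < L"
  shows "d \<bullet> (u - x) + L / 2 * (norm (u - x))\<^sup>2
    = L / 2 * (norm (u - (x - d /\<^sub>R L)))\<^sup>2 - (norm d)\<^sup>2 / (2 * L)"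
proof -
  define w where "w = u - x"
  have w: "u - (x - d /\<^sub>R L) = w + d /\<^sub>R L" by (simp add: w_def)
  show ?thesis
    using assms unfolding w w_def[symmetric] power2_norm_eq_inner
    by (simp add: inner_add_left inner_add_right inner_commute[of w d] field_simps)
qed

text \<open>The projection onto the unit ball is explicit, so no completeness of the space is needed.\<close>

lemma ball_projection_minimizes:
  fixes z u :: "'a::real_inner"
  assumes "norm u \<le> 1"
  shows "norm (z /\<^sub>R max 1 (norm z) - z) \<le> norm (u - z)"
proof (cases "norm z \<le> 1")
  case False
  then have "z /\<^sub>R max 1 (norm z) - z = (1 / norm z - 1) *\<^sub>R z"
    by (simp add: max_def scaleR_diff_left divide_inverse)
  then have "norm (z /\<^sub>R max 1 (norm z) - z) = \<bar>1 / norm z - 1\<bar> * norm z" by simp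
  also have "\<bar>1 / norm z - 1\<bar> = 1 - 1 / norm z"
    using False by (intro abs_of_neg[THEN trans]) (auto simp: divide_less_eq)
  also have "(1 - 1 / norm z) * norm z = norm z - 1" using False by (auto simp: field_simps)
  also have "\<dots> \<le> norm (u - z)"
    using norm_triangle_ineq2[of z u] assms by (simp add: norm_minus_commute)
  finally show ?thesis .
qed (simp add: max_def)

lemma first_order_condition:
  fixes d :: "'a::real_inner"
  assumes min: "\<And>u. u \<in> N \<Longrightarrow>
      d \<bullet> (y - x) + L / 2 * (norm (y - x))\<^sup>2 \<le> d \<bullet> (u - x) + L / 2 * (norm (u - x))\<^sup>2"
    and "convex N" "y \<in> N" "w \<in> N" "0 < L"
  shows "0 \<le> (d + L *\<^sub>R (y - x)) \<bullet> (w - y)"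
proof (rule ccontr)
  let ?s = "(d + L *\<^sub>R (y - x)) \<bullet> (w - y)"
  let ?n = "(norm (w - y))\<^sup>2"
  assume "\<not> 0 \<le> ?s"
  then have s: "?s < 0" by simp
  have ineq: "0 \<le> ?s + t * (L / 2 * ?n)" if "0 < t" "t \<le> 1" for t
  proof -
    have "y + t *\<^sub>R (w - y) = (1 - t) *\<^sub>R y + t *\<^sub>R w" by (simp add: algebra_simps)
    then have u: "y + t *\<^sub>R (w - y) \<in> N"
      using convexD_alt[OF \<open>convex N\<close> \<open>y \<in> N\<close> \<open>w \<in> N\<close>, of t] that by simp
    have "y + t *\<^sub>R (w - y) - x = (y - x) + t *\<^sub>R (w - y)" by simp
    with min[OF u] have "d \<bullet> (y - x) + L / 2 * (norm (y - x))\<^sup>2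
        \<le> d \<bullet> ((y - x) + t *\<^sub>R (w - y)) + L / 2 * (norm ((y - x) + t *\<^sub>R (w - y)))\<^sup>2"
      by (simp only:)
    then have "0 \<le> t * (?s + t * (L / 2 * ?n))"
      unfolding power2_norm_eq_inner
      by (simp add: inner_add_left inner_add_right inner_diff_left inner_diff_right inner_commute[of w x]
          inner_commute[of y x] inner_commute[of w y] algebra_simps)
    then show ?thesis using that by (simp add: zero_le_mult_iff)
  qed
  define k where "k = L / 2 * ?n"
  have k: "0 \<le> k" using \<open>0 < L\<close> by (simp add: k_def)
  define t where "t = min 1 (- ?s / (2 * (k + 1)))"
  have t: "0 < t" "t \<le> 1" using s k by (auto simp: t_def field_simps)
  have "t * k \<le> - ?s / (2 * (k + 1)) * k" using k by (intro mult_right_mono) (auto simp: t_def)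
  also have "\<dots> = - ?s / 2 * (k / (k + 1))" by simp
  also have "\<dots> \<le> - ?s / 2 * 1" using s k by (intro mult_left_mono) (auto simp: field_simps)
  finally show False using ineq[OF t] s by (simp add: k_def)
qed

text \<open>The data of one call of ADAP-FISTA whose domain is the unit ball of the subspace \<open>E\<close>.
  The gradient of \<open>\<psi>\<close> is \<open>D\<close>. The bounds with constant \<open>\<Lambda>\<close> relate points of the domain to
  points of the ball of radius 3, which contains the points where the method linearizes \<open>\<psi>\<close>.\<close>

locale adap_fista =
  fixes E :: "'a::real_inner set" and \<psi> :: "'a \<Rightarrow> real" and D :: "'a \<Rightarrow> 'a"
    and \<Lambda> \<sigma> chi \<mu> :: real and x0 :: 'a
  assumes subspace: "subspace E"
    and x0: "x0 \<in> E" "norm x0 \<le> 1"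
    and D_in: "x \<in> E \<Longrightarrow> D x \<in> E"
    and has_derivative: "x \<in> E \<Longrightarrow> (\<psi> has_derivative (\<lambda>h. D x \<bullet> h)) (at x within E)"
    and \<Lambda>_nonneg: "0 \<le> \<Lambda>"
    and upper: "\<lbrakk>x \<in> E; norm x \<le> 3; u \<in> E; norm u \<le> 1\<rbrakk> \<Longrightarrow>
      \<psi> u \<le> \<psi> x + D x \<bullet> (u - x) + \<Lambda> / 2 * (norm (u - x))\<^sup>2"
    and lipschitz: "\<lbrakk>x \<in> E; norm x \<le> 3; u \<in> E; norm u \<le> 1\<rbrakk> \<Longrightarrow>
      norm (D u - D x) \<le> \<Lambda> * norm (u - x)"
    and params: "0 < \<sigma>" "0 < chi" "chi < 1" "0 < \<mu>"
begin

text \<open>The domain of the method.\<close>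

definition N :: "'a set"
  where "N = {u \<in> E. norm u \<le> 1}"

abbreviation fista
  where "fista \<equiv> adap_fista_pass \<sigma> chi E x0 \<mu> \<psi> (indicator_fn N)"

lemma N_iff: "u \<in> N \<longleftrightarrow> u \<in> E \<and> norm u \<le> 1"
  by (simp add: N_def)

lemma convex_N: "convex N"
proof -
  have "N = E \<inter> cball 0 1" by (auto simp: N_def)
  then show ?thesis by (simp add: convex_Int subspace subspace_imp_convex)
qed

lemma gradient: "x \<in> E \<Longrightarrow> gradient_on E \<psi> x = D x"
  by (intro gradient_on_eqI subspace D_in has_derivative)

text \<open>\<open>stepsize A \<tau> L\<close> is \<open>a (L - \<mu>)\<close> for the number \<open>a\<close> of step (2).\<close>

definition stepsize :: "real \<Rightarrow> real \<Rightarrow> real \<Rightarrow> real"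
  where "stepsize A \<tau> L = (\<tau> + sqrt (\<tau>\<^sup>2 + 4 * \<tau> * A * (L - \<mu>))) / 2"

lemma stepsize_ge: "0 \<le> A \<Longrightarrow> 0 \<le> \<tau> \<Longrightarrow> \<mu> \<le> L \<Longrightarrow> \<tau> \<le> stepsize A \<tau> L"
  unfolding stepsize_def
  using real_le_rsqrt[of \<tau> "\<tau>\<^sup>2 + 4 * \<tau> * A * (L - \<mu>)"] by simp

lemma stepsize_square:
  assumes "0 \<le> A" "0 \<le> \<tau>" "\<mu> < L"
  shows "(stepsize A \<tau> L)\<^sup>2 = \<tau> * (A * (L - \<mu>) + stepsize A \<tau> L)"
proof -
  define r where "r = sqrt (\<tau>\<^sup>2 + 4 * \<tau> * A * (L - \<mu>))"
  have "r\<^sup>2 = \<tau>\<^sup>2 + 4 * \<tau> * A * (L - \<mu>)" using assms by (simp add: r_def)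
  then show ?thesis
    unfolding stepsize_def r_def[symmetric] by (simp add: power2_eq_square field_simps)
qed

lemma stepsize_mono:
  assumes "0 \<le> A" "A \<le> A'" "0 \<le> \<tau>" "\<tau> \<le> \<tau>'" "\<mu> \<le> L" "L \<le> L'"
  shows "stepsize A \<tau> L \<le> stepsize A' \<tau>' L'"
  unfolding stepsize_def using assms
  by (intro divide_right_mono add_mono real_sqrt_le_mono power_mono mult_mono) auto

text \<open>An iteration from \<open>(A, \<tau>, L, x, y)\<close> with the number \<open>step_a A \<tau> L\<close> of step (2) linearizes at
  \<open>prox_center A \<tau> L x y\<close>. The points \<open>y'\<close> with \<open>is_prox L xt y'\<close> are the minimizers in
  step (2), up to a constant in the objective.\<close>

definition step_a :: "real \<Rightarrow> real \<Rightarrow> real \<Rightarrow> real"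
  where "step_a A \<tau> L = stepsize A \<tau> L / (L - \<mu>)"

definition prox_center :: "real \<Rightarrow> real \<Rightarrow> real \<Rightarrow> 'a \<Rightarrow> 'a \<Rightarrow> 'a"
  where "prox_center A \<tau> L x y =
    (A *\<^sub>R y + step_a A \<tau> L *\<^sub>R x) /\<^sub>R (A + step_a A \<tau> L)"

definition is_prox :: "real \<Rightarrow> 'a \<Rightarrow> 'a \<Rightarrow> bool"
  where "is_prox L xt y' \<longleftrightarrow> y' \<in> N \<and> (\<forall>u\<in>N.
    D xt \<bullet> (y' - xt) + L / 2 * (norm (y' - xt))\<^sup>2 \<le> D xt \<bullet> (u - xt) + L / 2 * (norm (u - xt))\<^sup>2)"

lemma is_arg_min_iff_is_prox:
  assumes "xt \<in> E"
  shows "is_arg_min (\<lambda>u. ereal (linearization E \<psi> u xt) + indicator_fn N u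
      + ereal (L / 2 * (norm (u - xt))\<^sup>2)) (\<lambda>u. u \<in> E \<and> indicator_fn N u < \<infinity>) y'
    \<longleftrightarrow> is_prox L xt y'"
proof -
  have dom: "(u \<in> E \<and> indicator_fn N u < \<infinity>) \<longleftrightarrow> u \<in> N" for u
    by (auto simp: indicator_fn_def N_iff)
  show ?thesis
    unfolding is_arg_min_linorder is_prox_def dom linearization_def gradient[OF assms]
    by (auto simp: indicator_fn_def)
qed

lemma fista_iff:
  assumes "prox_center A \<tau> L x y \<in> E"
  shows "fista (A, \<tau>, L, x, y) out \<longleftrightarrow>
    (let a = step_a A \<tau> L; xt = prox_center A \<tau> L x y in \<exists>y'. is_prox L xt y' \<and> out =
       (if \<not> \<psi> xt + D xt \<bullet> (y' - xt) + (1 - chi) * L / 4 * (norm (y' - xt))\<^sup>2 \<ge> \<psi> y'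
        then Continue (A, \<tau>, 2 * L, x, y)
        else
          let A' = A + a; \<tau>' = \<tau> + a * \<mu>;
              s' = (L - \<mu>) *\<^sub>R (xt - y');
              x' = ((\<mu> * a) *\<^sub>R y' + \<tau> *\<^sub>R x - a *\<^sub>R s') /\<^sub>R \<tau>';
              v' = D y' - D xt + L *\<^sub>R (xt - y')
          in if \<not> (norm (y' - x0))\<^sup>2 \<ge> chi * A' * L * (norm (y' - xt))\<^sup>2 then Stop None
             else if norm v' \<le> \<sigma> * norm (y' - x0) then Stop (Some (y', v', L))
             else Continue (A', \<tau>', L, x', y')))"
proof -
  define a where "a = step_a A \<tau> L"
  define xt where "xt = prox_center A \<tau> L x y"
  have a: "(\<tau> + sqrt (\<tau>\<^sup>2 + 4 * \<tau> * A * (L - \<mu>))) / (2 * (L - \<mu>)) = a"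
    by (simp add: a_def step_a_def stepsize_def)
  have xt: "(A *\<^sub>R y + a *\<^sub>R x) /\<^sub>R (A + a) = xt"
    by (simp add: xt_def prox_center_def a_def)
  have E: "xt \<in> E" using assms by (simp add: xt_def)
  have [simp]: "is_prox L xt y' \<Longrightarrow> gradient_on E \<psi> y' = D y'" for y'
    by (auto simp: is_prox_def N_iff gradient)
  then show ?thesis
    unfolding adap_fista_pass_def prod.case Let_def a xt a_def[symmetric] xt_def[symmetric]
      is_arg_min_iff_is_prox[OF E]
    unfolding linearization_def gradient[OF E] by (intro ex_cong1 conj_cong refl) simp
qed

lemma is_prox_exists:
  assumes "xt \<in> E" "0 < L"
  shows "\<exists>y'. is_prox L xt y'"
proof -
  define z where "z = xt - D xt /\<^sub>R L"
  have z: "z \<in> E" unfolding z_def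
    using assms D_in subspace by (intro subspace_diff subspace_scale) auto
  let ?y = "z /\<^sub>R max 1 (norm z)"
  have "?y \<in> N" using z subspace
    by (auto simp: N_iff subspace_scale field_simps max_def)
  moreover have "D xt \<bullet> (?y - xt) + L / 2 * (norm (?y - xt))\<^sup>2
      \<le> D xt \<bullet> (u - xt) + L / 2 * (norm (u - xt))\<^sup>2" if "u \<in> N" for u
    unfolding quadratic_complete_square[OF assms(2)] z_def[symmetric]
    using that assms(2) ball_projection_minimizes[of u z]
    by (auto simp: N_iff intro!: mult_left_mono power_mono)
  ultimately show ?thesis unfolding is_prox_def by blast
qed

lemma is_prox_condition:
  assumes "is_prox L xt y'" "0 < L" "u \<in> N"
  shows "0 \<le> (D xt + L *\<^sub>R (y' - xt)) \<bullet> (u - y')"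
  using assms convex_N by (intro first_order_condition[where N = N]) (auto simp: is_prox_def)

text \<open>Invariant of the method: \<open>x\<close> lies on the ray from the previous point through \<open>y\<close>, and not
  too far beyond \<open>y\<close>, which keeps the next linearization point in the ball of radius 3 without
  any convexity of \<open>\<psi>\<close>.\<close>

definition inv :: "real \<times> real \<times> real \<times> 'a \<times> 'a \<Rightarrow> bool"
  where "inv = (\<lambda>(A, \<tau>, L, x, y). 0 \<le> A \<and> 1 \<le> \<tau> \<and> \<mu> < L \<and> y \<in> N \<and>
    (\<exists>d z. z \<in> N \<and> 0 \<le> d \<and> d * \<tau> \<le> stepsize A \<tau> L \<and> x = y + d *\<^sub>R (y - z)))"

lemma inv_init: "\<mu> < L \<Longrightarrow> inv (adap_fista_init x0 L)"
  using x0 params stepsize_ge[of 0 1 L]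
  by (auto simp: inv_def adap_fista_init_def N_iff intro!: exI[of _ 0] exI[of _ x0])

lemma inv_double: "inv (A, \<tau>, L, x, y) \<Longrightarrow> inv (A, \<tau>, 2 * L, x, y)"
  using params stepsize_mono[of A A \<tau> \<tau> L "2 * L"] by (fastforce simp: inv_def)

lemma step_a_props:
  assumes "inv (A, \<tau>, L, x, y)"
  shows "0 < step_a A \<tau> L" "\<tau> \<le> step_a A \<tau> L * (L - \<mu>)"
    "(step_a A \<tau> L)\<^sup>2 * (L - \<mu>) = \<tau> * (A + step_a A \<tau> L)"
    "stepsize A \<tau> L = step_a A \<tau> L * (L - \<mu>)"
proof -
  have s: "0 \<le> A" "1 \<le> \<tau>" "0 < L - \<mu>" using assms by (auto simp: inv_def)
  have g: "\<tau> \<le> stepsize A \<tau> L" using stepsize_ge s by simp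
  show e: "stepsize A \<tau> L = step_a A \<tau> L * (L - \<mu>)" using s by (simp add: step_a_def)
  show "0 < step_a A \<tau> L" using s g by (simp add: step_a_def)
  show "\<tau> \<le> step_a A \<tau> L * (L - \<mu>)" using g e by simp
  have "(stepsize A \<tau> L)\<^sup>2 = \<tau> * (A * (L - \<mu>) + stepsize A \<tau> L)"
    using s by (intro stepsize_square) auto
  then have "(L - \<mu>) * ((step_a A \<tau> L)\<^sup>2 * (L - \<mu>)) = (L - \<mu>) * (\<tau> * (A + step_a A \<tau> L))"
    unfolding e by (simp add: power2_eq_square algebra_simps)
  then show "(step_a A \<tau> L)\<^sup>2 * (L - \<mu>) = \<tau> * (A + step_a A \<tau> L)" using s by simp
qed

lemma prox_center_in_ball:
  assumes "inv (A, \<tau>, L, x, y)"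
  shows "prox_center A \<tau> L x y \<in> E" "norm (prox_center A \<tau> L x y) \<le> 3"
proof -
  obtain d z where i: "0 \<le> A" "1 \<le> \<tau>" "\<mu> < L" "y \<in> N" "z \<in> N" "0 \<le> d"
      "d * \<tau> \<le> stepsize A \<tau> L" "x = y + d *\<^sub>R (y - z)"
    using assms by (auto simp: inv_def)
  define a where "a = step_a A \<tau> L"
  have a: "0 < a" "a\<^sup>2 * (L - \<mu>) = \<tau> * (A + a)" "stepsize A \<tau> L = a * (L - \<mu>)"
    using step_a_props[OF assms] by (simp_all add: a_def)
  define e where "e = a * d / (A + a)"
  have "\<tau> * (a * d) = a * (d * \<tau>)" by simp
  also have "\<dots> \<le> a * (a * (L - \<mu>))" using a i by (intro mult_left_mono) auto
  also have "\<dots> = \<tau> * (A + a)" using a by (simp add: power2_eq_square)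
  finally have "a * d \<le> A + a" using i by simp
  then have e: "0 \<le> e" "e \<le> 1" using a i by (auto simp: e_def)
  have "a * d = (A + a) * e" using a i by (simp add: e_def)
  moreover have "A *\<^sub>R y + a *\<^sub>R x = (A + a) *\<^sub>R y + (a * d) *\<^sub>R (y - z)"
    by (simp add: i algebra_simps)
  ultimately have "A *\<^sub>R y + a *\<^sub>R x = (A + a) *\<^sub>R (y + e *\<^sub>R (y - z))"
    by (simp only: scaleR_add_right scaleR_scaleR)
  then have xt: "prox_center A \<tau> L x y = y + e *\<^sub>R (y - z)"
    using a i by (simp add: prox_center_def a_def[symmetric])
  show "prox_center A \<tau> L x y \<in> E" unfolding xt
    using i subspace by (intro subspace_add subspace_scale subspace_diff) (auto simp: N_iff)
  have "norm (y + e *\<^sub>R (y - z)) \<le> norm y + e * norm (y - z)"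
    using norm_triangle_ineq[of y "e *\<^sub>R (y - z)"] e by simp
  also have "e * norm (y - z) \<le> 1 * (norm y + norm z)"
    using e by (intro mult_mono norm_triangle_ineq4) auto
  finally show "norm (prox_center A \<tau> L x y) \<le> 3" using i unfolding xt by (simp add: N_iff)
qed

lemma inv_step:
  assumes "inv (A, \<tau>, L, x, y)" "y' \<in> N" "a = step_a A \<tau> L" "xt = prox_center A \<tau> L x y"
    and x': "x' = ((\<mu> * a) *\<^sub>R y' + \<tau> *\<^sub>R x - a *\<^sub>R ((L - \<mu>) *\<^sub>R (xt - y'))) /\<^sub>R (\<tau> + a * \<mu>)"
  shows "inv (A + a, \<tau> + a * \<mu>, L, x', y')"
proof -
  have i: "0 \<le> A" "1 \<le> \<tau>" "\<mu> < L" "y \<in> N"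
    using assms by (auto simp: inv_def)
  have a: "0 < a" "a\<^sup>2 * (L - \<mu>) = \<tau> * (A + a)" "stepsize A \<tau> L = a * (L - \<mu>)"
    using step_a_props[OF assms(1)] by (simp_all add: assms(3))
  define \<tau>' where "\<tau>' = \<tau> + a * \<mu>"
  have \<tau>': "1 \<le> \<tau>'" "\<tau> \<le> \<tau>'" using a i params by (auto simp: \<tau>'_def intro: add_increasing2)
  define c where "c = \<tau> * A / a"
  have c: "0 \<le> c" using a i by (simp add: c_def)
  have "(A + a) *\<^sub>R xt = A *\<^sub>R y + a *\<^sub>R x"
    using a i by (simp add: assms(4) prox_center_def assms(3)[symmetric])
  moreover have aL: "a * (L - \<mu>) = \<tau> / a * (A + a)"
    using a by (simp add: field_simps power2_eq_square)
  ultimately have "a *\<^sub>R ((L - \<mu>) *\<^sub>R xt) = (\<tau> / a) *\<^sub>R (A *\<^sub>R y + a *\<^sub>R x)"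
    by (metis scaleR_scaleR)
  moreover have "a *\<^sub>R ((L - \<mu>) *\<^sub>R y') = (\<tau> / a * (A + a)) *\<^sub>R y'"
    by (simp only: scaleR_scaleR aL)
  ultimately have "a *\<^sub>R ((L - \<mu>) *\<^sub>R (xt - y'))
      = (\<tau> / a) *\<^sub>R (A *\<^sub>R y + a *\<^sub>R x) - (\<tau> / a * (A + a)) *\<^sub>R y'"
    by (simp only: scaleR_diff_right)
  also have "\<dots> = c *\<^sub>R y + \<tau> *\<^sub>R x - (c + \<tau>) *\<^sub>R y'"
    using a by (simp add: c_def scaleR_add_right ring_distribs)
  finally have "(\<mu> * a) *\<^sub>R y' + \<tau> *\<^sub>R x - a *\<^sub>R ((L - \<mu>) *\<^sub>R (xt - y'))
      = \<tau>' *\<^sub>R y' + c *\<^sub>R (y' - y)"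
    by (simp add: \<tau>'_def algebra_simps)
  then have x'_eq: "x' = y' + (c / \<tau>') *\<^sub>R (y' - y)"
    unfolding x' \<tau>'_def[symmetric] using \<tau>' by (simp add: scaleR_add_right divide_inverse mult.commute)
  have "c \<le> \<tau> * (A + a) / a"
    unfolding c_def using a i by (intro divide_right_mono mult_left_mono) auto
  also have "\<dots> = a * (L - \<mu>)" by (simp add: aL)
  also have "\<dots> \<le> stepsize (A + a) \<tau>' L"
    unfolding a(3)[symmetric] using a i \<tau>' by (intro stepsize_mono) auto
  finally have "c / \<tau>' * \<tau>' \<le> stepsize (A + a) \<tau>' L" using \<tau>' by (simp add: a(3))
  then show ?thesis
    using x'_eq i a \<tau>' c assms(2) unfolding inv_def \<tau>'_def[symmetric]
    by (auto intro!: exI[of _ "c / \<tau>'"] exI[of _ y])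
qed

lemma fista_enabled:
  assumes "inv s"
  shows "\<exists>out. fista s out" "\<not> fista s Hang"
proof -
  obtain A \<tau> L x y where s: "s = (A, \<tau>, L, x, y)" by (cases s)
  have xt: "prox_center A \<tau> L x y \<in> E" using prox_center_in_ball assms s by blast
  have L: "0 < L" using assms params by (auto simp: s inv_def)
  obtain y' where "is_prox L (prox_center A \<tau> L x y) y'" using is_prox_exists[OF xt L] by blast
  then show "\<exists>out. fista s out" unfolding s fista_iff[OF xt] Let_def by blast
  show "\<not> fista s Hang" unfolding s fista_iff[OF xt] Let_def by auto
qed

text \<open>What a pass can do. In an iteration that continues, the number \<open>A\<close> stays bounded, because
  the residual \<open>v\<close> is at most a multiple of the step length, which in turn decays with \<open>A\<close>.\<close>

lemma fista_continue:
  assumes "inv (A, \<tau>, L, x, y)" "fista (A, \<tau>, L, x, y) (Continue s')"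
  obtains (double) "s' = (A, \<tau>, 2 * L, x, y)" "(1 - chi) * L / 2 < \<Lambda>"
  | (advance) y' x' \<tau>' where "s' = (A + step_a A \<tau> L, \<tau>', L, x', y')"
      "\<sigma>\<^sup>2 * chi * (A + step_a A \<tau> L) * L \<le> (\<Lambda> + L)\<^sup>2" "inv s'"
proof -
  define a where "a = step_a A \<tau> L"
  define xt where "xt = prox_center A \<tau> L x y"
  have xt: "xt \<in> E" "norm xt \<le> 3" using prox_center_in_ball[OF assms(1)] by (auto simp: xt_def)
  have L: "\<mu> < L" "0 < L" using assms(1) params by (auto simp: inv_def)
  have a: "0 < a" using step_a_props[OF assms(1)] by (simp add: a_def)
  obtain y' where y': "is_prox L xt y'" and out: "Continue s' =
       (if \<not> \<psi> xt + D xt \<bullet> (y' - xt) + (1 - chi) * L / 4 * (norm (y' - xt))\<^sup>2 \<ge> \<psi> y'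
        then Continue (A, \<tau>, 2 * L, x, y)
        else
          let A' = A + a; \<tau>' = \<tau> + a * \<mu>;
              s' = (L - \<mu>) *\<^sub>R (xt - y');
              x' = ((\<mu> * a) *\<^sub>R y' + \<tau> *\<^sub>R x - a *\<^sub>R s') /\<^sub>R \<tau>';
              v' = D y' - D xt + L *\<^sub>R (xt - y')
          in if \<not> (norm (y' - x0))\<^sup>2 \<ge> chi * A' * L * (norm (y' - xt))\<^sup>2 then Stop None
             else if norm v' \<le> \<sigma> * norm (y' - x0) then Stop (Some (y', v', L))
             else Continue (A', \<tau>', L, x', y'))"
    using assms(2) fista_iff[OF prox_center_in_ball(1)[OF assms(1)]]
    unfolding a_def[symmetric] xt_def[symmetric] Let_def by auto
  have y'N: "y' \<in> E" "norm y' \<le> 1" using y' by (auto simp: is_prox_def N_iff)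
  show thesis
  proof (cases "\<psi> xt + D xt \<bullet> (y' - xt) + (1 - chi) * L / 4 * (norm (y' - xt))\<^sup>2 \<ge> \<psi> y'")
    case False
    then have "(1 - chi) * L / 4 * (norm (y' - xt))\<^sup>2 < \<Lambda> / 2 * (norm (y' - xt))\<^sup>2"
      using upper[OF xt y'N] by linarith
    then have "(1 - chi) * L / 2 * ((norm (y' - xt))\<^sup>2 / 2) < \<Lambda> * ((norm (y' - xt))\<^sup>2 / 2)"
      by simp
    then have "(1 - chi) * L / 2 < \<Lambda>" by (rule mult_right_less_imp_less) simp
    then show thesis using double out False by simp
  next
    case True
    let ?v = "D y' - D xt + L *\<^sub>R (xt - y')"
    define r where "r = norm (y' - xt)"
    from True out have 1: "chi * (A + a) * L * r\<^sup>2 \<le> (norm (y' - x0))\<^sup>2"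
      "\<sigma> * norm (y' - x0) < norm ?v"
      and s': "s' = (A + a, \<tau> + a * \<mu>, L, ((\<mu> * a) *\<^sub>R y' + \<tau> *\<^sub>R x
        - a *\<^sub>R ((L - \<mu>) *\<^sub>R (xt - y'))) /\<^sub>R (\<tau> + a * \<mu>), y')"
      by (auto simp: Let_def r_def split: if_splits)
    have "norm ?v \<le> norm (D y' - D xt) + norm (L *\<^sub>R (xt - y'))" by (rule norm_triangle_ineq)
    also have "\<dots> \<le> \<Lambda> * r + L * r"
      using lipschitz[OF xt y'N] L by (simp add: r_def norm_minus_commute)
    finally have v: "norm ?v \<le> (\<Lambda> + L) * r" by (simp add: algebra_simps)
    have "\<sigma>\<^sup>2 * (chi * (A + a) * L * r\<^sup>2) \<le> (\<sigma> * norm (y' - x0))\<^sup>2"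
      unfolding power_mult_distrib using 1 by (intro mult_left_mono) auto
    also have "\<dots> \<le> ((\<Lambda> + L) * r)\<^sup>2"
      using 1 v params by (intro power_mono) auto
    finally have "(\<sigma>\<^sup>2 * chi * (A + a) * L) * r\<^sup>2 \<le> (\<Lambda> + L)\<^sup>2 * r\<^sup>2"
      by (simp add: power_mult_distrib mult_ac)
    moreover have "r \<noteq> 0"
    proof
      assume "r = 0"
      then have "norm ?v \<le> 0" using v by simp
      moreover have "0 \<le> \<sigma> * norm (y' - x0)" using params by simp
      ultimately show False using 1(2) by linarith
    qed
    ultimately have "\<sigma>\<^sup>2 * chi * (A + a) * L \<le> (\<Lambda> + L)\<^sup>2"
      by (simp add: mult_le_cancel_right)
    moreover have "inv s'"
      unfolding s' using y'N by (intro inv_step[OF assms(1)]) (auto simp: N_iff a_def xt_def)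
    ultimately show thesis using advance s' by (simp add: a_def)
  qed
qed

lemma fista_halts:
  assumes "\<mu> < L0"
  shows "halts fista (adap_fista_init x0 L0)"
proof -
  define Lm where "Lm = max L0 (4 * \<Lambda> / (1 - chi))"
  define Am where "Am = (\<Lambda> + Lm)\<^sup>2 / (\<sigma>\<^sup>2 * chi * \<mu>)"
  have Am: "0 \<le> Am" using params by (simp add: Am_def)
  define I where "I = (\<lambda>(A, \<tau>, L, x, y). inv (A, \<tau>, L, x, y) \<and> A \<le> Am \<and> L \<le> Lm)"
  define V :: "real \<times> real \<times> real \<times> 'a \<times> 'a \<Rightarrow> real"
    where "V = (\<lambda>(A, \<tau>, L, x, y). Lm * (Am - A) + log 2 (Lm / L))"
  have Lm: "0 < Lm" using assms params by (simp add: Lm_def)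
  show ?thesis
  proof (rule halts_by_measure[where I = I and V = V])
    show "I (adap_fista_init x0 L0)"
      using inv_init[OF assms] Am by (simp add: I_def adap_fista_init_def Lm_def)
    show "\<exists>out. fista s out" "\<not> fista s Hang" if "I s" for s
      using that fista_enabled[of s] by (auto simp: I_def)
    show "0 \<le> V s" if "I s" for s
    proof -
      obtain A \<tau> L x y where s: "s = (A, \<tau>, L, x, y)" by (cases s)
      have "0 < L" "L \<le> Lm" "A \<le> Am" using that params by (auto simp: s I_def inv_def)
      then have "0 \<le> log 2 (Lm / L)" by simp
      then show ?thesis using \<open>A \<le> Am\<close> Lm by (simp add: s V_def)
    qed
    show "I s' \<and> V s' + 1 \<le> V s" if Is: "I s" and cont: "fista s (Continue s')" for s s'
    proof -
      obtain A \<tau> L x y where s: "s = (A, \<tau>, L, x, y)" by (cases s)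
      have i: "inv (A, \<tau>, L, x, y)" "A \<le> Am" "L \<le> Lm" using Is by (auto simp: s I_def)
      then have L: "\<mu> < L" "0 < L" "1 \<le> \<tau>" using params by (auto simp: inv_def)
      show ?thesis
        using i(1) cont[unfolded s]
      proof (cases rule: fista_continue)
        case double
        have "2 * L \<le> 4 * \<Lambda> / (1 - chi)" using double params by (simp add: field_simps)
        then have "2 * L \<le> Lm" by (simp add: Lm_def)
        moreover have "log 2 (Lm / (2 * L)) = log 2 (Lm / L) - 1"
          using L Lm by (simp add: log_divide log_mult)
        ultimately show ?thesis
          using double i inv_double by (simp add: s I_def V_def)
      next
        case (advance y' x' \<tau>')
        define a where "a = step_a A \<tau> L"
        have a: "0 < a" "\<tau> \<le> a * (L - \<mu>)" using step_a_props[OF i(1)] by (auto simp: a_def)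
        have "\<sigma>\<^sup>2 * chi * \<mu> * (A + a) \<le> \<sigma>\<^sup>2 * chi * (A + a) * L"
          using L params a i by (simp add: mult_ac inv_def)
        also have "\<dots> \<le> (\<Lambda> + L)\<^sup>2" using advance by (simp add: a_def)
        also have "\<dots> \<le> (\<Lambda> + Lm)\<^sup>2" using L i \<Lambda>_nonneg by (intro power_mono) auto
        finally have "A + a \<le> Am" using params by (simp add: Am_def field_simps)
        moreover have "1 \<le> Lm * a"
        proof -
          have "1 \<le> a * (L - \<mu>)" using a L by linarith
          also have "\<dots> \<le> a * Lm" using a L i params by (intro mult_left_mono) auto
          finally show ?thesis by (simp add: mult.commute)
        qed
        ultimately show ?thesis
          using advance i by (simp add: s I_def V_def a_def[symmetric] algebra_simps)
      qed
    qed
  qed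
qed

text \<open>A successful call returns a point \<open>W\<close> and an approximate gradient \<open>V\<close> such that
  \<open>V - D W\<close> is normal to the domain at \<open>W\<close>.\<close>

lemma fista_success:
  assumes "\<mu> < L0" "returns fista (adap_fista_init x0 L0) (Some (W, V, L))"
  shows "W \<in> N" "L0 \<le> L" "norm V \<le> \<sigma> * norm (W - x0)"
    "\<And>u. u \<in> N \<Longrightarrow> (V - D W) \<bullet> (u - W) \<le> 0"
proof -
  have *: "W \<in> N \<and> L0 \<le> L \<and> norm V \<le> \<sigma> * norm (W - x0) \<and> (\<forall>u\<in>N. (V - D W) \<bullet> (u - W) \<le> 0)"
    if "returns fista s r" "inv s" "L0 \<le> fst (snd (snd s))" "r = Some (W, V, L)" for s r
    using that
  proof induction
    case (stop s r)
    obtain A \<tau> L1 x y where s: "s = (A, \<tau>, L1, x, y)" by (cases s)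
    note inv = stop(2)[unfolded s]
    define xt where "xt = prox_center A \<tau> L1 x y"
    have L1: "0 < L1" using inv params by (auto simp: inv_def)
    obtain y' where y': "is_prox L1 xt y'" "W = y'" "L = L1" "V = D y' - D xt + L1 *\<^sub>R (xt - y')"
        "norm V \<le> \<sigma> * norm (y' - x0)"
      using stop(1) unfolding s stop(4) fista_iff[OF prox_center_in_ball(1)[OF inv]] Let_def
      by (auto split: if_splits simp: xt_def)
    have "V - D W = - (D xt + L1 *\<^sub>R (y' - xt))" using y' by (simp add: algebra_simps)
    then have "(V - D W) \<bullet> (u - W) \<le> 0" if "u \<in> N" for u
      using is_prox_condition[OF y'(1) L1 that] by (simp add: y'(2) inner_diff_left inner_add_left)
    then show ?case using y' stop(3) s by (auto simp: is_prox_def)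
  next
    case (continue s s' r)
    obtain A \<tau> L1 x y where s: "s = (A, \<tau>, L1, x, y)" by (cases s)
    have "0 < L1" using continue(4) params by (auto simp: inv_def s)
    have "inv s' \<and> L0 \<le> fst (snd (snd s'))"
      using continue(4)[unfolded s] continue(1)[unfolded s]
    proof (cases rule: fista_continue)
      case double
      then show ?thesis using continue(4,5) inv_double \<open>0 < L1\<close> by (simp add: s)
    next
      case (advance y' x' \<tau>')
      then show ?thesis using continue(5) by (simp add: s)
    qed
    then show ?case using continue by blast
  qed
  have "L0 \<le> fst (snd (snd (adap_fista_init x0 L0)))" by (simp add: adap_fista_init_def)
  from *[OF assms(2) inv_init[OF assms(1)] this] show "W \<in> N" "L0 \<le> L"
    "norm V \<le> \<sigma> * norm (W - x0)" "\<And>u. u \<in> N \<Longrightarrow> (V - D W) \<bullet> (u - W) \<le> 0" by auto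
qed

end


text \<open>The inequality behind the potential function of an accelerated gradient method, with
  \<open>s = (L - \<mu>) (x\<^sub>t - y')\<close>.\<close>

lemma potential_inequality:
  fixes x y y' u xt x' s :: "'a::real_inner"
  assumes "0 < a" "0 < \<tau>" "0 < \<mu>" "0 \<le> A"
    and a: "a\<^sup>2 * l = \<tau> * (A + a)" and l: "0 < l"
    and xt: "(A + a) *\<^sub>R xt = A *\<^sub>R y + a *\<^sub>R x"
    and s: "s = l *\<^sub>R (xt - y')"
    and x': "(\<tau> + a * \<mu>) *\<^sub>R x' = (\<mu> * a) *\<^sub>R y' + \<tau> *\<^sub>R x - a *\<^sub>R s"
  shows "(A + a) * l / 2 * (norm (y' - xt))\<^sup>2 + (\<tau> + a * \<mu>) / 2 * (norm (u - x'))\<^sup>2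
    \<le> A * (s \<bullet> (y - y')) + a * (s \<bullet> (u - y') + \<mu> / 2 * (norm (u - y'))\<^sup>2)
      + \<tau> / 2 * (norm (u - x))\<^sup>2"
proof -
  define w where "w = y' - x"
  define d where "d = x' - x"
  define v where "v = u - x"
  define \<tau>' where "\<tau>' = \<tau> + a * \<mu>"
  have \<tau>': "0 < \<tau>'" using assms(1-3) by (simp add: \<tau>'_def add_pos_pos)
  have d: "\<tau>' *\<^sub>R d = (a * \<mu>) *\<^sub>R w - a *\<^sub>R s"
    using x' by (simp add: d_def w_def \<tau>'_def algebra_simps)
  have "A *\<^sub>R (y - y') = (A + a) *\<^sub>R xt - a *\<^sub>R x - A *\<^sub>R y'" by (simp add: xt scaleR_diff_right)
  also have "\<dots> = (A + a) *\<^sub>R (xt - y') + a *\<^sub>R w" by (simp add: w_def algebra_simps)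
  finally have "A * (s \<bullet> (y - y')) = (A + a) * (s \<bullet> (xt - y')) + a * (s \<bullet> w)"
    by (metis inner_add_right inner_scaleR_right)
  also have "s \<bullet> (xt - y') = l * (norm (y' - xt))\<^sup>2"
    by (simp add: s power2_norm_eq_inner norm_minus_commute)
  finally have 1: "A * (s \<bullet> (y - y')) = (A + a) * l * (norm (y' - xt))\<^sup>2 + a * (s \<bullet> w)" by simp
  \<comment> \<open>The terms with \<open>u\<close> cancel, because \<open>x'\<close> minimizes the right-hand side over \<open>u\<close>.\<close>
  have "a * (s \<bullet> (v - w) + \<mu> / 2 * (norm (v - w))\<^sup>2) + \<tau> / 2 * (norm v)\<^sup>2 - \<tau>' / 2 * (norm (v - d))\<^sup>2
      = a * \<mu> / 2 * (norm w)\<^sup>2 - a * (s \<bullet> w) - \<tau>' / 2 * (norm d)\<^sup>2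
        + (a * (s \<bullet> v) - a * \<mu> * (w \<bullet> v) + \<tau>' * (d \<bullet> v))"
    unfolding power2_norm_eq_inner \<tau>'_def
    by (simp add: inner_diff_left inner_diff_right inner_commute[of v w] inner_commute[of v d]
      field_simps)
  also have "\<tau>' * (d \<bullet> v) = a * \<mu> * (w \<bullet> v) - a * (s \<bullet> v)"
    using arg_cong[OF d, of "\<lambda>z. z \<bullet> v"] by (simp add: inner_diff_left)
  finally have 2: "a * (s \<bullet> (u - y') + \<mu> / 2 * (norm (u - y'))\<^sup>2) + \<tau> / 2 * (norm (u - x))\<^sup>2
      - \<tau>' / 2 * (norm (u - x'))\<^sup>2 = a * \<mu> / 2 * (norm w)\<^sup>2 - a * (s \<bullet> w) - \<tau>' / 2 * (norm d)\<^sup>2"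
    by (simp add: v_def w_def d_def)
  have "\<tau>' * (\<tau>' * (norm d)\<^sup>2) = (norm (\<tau>' *\<^sub>R d))\<^sup>2" using \<tau>' by (simp add: power_mult_distrib power2_eq_square)
  also have "\<dots> = a\<^sup>2 * (norm (\<mu> *\<^sub>R w - s))\<^sup>2"
    unfolding d power2_norm_eq_inner
    by (simp add: inner_diff_left inner_diff_right algebra_simps power2_eq_square)
  also have "\<dots> \<le> a\<^sup>2 * (\<tau>' / \<tau> * (norm s)\<^sup>2 + \<tau>' * \<mu> / a * (norm w)\<^sup>2)"
  proof (rule mult_left_mono)
    have "0 \<le> (norm (a *\<^sub>R s + \<tau> *\<^sub>R w))\<^sup>2 * \<mu> / (a * \<tau>)" using assms by simp
    also have "\<dots> = \<tau>' / \<tau> * (norm s)\<^sup>2 + \<tau>' * \<mu> / a * (norm w)\<^sup>2 - (norm (\<mu> *\<^sub>R w - s))\<^sup>2"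
      unfolding power2_norm_eq_inner \<tau>'_def using assms(1,2)
      by (simp add: inner_add_left inner_add_right inner_diff_left inner_diff_right
        inner_commute[of w s] field_simps)
    finally show "(norm (\<mu> *\<^sub>R w - s))\<^sup>2 \<le> \<tau>' / \<tau> * (norm s)\<^sup>2 + \<tau>' * \<mu> / a * (norm w)\<^sup>2" by simp
  qed simp
  also have "\<dots> = \<tau>' * (a\<^sup>2 / \<tau> * (norm s)\<^sup>2 + a * \<mu> * (norm w)\<^sup>2)"
    using assms(1) by (simp add: field_simps power2_eq_square)
  finally have 3: "\<tau>' * (norm d)\<^sup>2 \<le> a\<^sup>2 / \<tau> * (norm s)\<^sup>2 + a * \<mu> * (norm w)\<^sup>2"
    using \<tau>' by simp
  have "a\<^sup>2 / \<tau> * (norm s)\<^sup>2 = (a\<^sup>2 * l) / \<tau> * l * (norm (y' - xt))\<^sup>2"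
    using l by (simp add: s power_mult_distrib norm_minus_commute power2_eq_square)
  also have "\<dots> = (A + a) * l * (norm (y' - xt))\<^sup>2" using a assms(2) by simp
  finally show ?thesis using 1 2 3 unfolding \<tau>'_def[symmetric] by argo
qed

text \<open>If \<open>\<psi>\<close> is \<open>\<mu>\<close>-strongly convex, then \<open>\<Phi>\<^sub>i(u) = A\<^sub>i (\<psi> y\<^sub>i - \<psi> u) + \<tau>\<^sub>i/2 \<parallel>u - x\<^sub>i\<parallel>\<^sup>2\<close> does not
  increase with \<open>i\<close> for any point \<open>u\<close> of the domain. The test of step (4) follows from
  \<open>0 \<le> \<Phi>\<^sub>i\<^sub>+\<^sub>1(y\<^sub>i\<^sub>+\<^sub>1)\<close>.\<close>

locale adap_fista_convex = adap_fista +
  assumes strongly_convex: "\<lbrakk>x \<in> E; norm x \<le> 3; u \<in> E; norm u \<le> 1\<rbrakk> \<Longrightarrow>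
    \<psi> x + D x \<bullet> (u - x) + \<mu> / 2 * (norm (u - x))\<^sup>2 \<le> \<psi> u"
begin

text \<open>The value \<open>\<Phi>\<^sub>i(u)\<close> in the state of iteration \<open>i\<close>.\<close>

definition potential :: "real \<times> real \<times> real \<times> 'a \<times> 'a \<Rightarrow> 'a \<Rightarrow> real"
  where "potential = (\<lambda>(A, \<tau>, L, x, y) u. A * (\<psi> y - \<psi> u) + \<tau> / 2 * (norm (u - x))\<^sup>2)"

text \<open>In addition, each iteration consumes part of the potential in proportion to the squared step
  length, which is what the test of step (4) measures.\<close>

lemma potential_step:
  assumes inv: "inv (A, \<tau>, L, x, y)" and a_def: "a = step_a A \<tau> L"
    and xt_def: "xt = prox_center A \<tau> L x y"
    and y': "is_prox L xt y'" and u: "u \<in> N"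
    and accept: "\<psi> xt + D xt \<bullet> (y' - xt) + (1 - chi) * L / 4 * (norm (y' - xt))\<^sup>2 \<ge> \<psi> y'"
    and x': "x' = ((\<mu> * a) *\<^sub>R y' + \<tau> *\<^sub>R x - a *\<^sub>R ((L - \<mu>) *\<^sub>R (xt - y'))) /\<^sub>R (\<tau> + a * \<mu>)"
  shows "potential (A + a, \<tau> + a * \<mu>, L, x', y') u
    + (1 + chi) / 4 * ((A + a) * L * (norm (y' - xt))\<^sup>2) \<le> potential (A, \<tau>, L, x, y) u"
proof -
  have i: "0 \<le> A" "1 \<le> \<tau>" "\<mu> < L" "y \<in> N" using inv by (auto simp: inv_def)
  have L: "0 < L" using i params by simp
  have a: "0 < a" "a\<^sup>2 * (L - \<mu>) = \<tau> * (A + a)"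
    using step_a_props[OF inv] by (simp_all add: a_def)
  have xt: "xt \<in> E" "norm xt \<le> 3" using prox_center_in_ball[OF inv] by (auto simp: xt_def)
  define s where "s = (L - \<mu>) *\<^sub>R (xt - y')"
  define r2 where "r2 = (norm (y' - xt))\<^sup>2"
  define e where "e = \<psi> xt + D xt \<bullet> (y' - xt) + \<mu> / 2 * r2"
  have lower: "e + s \<bullet> (w - y') + \<mu> / 2 * (norm (w - y'))\<^sup>2 \<le> \<psi> w" if "w \<in> N" for w
  proof -
    have "\<psi> xt + D xt \<bullet> (w - xt) + \<mu> / 2 * (norm (w - xt))\<^sup>2 \<le> \<psi> w"
      using strongly_convex[OF xt] that by (simp add: N_iff)
    moreover have "0 \<le> (D xt + L *\<^sub>R (y' - xt)) \<bullet> (w - y')"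
      using is_prox_condition[OF y' L that] .
    moreover have "w - xt = (w - y') + (y' - xt)" by simp
    then have "(norm (w - xt))\<^sup>2 = (norm (w - y'))\<^sup>2 + 2 * ((y' - xt) \<bullet> (w - y')) + r2"
      "D xt \<bullet> (w - xt) = D xt \<bullet> (w - y') + D xt \<bullet> (y' - xt)"
      unfolding r2_def power2_norm_eq_inner
      by (simp_all only: inner_add_left inner_add_right inner_commute[of "w - y'" "y' - xt"])
    moreover have "s \<bullet> (w - y') = (\<mu> - L) * ((y' - xt) \<bullet> (w - y'))"
      unfolding s_def by (simp add: inner_diff_left algebra_simps)
    ultimately show ?thesis unfolding e_def by (simp add: inner_add_left algebra_simps)
  qed
  have "(A + a) * (L - \<mu>) / 2 * (norm (y' - xt))\<^sup>2 + (\<tau> + a * \<mu>) / 2 * (norm (u - x'))\<^sup>2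
    \<le> A * (s \<bullet> (y - y')) + a * (s \<bullet> (u - y') + \<mu> / 2 * (norm (u - y'))\<^sup>2) + \<tau> / 2 * (norm (u - x))\<^sup>2"
  proof (rule potential_inequality)
    show "(A + a) *\<^sub>R xt = A *\<^sub>R y + a *\<^sub>R x"
      using a i by (simp add: xt_def prox_center_def a_def[symmetric])
    have "0 < \<tau> + a * \<mu>" using a i params by (simp add: add_pos_pos)
    then show "(\<tau> + a * \<mu>) *\<^sub>R x' = (\<mu> * a) *\<^sub>R y' + \<tau> *\<^sub>R x - a *\<^sub>R s"
      by (simp add: x' s_def)
  qed (use a i params in \<open>auto simp: s_def\<close>)
  moreover have "A * (e + s \<bullet> (y - y')) \<le> A * \<psi> y"
    using lower[OF i(4)] i params by (intro mult_left_mono) (auto intro: order_trans[rotated])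
  moreover have "a * (e + (s \<bullet> (u - y') + \<mu> / 2 * (norm (u - y'))\<^sup>2)) \<le> a * \<psi> u"
    using lower[OF u] a by (intro mult_left_mono) auto
  moreover have "(A + a) * (\<psi> y' + (\<mu> / 2 - (1 - chi) * L / 4) * r2) \<le> (A + a) * e"
    using accept a i by (intro mult_left_mono) (auto simp: e_def r2_def algebra_simps)
  ultimately show ?thesis
    unfolding potential_def prod.case r2_def[symmetric] by (simp add: algebra_simps) argo
qed

lemma fista_never_fails:
  assumes "\<mu> < L0"
  shows "\<not> returns fista (adap_fista_init x0 L0) None"
proof -
  have *: "r \<noteq> None"
    if "returns fista s r" "inv s" "\<forall>u\<in>N. potential s u \<le> 1 / 2 * (norm (u - x0))\<^sup>2" for s r
    using that
  proof induction
    case (stop s r)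
    obtain A \<tau> L x y where s: "s = (A, \<tau>, L, x, y)" by (cases s)
    note inv = stop(2)[unfolded s]
    define xt where "xt = prox_center A \<tau> L x y"
    define a where "a = step_a A \<tau> L"
    have L: "0 < L" using inv params by (auto simp: inv_def)
    have i: "0 \<le> A" "1 \<le> \<tau>" "0 < a" using inv step_a_props[OF inv] by (auto simp: inv_def a_def)
    show ?case
    proof
      assume "r = None"
      then obtain y' where y': "is_prox L xt y'"
          "\<psi> xt + D xt \<bullet> (y' - xt) + (1 - chi) * L / 4 * (norm (y' - xt))\<^sup>2 \<ge> \<psi> y'"
          "(norm (y' - x0))\<^sup>2 < chi * (A + a) * L * (norm (y' - xt))\<^sup>2"
        using stop(1) unfolding s fista_iff[OF prox_center_in_ball(1)[OF inv]] Let_def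
        by (auto split: if_splits simp: xt_def a_def)
      define x' where "x' = ((\<mu> * a) *\<^sub>R y' + \<tau> *\<^sub>R x - a *\<^sub>R ((L - \<mu>) *\<^sub>R (xt - y'))) /\<^sub>R (\<tau> + a * \<mu>)"
      define q where "q = (A + a) * L * (norm (y' - xt))\<^sup>2"
      have N: "y' \<in> N" using y' by (simp add: is_prox_def)
      have "potential (A + a, \<tau> + a * \<mu>, L, x', y') y' + (1 + chi) / 4 * q
          \<le> potential (A, \<tau>, L, x, y) y'"
        unfolding q_def by (intro potential_step[OF inv a_def xt_def y'(1) N y'(2)]) (simp add: x'_def)
      moreover have "potential (A, \<tau>, L, x, y) y' \<le> 1 / 2 * (norm (y' - x0))\<^sup>2"
        using stop(3) N by (simp add: s)
      moreover have "0 \<le> potential (A + a, \<tau> + a * \<mu>, L, x', y') y'"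
        using i params by (simp add: potential_def)
      ultimately have "(1 + chi) / 2 * q \<le> (norm (y' - x0))\<^sup>2" by simp
      also have "\<dots> < chi * q" using y'(3) by (simp add: q_def mult_ac)
      finally have "(1 + chi) / 2 * q < chi * q" .
      moreover have "chi * q \<le> (1 + chi) / 2 * q"
        using params i L by (intro mult_right_mono) (auto simp: q_def)
      ultimately show False by simp
    qed
  next
    case (continue s s' r)
    obtain A \<tau> L x y where s: "s = (A, \<tau>, L, x, y)" by (cases s)
    note inv = continue(4)[unfolded s]
    define xt where "xt = prox_center A \<tau> L x y"
    define a where "a = step_a A \<tau> L"
    have L: "0 < L" using inv params by (auto simp: inv_def)
    have i: "0 \<le> A" "1 \<le> \<tau>" "0 < a" using inv step_a_props[OF inv] by (auto simp: inv_def a_def)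
    have "inv s'"
      using inv continue(1)[unfolded s] by (cases rule: fista_continue) (use inv inv_double in auto)
    moreover have "potential s' u \<le> potential s u" if u: "u \<in> N" for u
    proof -
      obtain y' where y': "is_prox L xt y'" and s': "s' = (A, \<tau>, 2 * L, x, y) \<or>
          (\<psi> xt + D xt \<bullet> (y' - xt) + (1 - chi) * L / 4 * (norm (y' - xt))\<^sup>2 \<ge> \<psi> y' \<and>
           s' = (A + a, \<tau> + a * \<mu>, L, ((\<mu> * a) *\<^sub>R y' + \<tau> *\<^sub>R x
             - a *\<^sub>R ((L - \<mu>) *\<^sub>R (xt - y'))) /\<^sub>R (\<tau> + a * \<mu>), y'))"
        using continue(1) unfolding s fista_iff[OF prox_center_in_ball(1)[OF inv]] Let_def
        by (auto split: if_splits simp: xt_def a_def)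
      from s' show ?thesis
      proof
        assume "s' = (A, \<tau>, 2 * L, x, y)"
        then show ?thesis by (simp add: s potential_def)
      next
        assume acc: "\<psi> xt + D xt \<bullet> (y' - xt) + (1 - chi) * L / 4 * (norm (y' - xt))\<^sup>2 \<ge> \<psi> y' \<and>
           s' = (A + a, \<tau> + a * \<mu>, L, ((\<mu> * a) *\<^sub>R y' + \<tau> *\<^sub>R x
             - a *\<^sub>R ((L - \<mu>) *\<^sub>R (xt - y'))) /\<^sub>R (\<tau> + a * \<mu>), y')"
        have "potential s' u + (1 + chi) / 4 * ((A + a) * L * (norm (y' - xt))\<^sup>2) \<le> potential s u"
          unfolding s acc[THEN conjunct2]
          by (rule potential_step[OF inv a_def xt_def y' u acc[THEN conjunct1] refl])
        moreover have "0 \<le> (1 + chi) / 4 * ((A + a) * L * (norm (y' - xt))\<^sup>2)"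
          using params i L by simp
        ultimately show ?thesis by simp
      qed
    qed
    ultimately show ?case using continue by (meson order_trans)
  qed
  have "\<forall>u\<in>N. potential (adap_fista_init x0 L0) u \<le> 1 / 2 * (norm (u - x0))\<^sup>2"
    by (simp add: potential_def adap_fista_init_def)
  then show ?thesis using *[OF _ inv_init[OF assms]] by blast
qed

end


section \<open>Convex functions of a low-rank factor\<close>

text \<open>A convex function \<open>g\<close> of a symmetric matrix with gradient \<open>G\<close>, which is Lipschitz continuous
  with constant \<open>Lg\<close>.\<close>

locale smooth_convex =
  fixes g :: "'n::finite symmat \<Rightarrow> real" and G :: "'n symmat \<Rightarrow> 'n symmat" and Lg :: real
  assumes Lg_nonneg: "0 \<le> Lg"
    and convex_below: "g X + G X \<bullet> (Y - X) \<le> g Y"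
    and smooth_above: "g Y \<le> g X + G X \<bullet> (Y - X) + Lg / 2 * (norm (Y - X))\<^sup>2"
    and gradient_lipschitz: "norm (G Y - G X) \<le> Lg * norm (Y - X)"
begin

lemma g_has_derivative: "(g has_derivative (\<lambda>h. G X \<bullet> h)) (at X within E)"
proof (rule has_derivative_from_quadratic_bound)
  fix Y
  show "\<bar>g Y - g X - G X \<bullet> (Y - X)\<bar> \<le> Lg / 2 * (norm (Y - X))\<^sup>2"
    using convex_below[of X Y] smooth_above[of Y X] by linarith
qed

lemma g_gradient: "gradient_on UNIV g X = G X"
  by (intro gradient_on_eqI g_has_derivative) auto

lemma g_continuous: "continuous_on E g"
  using g_has_derivative by (intro has_derivative_continuous_on)

lemma g_bounded_below:
  assumes "norm X \<le> 1"
  shows "g 0 - norm (G 0) \<le> g X"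
proof -
  have "\<bar>G 0 \<bullet> X\<bar> \<le> norm (G 0) * norm X" by (rule Cauchy_Schwarz_ineq2)
  also have "\<dots> \<le> norm (G 0) * 1" using assms by (intro mult_left_mono) auto
  finally show ?thesis using convex_below[of 0 X] by simp
qed

text \<open>The gradient of \<open>U \<mapsto> g (gram U)\<close>.\<close>

definition factor_grad :: "'n colmat \<Rightarrow> 'n colmat"
  where "factor_grad U = 2 *\<^sub>R mult_cols (G (gram U)) U"

text \<open>The increment of \<open>gram\<close> has a linear part and the quadratic part \<open>gram (V - U)\<close>, which meets the
  gradient of \<open>g\<close>; convexity of \<open>g\<close> is needed only for the lower bound.\<close>

lemma factor_remainder:
  "- (norm (G (gram U)) * (norm (V - U))\<^sup>2) \<le> g (gram V) - g (gram U) - factor_grad U \<bullet> (V - U)"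
  "g (gram V) - g (gram U) - factor_grad U \<bullet> (V - U)
    \<le> (norm (G (gram U)) + Lg / 2 * (norm V + norm U)\<^sup>2) * (norm (V - U))\<^sup>2"
proof -
  let ?G = "G (gram U)"
  have e: "?G \<bullet> (gram V - gram U) = factor_grad U \<bullet> (V - U) + ?G \<bullet> gram (V - U)"
    unfolding inner_gram inner_gram_diff factor_grad_def
    by (simp add: inner_diff_left inner_diff_right inner_add_right
        inner_mult_cols_commute[of ?G V U] algebra_simps)
  have "\<bar>?G \<bullet> gram (V - U)\<bar> \<le> norm ?G * norm (gram (V - U))" by (rule Cauchy_Schwarz_ineq2)
  also have "\<dots> \<le> norm ?G * (norm (V - U))\<^sup>2" by (intro mult_left_mono norm_gram_le) auto
  finally have q: "\<bar>?G \<bullet> gram (V - U)\<bar> \<le> norm ?G * (norm (V - U))\<^sup>2" .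
  then show "- (norm ?G * (norm (V - U))\<^sup>2) \<le> g (gram V) - g (gram U) - factor_grad U \<bullet> (V - U)"
    using convex_below[of "gram U" "gram V"] e by linarith
  have "Lg / 2 * (norm (gram V - gram U))\<^sup>2
      \<le> Lg / 2 * ((norm V + norm U)\<^sup>2 * (norm (V - U))\<^sup>2)"
    unfolding power_mult_distrib[symmetric] using Lg_nonneg by (intro mult_left_mono power_mono norm_gram_diff_le) auto
  then show "g (gram V) - g (gram U) - factor_grad U \<bullet> (V - U)
    \<le> (norm ?G + Lg / 2 * (norm V + norm U)\<^sup>2) * (norm (V - U))\<^sup>2"
    using smooth_above[of "gram V" "gram U"] e q
    unfolding distrib_right[of "norm ?G"] mult.assoc by linarith
qed

lemma factor_has_derivative:
  "((\<lambda>U. g (gram U)) has_derivative (\<lambda>h. factor_grad U \<bullet> h)) (at U within E)"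
proof (rule has_derivative_from_quadratic_bound)
  fix V assume V: "norm (V - U) \<le> 1"
  let ?K = "norm (G (gram U)) + Lg / 2 * (1 + norm U + norm U)\<^sup>2"
  have "norm V \<le> norm U + norm (V - U)" by (rule norm_triangle_sub)
  then have "norm V \<le> 1 + norm U" using V by linarith
  then have "(norm (G (gram U)) + Lg / 2 * (norm V + norm U)\<^sup>2) * (norm (V - U))\<^sup>2
      \<le> ?K * (norm (V - U))\<^sup>2"
    using Lg_nonneg by (intro mult_right_mono add_left_mono mult_left_mono power_mono) auto
  moreover have "norm (G (gram U)) * (norm (V - U))\<^sup>2 \<le> ?K * (norm (V - U))\<^sup>2"
    using Lg_nonneg by (intro mult_right_mono) auto
  ultimately show "\<bar>g (gram V) - g (gram U) - factor_grad U \<bullet> (V - U)\<bar> \<le> ?K * (norm (V - U))\<^sup>2"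
    using factor_remainder(1)[of U V] factor_remainder(2)[of V U] by linarith
qed

end


section \<open>ADAP-AIPP\<close>

lemma half_norm_square_expand:
  fixes u x w :: "'a::real_inner"
  shows "1 / 2 * (norm (u - w))\<^sup>2 = 1 / 2 * (norm (x - w))\<^sup>2 + (x - w) \<bullet> (u - x) + 1 / 2 * (norm (u - x))\<^sup>2"
proof -
  have "u - w = (x - w) + (u - x)" by simp
  then have "(norm (u - w))\<^sup>2 = (norm ((x - w) + (u - x)))\<^sup>2" by simp
  then show ?thesis
    unfolding power2_norm_eq_inner
    by (simp only: inner_add_left inner_add_right inner_commute[of "u - x" "x - w"]) simp
qed

text \<open>In \<open>C_sigma\<close> the factor \<open>(1 - \<sigma>)\<^sup>2\<close> comes from
  \<open>\<parallel>W - W\<^sub>0\<parallel> \<le> \<parallel>V + W\<^sub>0 - W\<parallel> / (1 - \<sigma>)\<close>.\<close>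

lemma prox_descent:
  fixes W W0 V :: "'a::real_inner"
  assumes "0 < \<sigma>" "\<sigma> < 1 / 2" "0 < lam" "norm V \<le> \<sigma> * norm (W - W0)"
    and "V \<bullet> (W0 - W) \<le> lam * d - 1 / 2 * (norm (W - W0))\<^sup>2"
  shows "lam * (norm ((V + W0 - W) /\<^sub>R lam))\<^sup>2 \<le> C_sigma \<sigma> * d"
proof -
  define p where "p = norm (V + W0 - W)"
  define r where "r = norm (W - W0)"
  define v where "v = norm V"
  have "r = norm (V - (V + W0 - W))" by (simp add: r_def)
  then have "r \<le> v + p" unfolding v_def p_def by (metis norm_triangle_ineq4)
  moreover have "v \<le> \<sigma> * r" using assms by (simp add: v_def r_def)
  ultimately have "(1 - \<sigma>) * r \<le> p" by (simp add: algebra_simps)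
  then have "\<sigma> * ((1 - \<sigma>) * r) \<le> \<sigma> * p" using assms by simp
  moreover have "(1 - \<sigma>) * v \<le> (1 - \<sigma>) * (\<sigma> * r)"
    using assms \<open>v \<le> \<sigma> * r\<close> by (intro mult_left_mono) auto
  ultimately have "(1 - \<sigma>) * v \<le> \<sigma> * p" by (simp add: mult_ac)
  then have "((1 - \<sigma>) * v)\<^sup>2 \<le> (\<sigma> * p)\<^sup>2"
    using assms by (intro power_mono) (auto simp: v_def)
  moreover have "p\<^sup>2 = v\<^sup>2 + 2 * (V \<bullet> (W0 - W)) + r\<^sup>2"
  proof -
    have "V + W0 - W = V + (W0 - W)" "r = norm (W0 - W)" by (simp_all add: r_def norm_minus_commute)
    then show ?thesis unfolding p_def v_def power2_norm_eq_inner
      by (simp only: power2_norm_eq_inner inner_add_left inner_add_right inner_commute[of "W0 - W" V])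
  qed
  then have "p\<^sup>2 - v\<^sup>2 \<le> 2 * lam * d" using assms(5) by (simp add: r_def)
  then have "(1 - \<sigma>)\<^sup>2 * (p\<^sup>2 - v\<^sup>2) \<le> (1 - \<sigma>)\<^sup>2 * (2 * lam * d)" by (intro mult_left_mono) auto
  ultimately have "(1 - 2 * \<sigma>) * p\<^sup>2 \<le> (1 - \<sigma>)\<^sup>2 * (2 * lam * d)"
    by (simp add: power2_eq_square algebra_simps)
  then have "p\<^sup>2 \<le> lam * (C_sigma \<sigma> * d)"
    using assms(2) by (simp add: C_sigma_def field_simps)
  moreover have "norm ((V + W0 - W) /\<^sub>R lam) = p / lam"
    using assms(3) by (simp add: p_def divide_inverse)
  then have "lam * (norm ((V + W0 - W) /\<^sub>R lam))\<^sup>2 = p\<^sup>2 / lam"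
    using assms(3) by (simp add: power2_eq_square)
  moreover have "p\<^sup>2 / lam \<le> C_sigma \<sigma> * d"
    using calculation(1) assms(3) by (simp add: divide_le_eq mult.commute)
  ultimately show ?thesis by simp
qed

text \<open>The setting of ADAP-AIPP and HLR. \<open>Gb\<close> bounds the gradient of \<open>g\<close> on the ball where
  ADAP-FISTA linearizes. \<open>1 / K\<close> is a lower bound for the prox stepsizes.\<close>

locale low_rank_method = smooth_convex g G Lg
  for g :: "'n::finite symmat \<Rightarrow> real" and G :: "'n symmat \<Rightarrow> 'n symmat" and Lg :: real +
  fixes Gb \<sigma> chi \<rho> K :: real
  assumes gradient_bound: "norm U \<le> 3 \<Longrightarrow> norm (G (gram U)) \<le> Gb"
    and method_params: "0 < \<sigma>" "\<sigma> < 1 / 2" "0 < chi" "chi < 1" "0 < \<rho>"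
    and K_ge: "4 * (2 * Gb + 36 * Lg) \<le> K"
begin

lemma Gb_nonneg: "0 \<le> Gb"
  using order_trans[OF norm_ge_zero gradient_bound[of 0]] by simp

text \<open>A bound for the curvature of \<open>U \<mapsto> g (gram U)\<close>.\<close>

definition Lt :: real
  where "Lt = 2 * Gb + 36 * Lg"

lemma Lt_nonneg: "0 \<le> Lt"
  using Gb_nonneg Lg_nonneg by (simp add: Lt_def)

lemma factor_curvature:
  assumes "norm U \<le> 3" "norm V \<le> 1"
  shows "\<bar>g (gram V) - g (gram U) - factor_grad U \<bullet> (V - U)\<bar> \<le> Lt / 2 * (norm (V - U))\<^sup>2"
    and "norm (factor_grad V - factor_grad U) \<le> Lt * norm (V - U)"
proof -
  have G: "norm (G (gram U)) \<le> Gb" "norm (G (gram V)) \<le> Gb" using assms gradient_bound by auto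
  have "(norm V + norm U)\<^sup>2 \<le> 6\<^sup>2" using assms by (intro power_mono) auto
  then have "Lg / 2 * (norm V + norm U)\<^sup>2 \<le> Lg / 2 * 36" using Lg_nonneg by (intro mult_left_mono) auto
  then have "(norm (G (gram U)) + Lg / 2 * (norm V + norm U)\<^sup>2) * (norm (V - U))\<^sup>2
      \<le> Lt / 2 * (norm (V - U))\<^sup>2"
    using G by (intro mult_right_mono) (auto simp: Lt_def)
  moreover have "norm (G (gram U)) * (norm (V - U))\<^sup>2 \<le> Lt / 2 * (norm (V - U))\<^sup>2"
    using G Lg_nonneg by (intro mult_right_mono) (auto simp: Lt_def)
  ultimately show "\<bar>g (gram V) - g (gram U) - factor_grad U \<bullet> (V - U)\<bar> \<le> Lt / 2 * (norm (V - U))\<^sup>2"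
    using factor_remainder(1)[of U V] factor_remainder(2)[of V U] by linarith
  have "norm (factor_grad V - factor_grad U)
      = norm (2 *\<^sub>R (mult_cols (G (gram V)) (V - U) + mult_cols (G (gram V) - G (gram U)) U))"
    unfolding factor_grad_def scaleR_diff_right[symmetric] by simp
  also have "\<dots> \<le> 2 * (norm (mult_cols (G (gram V)) (V - U))
      + norm (mult_cols (G (gram V) - G (gram U)) U))"
    using norm_triangle_ineq[of "mult_cols (G (gram V)) (V - U)" "mult_cols (G (gram V) - G (gram U)) U"]
    by (simp del: mult_cols_diff mult_cols_diff_left)
  also have "norm (mult_cols (G (gram V)) (V - U)) \<le> Gb * norm (V - U)"
    using G by (intro order_trans[OF norm_mult_cols_le] mult_right_mono) auto
  also have "norm (mult_cols (G (gram V) - G (gram U)) U) \<le> norm (G (gram V) - G (gram U)) * norm U"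
    by (rule norm_mult_cols_le)
  also have "\<dots> \<le> (Lg * ((norm V + norm U) * norm (V - U))) * 3"
    using assms Lg_nonneg
    by (intro mult_mono order_trans[OF gradient_lipschitz] norm_gram_diff_le) auto
  also have "\<dots> \<le> (Lg * (4 * norm (V - U))) * 3"
    using assms Lg_nonneg by (intro mult_right_mono mult_left_mono) auto
  also have "2 * (Gb * norm (V - U) + \<dots>) \<le> Lt * norm (V - U)"
    using Lg_nonneg by (simp add: Lt_def algebra_simps)
  finally show "norm (factor_grad V - factor_grad U) \<le> Lt * norm (V - U)" by simp
qed

text \<open>The smooth part of the objective in a call of ADAP-FISTA with prox center \<open>W0\<close> and prox
  stepsize \<open>lam\<close>, and its gradient.\<close>

definition prox_fun :: "real \<Rightarrow> 'n colmat \<Rightarrow> 'n colmat \<Rightarrow> real"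
  where "prox_fun lam W0 U = lam * g (gram U) + 1 / 2 * (norm (U - W0))\<^sup>2"

definition prox_grad :: "real \<Rightarrow> 'n colmat \<Rightarrow> 'n colmat \<Rightarrow> 'n colmat"
  where "prox_grad lam W0 U = lam *\<^sub>R factor_grad U + (U - W0)"

abbreviation fista_call :: "nat \<Rightarrow> real \<Rightarrow> 'n colmat \<Rightarrow>
    (real \<times> real \<times> real \<times> 'n colmat \<times> 'n colmat, ('n colmat \<times> 'n colmat \<times> real) option) method_pass"
  where "fista_call s lam W0 \<equiv> adap_fista_pass \<sigma> chi (cols s) W0 (1 / 2)
    (\<lambda>U. lam * g (gram U) + 1 / 2 * (norm (U - W0))\<^sup>2)
    (\<lambda>U. ereal lam * indicator_fn (unit_ball s) U)"

lemma prox_fun_remainder: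
  "prox_fun lam W0 u - prox_fun lam W0 x - prox_grad lam W0 x \<bullet> (u - x)
    = lam * (g (gram u) - g (gram x) - factor_grad x \<bullet> (u - x)) + 1 / 2 * (norm (u - x))\<^sup>2"
  unfolding prox_fun_def prox_grad_def half_norm_square_expand[of u W0 x]
  by (simp add: inner_add_left algebra_simps)

lemma adap_fista_call:
  assumes W0: "W0 \<in> unit_ball s" and lam: "0 < lam"
  shows "adap_fista (cols s) (prox_fun lam W0) (prox_grad lam W0) (lam * Lt + 1) \<sigma> chi (1 / 2) W0"
proof
  show "subspace (cols s)" by (rule subspace_cols)
  show "W0 \<in> cols s" "norm W0 \<le> 1" using W0 by (auto simp: unit_ball_def)
  show "0 \<le> lam * Lt + 1" using lam Lt_nonneg by simp
  show "0 < \<sigma>" "0 < chi" "chi < 1" "0 < (1 / 2 :: real)" using method_params by auto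
next
  fix x :: "'n colmat" assume x: "x \<in> cols s"
  show "prox_grad lam W0 x \<in> cols s"
    unfolding prox_grad_def factor_grad_def
    using x W0 subspace_cols
    by (intro subspace_add subspace_scale subspace_diff mult_cols_in_cols) (auto simp: unit_ball_def)
  have "((\<lambda>U. 1 / 2 * (norm (U - W0))\<^sup>2) has_derivative (\<lambda>h. (x - W0) \<bullet> h)) (at x within cols s)"
  proof (rule has_derivative_from_quadratic_bound)
    fix u
    show "\<bar>1 / 2 * (norm (u - W0))\<^sup>2 - 1 / 2 * (norm (x - W0))\<^sup>2 - (x - W0) \<bullet> (u - x)\<bar>
        \<le> 1 / 2 * (norm (u - x))\<^sup>2"
      unfolding half_norm_square_expand[of u W0 x] by simp
  qed
  from has_derivative_add[OF has_derivative_mult_right[OF factor_has_derivative, of lam] this]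
  show "(prox_fun lam W0 has_derivative (\<lambda>h. prox_grad lam W0 x \<bullet> h)) (at x within cols s)"
    unfolding prox_fun_def prox_grad_def by (simp add: inner_add_left)
next
  fix x u :: "'n colmat" assume xu: "norm x \<le> 3" "norm u \<le> 1"
  have "lam * (g (gram u) - g (gram x) - factor_grad x \<bullet> (u - x)) \<le> lam * (Lt / 2 * (norm (u - x))\<^sup>2)"
    using lam by (intro mult_left_mono) (use factor_curvature(1)[OF xu] in linarith)+
  moreover have "(lam * Lt + 1) / 2 * (norm (u - x))\<^sup>2
      = lam * (Lt / 2 * (norm (u - x))\<^sup>2) + 1 / 2 * (norm (u - x))\<^sup>2"
    by (simp add: field_simps)
  ultimately show "prox_fun lam W0 u \<le> prox_fun lam W0 x + prox_grad lam W0 x \<bullet> (u - x)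
      + (lam * Lt + 1) / 2 * (norm (u - x))\<^sup>2"
    using prox_fun_remainder[of lam W0 u x] by linarith
  have "prox_grad lam W0 u - prox_grad lam W0 x
      = lam *\<^sub>R (factor_grad u - factor_grad x) + (u - x)"
    by (simp add: prox_grad_def scaleR_diff_right)
  then have "norm (prox_grad lam W0 u - prox_grad lam W0 x)
      \<le> lam * norm (factor_grad u - factor_grad x) + norm (u - x)"
    using norm_triangle_ineq[of "lam *\<^sub>R (factor_grad u - factor_grad x)" "u - x"] lam by simp
  also have "\<dots> \<le> lam * (Lt * norm (u - x)) + norm (u - x)"
    using factor_curvature(2)[OF xu] lam by (intro add_right_mono mult_left_mono) auto
  finally show "norm (prox_grad lam W0 u - prox_grad lam W0 x) \<le> (lam * Lt + 1) * norm (u - x)"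
    by (simp add: algebra_simps)
qed

text \<open>The stepsize condition makes the smooth part \<open>1/2\<close>-strongly convex. Then the descent test of
  ADAP-AIPP follows from the subgradient inequality, since \<open>V - prox_grad lam W0 W\<close> is normal to
  the ball at \<open>W\<close>.\<close>

lemma fista_call_facts:
  assumes W0: "W0 \<in> unit_ball s" and lam: "0 < lam" and L0: "1 \<le> L0"
  defines "init \<equiv> adap_fista_init W0 L0"
  shows "halts (fista_call s lam W0) init"
    and "returns (fista_call s lam W0) init (Some (W, V, L)) \<Longrightarrow>
      W \<in> unit_ball s \<and> 1 \<le> L \<and> norm V \<le> \<sigma> * norm (W - W0)"
    and "2 * Lt * lam \<le> 1 \<Longrightarrow> \<not> returns (fista_call s lam W0) init None"
    and "2 * Lt * lam \<le> 1 \<Longrightarrow> returns (fista_call s lam W0) init (Some (W, V, L)) \<Longrightarrow>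
      V \<bullet> (W0 - W) \<le> lam * g (gram W0) - (lam * g (gram W) + 1 / 2 * (norm (W - W0))\<^sup>2)"
proof -
  interpret F: adap_fista "cols s" "prox_fun lam W0" "prox_grad lam W0" "lam * Lt + 1" \<sigma> chi "1 / 2" W0
    by (rule adap_fista_call[OF W0 lam])
  have N: "F.N = unit_ball s" by (simp add: F.N_def unit_ball_def)
  have "(\<lambda>U. ereal lam * indicator_fn (unit_ball s) U) = indicator_fn F.N"
    using lam by (auto simp: fun_eq_iff indicator_fn_def N)
  then have call: "fista_call s lam W0 = F.fista"
    unfolding prox_fun_def by simp
  have L0': "1 / 2 < L0" using L0 by simp
  show "halts (fista_call s lam W0) init" unfolding call init_def by (rule F.fista_halts[OF L0'])
  note succ = F.fista_success[OF L0', folded init_def call, unfolded N]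
  show "W \<in> unit_ball s \<and> 1 \<le> L \<and> norm V \<le> \<sigma> * norm (W - W0)"
    if "returns (fista_call s lam W0) init (Some (W, V, L))"
    using succ[OF that] L0 by auto
  have convex: "prox_fun lam W0 x + prox_grad lam W0 x \<bullet> (u - x) + (1 / 2) / 2 * (norm (u - x))\<^sup>2
      \<le> prox_fun lam W0 u" if small: "2 * Lt * lam \<le> 1" and xu: "norm x \<le> 3" "norm u \<le> 1" for x u
  proof -
    have "lam * (- (Lt / 2 * (norm (u - x))\<^sup>2)) \<le> lam * (g (gram u) - g (gram x) - factor_grad x \<bullet> (u - x))"
      using lam by (intro mult_left_mono) (use factor_curvature(1)[OF xu] in linarith)+
    moreover have "(2 * Lt * lam) * (norm (u - x))\<^sup>2 \<le> 1 * (norm (u - x))\<^sup>2"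
      using small by (intro mult_right_mono) auto
    ultimately show ?thesis using prox_fun_remainder[of lam W0 u x] by (simp add: field_simps)
  qed
  {
    assume small: "2 * Lt * lam \<le> 1"
    interpret C: adap_fista_convex "cols s" "prox_fun lam W0" "prox_grad lam W0" "lam * Lt + 1"
      \<sigma> chi "1 / 2" W0
      by unfold_locales (use convex[OF small] in auto)
    show "\<not> returns (fista_call s lam W0) init None"
      unfolding call init_def by (rule C.fista_never_fails[OF L0'])
    assume ret: "returns (fista_call s lam W0) init (Some (W, V, L))"
    have norms: "norm W \<le> 1" "norm W0 \<le> 1" using succ(1)[OF ret] W0 by (auto simp: unit_ball_def)
    have "0 \<le> (1 / 2) / 2 * (norm (W0 - W))\<^sup>2" by simp
    then have "prox_fun lam W0 W + prox_grad lam W0 W \<bullet> (W0 - W) \<le> prox_fun lam W0 W0"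
      using convex[OF small, of W W0] norms by linarith
    moreover have "(V - prox_grad lam W0 W) \<bullet> (W0 - W) \<le> 0" by (rule succ(4)[OF ret W0])
    ultimately show "V \<bullet> (W0 - W)
        \<le> lam * g (gram W0) - (lam * g (gram W) + 1 / 2 * (norm (W - W0))\<^sup>2)"
      by (simp add: prox_fun_def inner_diff_left)
  }
qed

text \<open>A decrease of \<open>g\<close> by \<open>1 / descent_rate\<close> is guaranteed in each accepted iteration of ADAP-AIPP
  that does not stop.\<close>

definition descent_rate :: real
  where "descent_rate = C_sigma \<sigma> * K / \<rho>\<^sup>2"

definition aipp_inv :: "nat \<Rightarrow> 'n colmat \<times> real \<times> real \<times> nat \<Rightarrow> bool"
  where "aipp_inv s = (\<lambda>(W0, lam, M, N). W0 \<in> unit_ball s \<and> 0 < lam \<and> 1 \<le> lam * K \<and> 1 \<le> M)"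

lemma K_pos: "0 < lam \<Longrightarrow> 1 \<le> lam * K \<Longrightarrow> 0 < K"
  by (metis linorder_not_less mult_nonneg_nonpos not_one_le_zero order.trans less_imp_le)

lemma C_sigma_pos: "0 < C_sigma \<sigma>"
  using method_params by (simp add: C_sigma_def)

lemma aipp_descent:
  assumes "0 < lam" "1 \<le> lam * K" "norm V \<le> \<sigma> * norm (W - W0)"
    "V \<bullet> (W0 - W) \<le> lam * g (gram W0) - (lam * g (gram W) + 1 / 2 * (norm (W - W0))\<^sup>2)"
  shows "g (gram W) \<le> g (gram W0)"
    "\<rho> < norm ((V + W0 - W) /\<^sub>R lam) \<Longrightarrow> 1 \<le> descent_rate * (g (gram W0) - g (gram W))"
proof -
  let ?R = "(V + W0 - W) /\<^sub>R lam"
  have *: "lam * (norm ?R)\<^sup>2 \<le> C_sigma \<sigma> * (g (gram W0) - g (gram W))"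
    by (rule prox_descent) (use assms method_params in \<open>simp_all add: algebra_simps\<close>)
  moreover have "0 \<le> lam * (norm ?R)\<^sup>2" using assms by simp
  ultimately have "0 \<le> C_sigma \<sigma> * (g (gram W0) - g (gram W))" by linarith
  then show "g (gram W) \<le> g (gram W0)"
    using C_sigma_pos by (simp add: zero_le_mult_iff)
  assume "\<rho> < norm ?R"
  then have "\<rho>\<^sup>2 \<le> (norm ?R)\<^sup>2" using method_params by (intro power_mono) auto
  then have "1 * \<rho>\<^sup>2 \<le> (lam * K) * (norm ?R)\<^sup>2" using assms by (intro mult_mono) auto
  also have "\<dots> \<le> K * (C_sigma \<sigma> * (g (gram W0) - g (gram W)))"
    using * K_pos[OF assms(1,2)] by (simp add: mult_ac)
  finally show "1 \<le> descent_rate * (g (gram W0) - g (gram W))"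
    using method_params by (simp add: descent_rate_def field_simps)
qed

text \<open>Halving happens only while \<open>2 Lt lam > 1\<close>, and then \<open>lam / 2 * K \<ge> 2 Lt lam > 1\<close>.\<close>

lemma aipp_pass_cases:
  assumes inv: "aipp_inv s (W0, lam, M, N)"
    and pass: "adap_aipp_pass \<sigma> chi s g \<rho> (W0, lam, M, N) out"
  obtains (halve) "out = Continue (W0, lam / 2, M, N + 1)" "1 \<le> lam / 2 * K"
  | (proceed) W L where "out = Continue (W, lam, L, N + 1)" "W \<in> unit_ball s" "1 \<le> L"
      "1 \<le> descent_rate * (g (gram W0) - g (gram W))"
  | (stop) W R where "out = Stop (W, R, N + 1)" "W \<in> unit_ball s" "g (gram W) \<le> g (gram W0)"
proof -
  have i: "W0 \<in> unit_ball s" "0 < lam" "1 \<le> lam * K" "1 \<le> M" using inv by (auto simp: aipp_inv_def)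
  have large: "1 \<le> lam / 2 * K" if "\<not> 2 * Lt * lam \<le> 1"
  proof -
    have "lam * (4 * Lt) \<le> lam * K" using K_ge i by (intro mult_left_mono) (auto simp: Lt_def)
    then have "2 * (2 * Lt * lam) \<le> lam * K" by (simp add: mult_ac)
    with that have "2 \<le> lam * K" by linarith
    then show ?thesis by simp
  qed
  obtain L0 where L0: "1 \<le> L0" and *: "\<not> halts (fista_call s lam W0) (adap_fista_init W0 L0) \<and> out = Hang \<or>
       (\<exists>res. returns (fista_call s lam W0) (adap_fista_init W0 L0) res \<and>
        out = (case res of
            None \<Rightarrow> Continue (W0, lam / 2, M, N + 1)
          | Some (W, V, L) \<Rightarrow>
              if \<not> lam * g (gram W0) - (lam * g (gram W) + 1 / 2 * (norm (W - W0))\<^sup>2) \<ge> V \<bullet> (W0 - W)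
              then Continue (W0, lam / 2, M, N + 1)
              else
                let R = (V + W0 - W) /\<^sub>R lam
                in if norm R \<le> \<rho> then Stop (W, R, N + 1)
                   else Continue (W, lam, L, N + 1)))"
    using pass unfolding adap_aipp_pass_def prod.case Let_def by blast
  note facts = fista_call_facts[OF i(1,2) L0]
  from * facts(1) obtain res where res: "returns (fista_call s lam W0) (adap_fista_init W0 L0) res"
    and out: "out = (case res of
            None \<Rightarrow> Continue (W0, lam / 2, M, N + 1)
          | Some (W, V, L) \<Rightarrow>
              if \<not> lam * g (gram W0) - (lam * g (gram W) + 1 / 2 * (norm (W - W0))\<^sup>2) \<ge> V \<bullet> (W0 - W)
              then Continue (W0, lam / 2, M, N + 1)
              else
                let R = (V + W0 - W) /\<^sub>R lam
                in if norm R \<le> \<rho> then Stop (W, R, N + 1)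
                   else Continue (W, lam, L, N + 1))" by blast
  show thesis
  proof (cases res)
    case None
    then show thesis using halve out facts(3) large res by auto
  next
    case (Some t)
    then obtain W V L where t: "res = Some (W, V, L)" by (cases t) auto
    note props = facts(2)[OF res[unfolded t]]
    show thesis
    proof (cases "V \<bullet> (W0 - W) \<le> lam * g (gram W0) - (lam * g (gram W) + 1 / 2 * (norm (W - W0))\<^sup>2)")
      case False
      then show thesis using halve out facts(4)[of W V L] large res by (auto simp: t)
    next
      case True
      note descent = aipp_descent[OF i(2,3) _ True]
      show thesis
        using True out descent props stop proceed
        by (cases "norm ((V + W0 - W) /\<^sub>R lam) \<le> \<rho>") (auto simp: t Let_def)
    qed
  qed
qed

lemma unit_ball_bounded_below:
  assumes "W \<in> unit_ball s"
  shows "g 0 - norm (G 0) \<le> g (gram W)"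
proof (rule g_bounded_below)
  have "(norm W)\<^sup>2 \<le> 1" using assms by (simp add: unit_ball_def power_le_one)
  then show "norm (gram W) \<le> 1" using norm_gram_le[of W] by linarith
qed

lemma aipp_halts:
  assumes "W \<in> unit_ball s" "0 < lam" "1 \<le> lam * K"
  shows "halts (adap_aipp_pass \<sigma> chi s g \<rho>) (adap_aipp_init W lam)"
proof (rule halts_by_measure[where I = "aipp_inv s" and V = "\<lambda>(W0, lam, M, N).
    log 2 (lam * K) + descent_rate * (g (gram W0) - (g 0 - norm (G 0)))"])
  let ?pass = "adap_aipp_pass \<sigma> chi s g \<rho>"
  have K: "0 < K" using assms K_pos by blast
  then have rate: "0 \<le> descent_rate" using C_sigma_pos by (simp add: descent_rate_def)
  show "aipp_inv s (adap_aipp_init W lam)"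
    using assms by (simp add: aipp_inv_def adap_aipp_init_def)
  fix st assume inv: "aipp_inv s st"
  obtain W0 lam M N where st: "st = (W0, lam, M, N)" by (cases st)
  have i: "W0 \<in> unit_ball s" "0 < lam" "1 \<le> lam * K" "1 \<le> M"
    using inv by (auto simp: aipp_inv_def st)
  obtain res where "returns (fista_call s lam W0) (adap_fista_init W0 1) res"
    using halts_imp_returns[OF fista_call_facts(1)[OF i(1,2), of 1]] by auto
  then show "\<exists>out. ?pass st out"
    unfolding st adap_aipp_pass_def prod.case Let_def using i(4) by blast
  show "\<not> ?pass st Hang"
    using aipp_pass_cases[OF inv[unfolded st], of Hang] by (auto simp: st)
  show "0 \<le> (case st of (W0, lam, M, N) \<Rightarrow>
      log 2 (lam * K) + descent_rate * (g (gram W0) - (g 0 - norm (G 0))))"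
    using i rate unit_ball_bounded_below[OF i(1)] by (simp add: st)
  fix st' assume pass: "?pass st (Continue st')"
  show "aipp_inv s st' \<and> (case st' of (W0, lam, M, N) \<Rightarrow>
      log 2 (lam * K) + descent_rate * (g (gram W0) - (g 0 - norm (G 0)))) + 1
    \<le> (case st of (W0, lam, M, N) \<Rightarrow>
      log 2 (lam * K) + descent_rate * (g (gram W0) - (g 0 - norm (G 0))))"
    using inv[unfolded st] pass[unfolded st]
  proof (cases rule: aipp_pass_cases)
    case halve
    have "log 2 (lam / 2 * K) = log 2 (lam * K) - 1"
      using K i by (simp add: log_mult log_divide)
    then show ?thesis using halve i by (simp add: aipp_inv_def st)
  next
    case (proceed W L)
    then show ?thesis using i by (simp add: aipp_inv_def st algebra_simps)
  qed auto
qed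

lemma aipp_returns:
  assumes "W0 \<in> unit_ball s" "0 < lam" "1 \<le> lam * K"
    and "returns (adap_aipp_pass \<sigma> chi s g \<rho>) (adap_aipp_init W0 lam) (W, R, N)"
  shows "W \<in> unit_ball s" "g (gram W) \<le> g (gram W0)"
    "real N \<le> 1 + log 2 (lam * K) + descent_rate * (g (gram W0) - g (gram W))"
proof -
  have K: "0 < K" using assms K_pos by blast
  then have rate: "0 < descent_rate" using C_sigma_pos method_params by (simp add: descent_rate_def)
  have *: "W \<in> unit_ball s \<and> g (gram W) \<le> g (gram W0) \<and>
      real N \<le> real N0 + 1 + log 2 (lam * K) + descent_rate * (g (gram W0) - g (gram W))"
    if "returns (adap_aipp_pass \<sigma> chi s g \<rho>) st r" "aipp_inv s st"
      "st = (W0, lam, M, N0)" "r = (W, R, N)" for st r W0 lam M N0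
    using that
  proof (induction arbitrary: W0 lam M N0)
    case (stop st r)
    have log: "0 \<le> log 2 (lam * K)" using stop by (simp add: aipp_inv_def)
    show ?case
      using stop(2)[unfolded stop(3)] stop(1)[unfolded stop(3)]
      by (cases rule: aipp_pass_cases) (use stop(4) rate log in auto)
  next
    case (continue st st' r)
    note inv = continue(4)[unfolded continue(5)]
    have i: "W0 \<in> unit_ball s" "0 < lam" "1 \<le> lam * K" "1 \<le> M" using inv by (auto simp: aipp_inv_def)
    from inv continue(1)[unfolded continue(5)] show ?case
    proof (cases rule: aipp_pass_cases)
      case halve
      have "log 2 (lam / 2 * K) = log 2 (lam * K) - 1"
        using K i by (simp add: log_mult log_divide)
      then show ?thesis
        using halve i continue(3)[of W0 "lam / 2" M "N0 + 1"] continue(6) by (simp add: aipp_inv_def)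
    next
      case (proceed W1 L)
      have "0 < descent_rate * (g (gram W0) - g (gram W1))" using proceed by linarith
      then have "g (gram W1) \<le> g (gram W0)" using rate by (simp add: zero_less_mult_iff)
      then show ?thesis
        using proceed i continue(3)[of W1 lam L "N0 + 1"] continue(6)
        by (simp add: aipp_inv_def algebra_simps)
    qed auto
  qed
  have inv: "aipp_inv s (adap_aipp_init W0 lam)"
    using assms by (simp add: aipp_inv_def adap_aipp_init_def)
  show "W \<in> unit_ball s" "g (gram W) \<le> g (gram W0)"
    "real N \<le> 1 + log 2 (lam * K) + descent_rate * (g (gram W0) - g (gram W))"
    using *[OF assms(4) inv, of W0 lam 1 0] by (auto simp: adap_aipp_init_def)
qed

end


section \<open>Frank--Wolfe steps\<close>

text \<open>A bound for the number of further steps of a method whose optimality gap \<open>h\<close> decreases by at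
  least \<open>(max h \<epsilon>)\<^sup>2 / (2 M)\<close> in each step. It is concave with derivative
  \<open>2 M / (max h \<epsilon>)\<^sup>2\<close>.\<close>

definition gap_steps :: "real \<Rightarrow> real \<Rightarrow> real \<Rightarrow> real"
  where "gap_steps M \<epsilon> h = (if h \<le> \<epsilon> then 2 * M * h / \<epsilon>\<^sup>2 else 4 * M / \<epsilon> - 2 * M / h)"

lemma gap_steps_concave:
  assumes "0 < \<epsilon>" "0 < M" "0 \<le> h'" "h' \<le> h"
  shows "2 * M / (max h \<epsilon>)\<^sup>2 * (h - h') \<le> gap_steps M \<epsilon> h - gap_steps M \<epsilon> h'"
proof (cases "h \<le> \<epsilon>")
  case True
  then show ?thesis using assms by (simp add: gap_steps_def max_def field_simps)
next
  case False
  have h: "0 < h" "\<epsilon> < h" using False assms by auto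
  show ?thesis
  proof (cases "h' \<le> \<epsilon>")
    case True
    have "h' / \<epsilon> \<le> 1" "h' / h \<le> 1" using True assms h by (auto simp: field_simps)
    then have "0 \<le> 2 - h' / \<epsilon> - h' / h" by linarith
    moreover have "0 \<le> 1 / \<epsilon> - 1 / h" using assms h by (simp add: field_simps)
    ultimately have "0 \<le> (1 / \<epsilon> - 1 / h) * (2 - h' / \<epsilon> - h' / h)"
      by (intro mult_nonneg_nonneg)
    also have "\<dots> = 2 / \<epsilon> - 1 / h - h' / \<epsilon>\<^sup>2 - (h - h') / h\<^sup>2"
      using assms h by (simp add: field_simps power2_eq_square)
    finally have "0 \<le> 2 * M * (2 / \<epsilon> - 1 / h - h' / \<epsilon>\<^sup>2 - (h - h') / h\<^sup>2)"
      using assms by simp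
    also have "\<dots> = gap_steps M \<epsilon> h - gap_steps M \<epsilon> h' - 2 * M / h\<^sup>2 * (h - h')"
      using True False by (simp add: gap_steps_def algebra_simps)
    finally show ?thesis using h by (simp add: max_def)
  next
    case h': False
    have "2 * M / h\<^sup>2 * (h - h') = 2 * M * ((h - h') / h) * (1 / h)"
      by (simp add: power2_eq_square)
    also have "\<dots> \<le> 2 * M * ((h - h') / h) * (1 / h')"
      using assms h h' by (intro mult_left_mono) (auto simp: field_simps)
    also have "\<dots> = gap_steps M \<epsilon> h - gap_steps M \<epsilon> h'"
      using assms h h' by (simp add: gap_steps_def field_simps)
    finally show ?thesis using h by (simp add: max_def)
  qed
qed

lemma gap_steps_mono:
  assumes "0 < \<epsilon>" "0 < M" "0 \<le> h'" "h' \<le> h"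
  shows "gap_steps M \<epsilon> h' \<le> gap_steps M \<epsilon> h"
proof -
  have "0 \<le> 2 * M / (max h \<epsilon>)\<^sup>2 * (h - h')" using assms by simp
  then show ?thesis using gap_steps_concave[OF assms] by linarith
qed

lemma gap_steps_decrease:
  assumes "0 < \<epsilon>" "0 < M" "0 \<le> h'" "h' \<le> h - (max h \<epsilon>)\<^sup>2 / (2 * M)"
  shows "gap_steps M \<epsilon> h' + 1 \<le> gap_steps M \<epsilon> h"
proof -
  have pos: "0 < (max h \<epsilon>)\<^sup>2" using assms by (simp add: max_def)
  have "0 \<le> (max h \<epsilon>)\<^sup>2 / (2 * M)" using assms by simp
  then have "h' \<le> h" using assms by linarith
  have "1 = 2 * M / (max h \<epsilon>)\<^sup>2 * ((max h \<epsilon>)\<^sup>2 / (2 * M))" using pos assms by simp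
  also have "\<dots> \<le> 2 * M / (max h \<epsilon>)\<^sup>2 * (h - h')"
    using assms pos by (intro mult_left_mono) auto
  finally show ?thesis using gap_steps_concave[OF assms(1-3) \<open>h' \<le> h\<close>] by linarith
qed

text \<open>After one step with unit stepsize the gap is at most \<open>Q / 2\<close>, whatever it was before;
  hence a bound that does not depend on the initial gap.\<close>

definition fw_steps :: "real \<Rightarrow> real \<Rightarrow> real \<Rightarrow> real"
  where "fw_steps Q \<epsilon> h = (let M = max Q \<epsilon> in
    if h \<le> M / 2 then gap_steps M \<epsilon> h else 1 + gap_steps M \<epsilon> (M / 2))"

lemma fw_steps_nonneg:
  assumes "0 < \<epsilon>" "0 \<le> h"
  shows "0 \<le> fw_steps Q \<epsilon> h"
proof -
  have "0 \<le> gap_steps (max Q \<epsilon>) \<epsilon> x" if "0 \<le> x" for x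
    using gap_steps_mono[of \<epsilon> "max Q \<epsilon>" 0 x] that assms by (simp add: gap_steps_def less_max_iff_disj)
  then show ?thesis using assms by (simp add: fw_steps_def Let_def less_max_iff_disj)
qed

lemma fw_steps_mono:
  assumes "0 < \<epsilon>" "0 \<le> h'" "h' \<le> h"
  shows "fw_steps Q \<epsilon> h' \<le> fw_steps Q \<epsilon> h"
proof -
  define M where "M = max Q \<epsilon>"
  have M: "0 < M" using assms by (simp add: M_def)
  show ?thesis
    using gap_steps_mono[OF assms(1) M assms(2), of h] gap_steps_mono[OF assms(1) M assms(2), of "M / 2"]
      assms(3)
    unfolding fw_steps_def Let_def M_def[symmetric] by auto
qed

lemma fw_steps_le:
  assumes "0 < \<epsilon>" "0 \<le> h"
  shows "fw_steps Q \<epsilon> h \<le> max 12 (4 * Q / \<epsilon>)"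
proof -
  define M where "M = max Q \<epsilon>"
  have M: "0 < M" "\<epsilon> \<le> M" using assms by (auto simp: M_def)
  have "fw_steps Q \<epsilon> h \<le> 1 + gap_steps M \<epsilon> (M / 2)"
    using gap_steps_mono[OF assms(1) M(1) assms(2), of "M / 2"]
    unfolding fw_steps_def Let_def M_def[symmetric] by auto
  also have "\<dots> \<le> max 12 (4 * Q / \<epsilon>)"
  proof (cases "M / 2 \<le> \<epsilon>")
    case True
    have "M\<^sup>2 \<le> (2 * \<epsilon>)\<^sup>2" using True M by (intro power_mono) auto
    then have "M * M / \<epsilon>\<^sup>2 \<le> 4" using assms by (simp add: field_simps power2_eq_square)
    then show ?thesis using True by (simp add: gap_steps_def)
  next
    case False
    then have "M = Q" using assms by (auto simp: M_def)
    moreover have "gap_steps M \<epsilon> (M / 2) = 4 * M / \<epsilon> - 4" using False M by (simp add: gap_steps_def)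
    ultimately show ?thesis by simp
  qed
  finally show ?thesis .
qed

lemma fw_steps_decrease:
  assumes "0 < \<epsilon>" "0 \<le> h'" "h' \<le> Q / 2"
    and "h \<le> max Q \<epsilon> / 2 \<Longrightarrow> h' \<le> h - (max h \<epsilon>)\<^sup>2 / (2 * max Q \<epsilon>)"
  shows "fw_steps Q \<epsilon> h' + 1 \<le> fw_steps Q \<epsilon> h"
proof -
  define M where "M = max Q \<epsilon>"
  have M: "0 < M" "Q \<le> M" using assms by (auto simp: M_def)
  have h': "h' \<le> M / 2" using assms M by linarith
  show ?thesis
  proof (cases "h \<le> M / 2")
    case True
    then show ?thesis
      using gap_steps_decrease[OF assms(1) M(1) assms(2), of h] assms(4) h'
      unfolding fw_steps_def Let_def M_def[symmetric] by simp
  next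
    case False
    then show ?thesis
      using gap_steps_mono[OF assms(1) M(1) assms(2) h'] h'
      unfolding fw_steps_def Let_def M_def[symmetric] by simp
  qed
qed


section \<open>HLR\<close>

lemma norm_le_one_if_Delta:
  fixes X :: "'n::finite symmat"
  assumes "X \<in> Delta"
  shows "norm X \<le> 1"
proof -
  have psd: "psd X" and tr: "tr X \<le> 1" using assms by (auto simp: Delta_def)
  have "0 \<le> v \<bullet> mult_vec (tr X *\<^sub>R sym_id - X) v" for v :: "real^'n"
  proof -
    have "psd ((norm v)\<^sup>2 *\<^sub>R sym_id - outer v)"
      unfolding psd_def
    proof
      fix w
      show "0 \<le> w \<bullet> mult_vec ((norm v)\<^sup>2 *\<^sub>R sym_id - outer v) w"
        unfolding power2_norm_eq_inner using Cauchy_Schwarz_ineq[of v w]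
        by (simp add: mult_vec_outer inner_diff_right power2_eq_square inner_commute[of w v])
    qed
    then have "0 \<le> X \<bullet> ((norm v)\<^sup>2 *\<^sub>R sym_id - outer v)" by (rule psd_inner_nonneg[OF psd])
    then show ?thesis
      by (simp add: inner_diff_right inner_sym_id inner_outer power2_norm_eq_inner mult.commute)
  qed
  then have "0 \<le> X \<bullet> (tr X *\<^sub>R sym_id - X)"
    by (intro psd_inner_nonneg[OF psd]) (simp add: psd_def)
  then have "(norm X)\<^sup>2 \<le> (tr X)\<^sup>2"
    unfolding power2_norm_eq_inner by (simp add: inner_diff_right inner_sym_id power2_eq_square)
  moreover have "0 \<le> tr X"
    unfolding inner_sym_id[symmetric] by (intro psd_inner_nonneg[OF psd]) (simp add: psd_def)
  ultimately have "norm X \<le> tr X" by (rule power2_le_imp_le)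
  then show ?thesis using tr by simp
qed

text \<open>The direction of a Frank--Wolfe step: \<open>outer y\<close> minimizes the inner product with \<open>Q\<close> over
  \<^const>\<open>Delta\<close>.\<close>

definition fw_direction :: "'n::finite symmat \<Rightarrow> real \<Rightarrow> real^'n \<Rightarrow> bool"
  where "fw_direction Q \<theta> y \<longleftrightarrow> \<theta> = max (- lambda_min Q) 0 \<and> (if \<theta> > 0 then is_v_min Q y else y = 0)"

lemma fw_direction_props:
  assumes "fw_direction Q \<theta> y"
  shows "norm y \<le> 1" "Q \<bullet> outer y = - \<theta>" "outer y \<in> Delta"
proof -
  show n: "norm y \<le> 1" using assms by (auto simp: fw_direction_def is_v_min_def split: if_splits)
  show "Q \<bullet> outer y = - \<theta>"
  proof (cases "\<theta> > 0")
    case True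
    then have y: "mult_vec Q y = lambda_min Q *\<^sub>R y" "norm y = 1"
      using assms by (auto simp: fw_direction_def is_v_min_def eigenpair_def)
    then have "Q \<bullet> outer y = lambda_min Q" by (simp add: inner_outer norm_eq_1)
    also have "\<dots> = - \<theta>" using assms True by (auto simp: fw_direction_def)
    finally show ?thesis .
  qed (use assms in \<open>auto simp: fw_direction_def\<close>)
  show "outer y \<in> Delta" using n by (simp add: Delta_def psd_outer tr_outer power_le_one)
qed

lemma fw_direction_exists:
  obtains y where "fw_direction Q (max (- lambda_min Q) 0) y"
  using min_eigenpair_exists[of Q] unfolding fw_direction_def by metis

context smooth_convex
begin

text \<open>The infimum suffices as the reference value; that it is attained plays no role.\<close>

definition opt_val :: real
  where "opt_val = Inf (g ` Delta)"

lemma opt_val_le: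
  assumes "X \<in> Delta"
  shows "opt_val \<le> g X"
  unfolding opt_val_def
proof (rule cInf_lower)
  show "bdd_below (g ` Delta)"
    using g_bounded_below norm_le_one_if_Delta by (intro bdd_belowI2[of _ "g 0 - norm (G 0)"]) auto
qed (use assms in auto)

text \<open>The optimality gap is at most the Frank--Wolfe gap.\<close>

lemma fw_gap_bound:
  assumes "X \<in> Delta" "\<theta> = max (- lambda_min (G X)) 0"
  shows "g X - opt_val \<le> G X \<bullet> X + \<theta>"
proof -
  have "g X - (G X \<bullet> X + \<theta>) \<le> opt_val"
    unfolding opt_val_def
  proof (rule cInf_greatest)
    show "g ` Delta \<noteq> {}" using assms by blast
    fix v assume "v \<in> g ` Delta"
    then obtain Z where Z: "Z \<in> Delta" "v = g Z" by blast
    have "- \<theta> \<le> G X \<bullet> Z" using inner_ge_neg_theta assms Z by blast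
    then show "g X - (G X \<bullet> X + \<theta>) \<le> v"
      using convex_below[of X Z] Z by (simp add: inner_diff_right)
  qed
  then show ?thesis by simp
qed

text \<open>The constant \<open>2 * Lg\<close> is \<open>Lg / 2\<close> times the bound \<open>2\<^sup>2\<close> for the squared diameter of
  \<^const>\<open>Delta\<close>.\<close>

lemma fw_step:
  assumes X: "X \<in> Delta" and y: "fw_direction (G X) \<theta> y"
    and \<alpha>: "is_arg_min (\<lambda>\<alpha>. g (\<alpha> *\<^sub>R outer y + (1 - \<alpha>) *\<^sub>R X)) (\<lambda>\<alpha>. \<alpha> \<in> {0..1}) \<alpha>"
    and t: "0 \<le> t" "t \<le> 1"
  shows "g (\<alpha> *\<^sub>R outer y + (1 - \<alpha>) *\<^sub>R X) \<le> g X - t * (G X \<bullet> X + \<theta>) + 2 * Lg * t\<^sup>2"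
proof -
  let ?D = "outer y - X"
  have "norm ?D \<le> norm (outer y) + norm X" by (rule norm_triangle_ineq4)
  also have "\<dots> \<le> 1 + 1"
    using norm_le_one_if_Delta X fw_direction_props(3)[OF y] by (intro add_mono) auto
  finally have "(norm ?D)\<^sup>2 \<le> 2\<^sup>2" by (intro power_mono) auto
  then have "Lg / 2 * t\<^sup>2 * (norm ?D)\<^sup>2 \<le> Lg / 2 * t\<^sup>2 * 4"
    using Lg_nonneg by (intro mult_left_mono) auto
  moreover have "g (\<alpha> *\<^sub>R outer y + (1 - \<alpha>) *\<^sub>R X) \<le> g (t *\<^sub>R outer y + (1 - t) *\<^sub>R X)"
    using \<alpha> t by (simp add: is_arg_min_linorder)
  moreover have "t *\<^sub>R outer y + (1 - t) *\<^sub>R X = X + t *\<^sub>R ?D" by (simp add: algebra_simps)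
  then have "g (t *\<^sub>R outer y + (1 - t) *\<^sub>R X) = g (X + t *\<^sub>R ?D)" by simp
  moreover have "g (X + t *\<^sub>R ?D) \<le> g X + t * (G X \<bullet> ?D) + Lg / 2 * t\<^sup>2 * (norm ?D)\<^sup>2"
    using smooth_above[of "X + t *\<^sub>R ?D" X] by (simp add: power_mult_distrib)
  moreover have "G X \<bullet> ?D = - (G X \<bullet> X + \<theta>)"
    using fw_direction_props(2)[OF y] by (simp add: inner_diff_right)
  then have "t * (G X \<bullet> ?D) = - (t * (G X \<bullet> X + \<theta>))" by (simp only: mult_minus_right)
  ultimately show ?thesis by linarith
qed

lemma line_search_exists:
  "\<exists>\<alpha>. is_arg_min (\<lambda>\<alpha>. g (\<alpha> *\<^sub>R Z + (1 - \<alpha>) *\<^sub>R X)) (\<lambda>\<alpha>. \<alpha> \<in> {0..1}) \<alpha>"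
proof -
  have "continuous_on {0..1 :: real} (\<lambda>\<alpha>. g (\<alpha> *\<^sub>R Z + (1 - \<alpha>) *\<^sub>R X))"
    by (intro continuous_on_compose2[OF g_continuous[of UNIV]] continuous_intros) auto
  then show ?thesis
    using continuous_attains_inf[of "{0..1 :: real}"] by (fastforce simp: is_arg_min_linorder)
qed

text \<open>A bound for the number of Frank--Wolfe steps that HLR still takes from \<open>X\<close>.\<close>

definition hlr_steps :: "real \<Rightarrow> 'n symmat \<Rightarrow> real"
  where "hlr_steps \<epsilon> X = fw_steps (4 * Lg) \<epsilon> (g X - opt_val)"

lemma fw_progress:
  assumes X: "X \<in> Delta" and y: "fw_direction (G X) \<theta> y"
    and \<alpha>: "is_arg_min (\<lambda>\<alpha>. g (\<alpha> *\<^sub>R outer y + (1 - \<alpha>) *\<^sub>R X)) (\<lambda>\<alpha>. \<alpha> \<in> {0..1}) \<alpha>"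
    and \<epsilon>: "0 < \<epsilon>" "\<epsilon> < G X \<bullet> X + \<theta>"
  defines "X' \<equiv> \<alpha> *\<^sub>R outer y + (1 - \<alpha>) *\<^sub>R X"
  shows "X' \<in> Delta" "g X' \<le> g X" "hlr_steps \<epsilon> X' + 1 \<le> hlr_steps \<epsilon> X"
proof -
  have "0 \<le> \<alpha>" "\<alpha> \<le> 1" using \<alpha> by (auto simp: is_arg_min_linorder)
  then show X': "X' \<in> Delta"
    unfolding X'_def by (intro Delta_convex fw_direction_props(3)[OF y] X)
  note step = fw_step[OF X y \<alpha>, folded X'_def]
  show "g X' \<le> g X" using step[of 0] by simp
  define e where "e = G X \<bullet> X + \<theta>"
  have gap: "g X - opt_val \<le> e"
    unfolding e_def using fw_gap_bound[OF X] y by (simp add: fw_direction_def)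
  define M where "M = max (4 * Lg) \<epsilon>"
  have M: "0 < M" using \<epsilon> by (simp add: M_def)
  show "hlr_steps \<epsilon> X' + 1 \<le> hlr_steps \<epsilon> X"
    unfolding hlr_steps_def
  proof (rule fw_steps_decrease)
    show "0 < \<epsilon>" by fact
    show "0 \<le> g X' - opt_val" using opt_val_le[OF X'] by simp
    show "g X' - opt_val \<le> 4 * Lg / 2" using step[of 1] gap by (simp add: e_def)
    assume small: "g X - opt_val \<le> max (4 * Lg) \<epsilon> / 2"
    define m where "m = max (g X - opt_val) \<epsilon>"
    have m: "0 < m" "m \<le> M" "m \<le> e"
      using small \<epsilon> gap M by (auto simp: m_def M_def e_def)
    \<comment> \<open>With \<open>m\<close> in place of the Frank--Wolfe gap, which may exceed \<open>M\<close>, the stepsize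
      \<open>m / M\<close> is admissible.\<close>
    have t: "0 \<le> m / M" "m / M \<le> 1" using m M by auto
    have "2 * Lg * (m / M)\<^sup>2 \<le> M / 2 * (m / M)\<^sup>2"
      by (intro mult_right_mono) (auto simp: M_def)
    moreover have "m / M * m \<le> m / M * e" using m t by (intro mult_left_mono) auto
    moreover have "- (m / M * m) + M / 2 * (m / M)\<^sup>2 = - (m\<^sup>2 / (2 * M))"
      using M by (simp add: power2_eq_square field_simps)
    ultimately have "g X' \<le> g X - m\<^sup>2 / (2 * M)"
      using step[OF t] unfolding e_def[symmetric] by linarith
    then show "g X' - opt_val \<le> g X - opt_val
        - (max (g X - opt_val) \<epsilon>)\<^sup>2 / (2 * max (4 * Lg) \<epsilon>)"
      by (simp add: m_def M_def)
  qed
qed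

lemma hlr_steps_mono:
  assumes "0 < \<epsilon>" "X \<in> Delta" "g X \<le> g Z"
  shows "hlr_steps \<epsilon> X \<le> hlr_steps \<epsilon> Z"
  unfolding hlr_steps_def using assms opt_val_le by (intro fw_steps_mono) auto

lemma hlr_steps_nonneg:
  assumes "0 < \<epsilon>" "X \<in> Delta"
  shows "0 \<le> hlr_steps \<epsilon> X"
  unfolding hlr_steps_def using assms opt_val_le by (intro fw_steps_nonneg) auto

lemma hlr_steps_le:
  assumes "0 < \<epsilon>" "X \<in> Delta"
  shows "hlr_steps \<epsilon> X \<le> max 12 (16 * Lg / \<epsilon>)"
  using fw_steps_le[of \<epsilon> "g X - opt_val" "4 * Lg"] assms opt_val_le[of X]
  by (simp add: hlr_steps_def)

end

lemma gram_unit_ball_Delta: "U \<in> unit_ball s \<Longrightarrow> gram U \<in> Delta"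
  by (simp add: unit_ball_def gram_in_Delta)

text \<open>The factor of the next iterate represents the Frank--Wolfe step.\<close>

lemma fw_factor:
  assumes "Y \<in> unit_ball s" "gram Y \<in> Delta" "0 \<le> \<alpha>" "\<alpha> \<le> 1" "norm y \<le> 1"
    and "(Z, s') = (if \<alpha> = 1 then (hcat 0 0 y, 1)
      else (hcat s (sqrt (1 - \<alpha>) *\<^sub>R Y) (sqrt \<alpha> *\<^sub>R y), s + 1))"
  shows "gram Z = \<alpha> *\<^sub>R outer y + (1 - \<alpha>) *\<^sub>R gram Y" "Z \<in> unit_ball s'"
proof -
  have Y: "Y \<in> cols s" "sqrt (1 - \<alpha>) *\<^sub>R Y \<in> cols s"
    using assms(1) subspace_cols subspace_scale by (auto simp: unit_ball_def)
  have 0: "(0 :: 'a colmat) \<in> cols 0" using subspace_cols subspace_0 by blast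
  show gram: "gram Z = \<alpha> *\<^sub>R outer y + (1 - \<alpha>) *\<^sub>R gram Y"
    using assms(3,4,6) 0 Y
    by (auto simp: gram_hcat gram_scaleR outer_scaleR add.commute split: if_splits)
  have "Z \<in> cols s'" using assms(6) hcat_in_cols by (auto split: if_splits)
  moreover have "\<alpha> *\<^sub>R outer y + (1 - \<alpha>) *\<^sub>R gram Y \<in> Delta"
    using assms(5) by (intro Delta_convex assms(2-4)) (simp add: Delta_def psd_outer tr_outer power_le_one)
  ultimately show "Z \<in> unit_ball s'"
    unfolding in_unit_ball_iff gram by (simp add: Delta_def)
qed

text \<open>One call of HLR with the tolerance \<open>\<epsilon>\<close> and the initial prox stepsize \<open>lam0\<close>.\<close>

locale hlr_call = low_rank_method g G Lg Gb \<sigma> chi \<rho> K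
  for g :: "'n::finite symmat \<Rightarrow> real" and G Lg Gb \<sigma> chi \<rho> K +
  fixes lam0 \<epsilon> :: real
  assumes lam0: "0 < lam0" "1 \<le> lam0 * K" and \<epsilon>: "0 < \<epsilon>"
begin

abbreviation hlr
  where "hlr \<equiv> hlr_pass \<sigma> chi g \<epsilon> \<rho> lam0"

lemma hlr_pass_cases:
  assumes Y0: "Y0 \<in> unit_ball s" and pass: "hlr (Y0, s, c) out"
  obtains (stop) Y N \<theta> where
      "out = Stop (Y, s, \<theta>, add_effort c \<lparr>hlr_iterations = 1, min_eigenvectors = 1, fista_calls = N\<rparr>)"
      "Y \<in> unit_ball s" "g (gram Y) \<le> g (gram Y0)" "\<theta> = max (- lambda_min (G (gram Y))) 0"
      "G (gram Y) \<bullet> gram Y + \<theta> \<le> \<epsilon>"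
      "real N \<le> 1 + log 2 (lam0 * K) + descent_rate * (g (gram Y0) - g (gram Y))"
  | (continue) Z s' N where
      "out = Continue (Z, s', add_effort c \<lparr>hlr_iterations = 1, min_eigenvectors = 1, fista_calls = N\<rparr>)"
      "Z \<in> unit_ball s'" "g (gram Z) \<le> g (gram Y0)"
      "hlr_steps \<epsilon> (gram Z) + 1 \<le> hlr_steps \<epsilon> (gram Y0)"
      "real N \<le> 1 + log 2 (lam0 * K) + descent_rate * (g (gram Y0) - g (gram Z))"
proof -
  have K: "0 < K" using K_pos lam0 by blast
  have rate: "0 \<le> descent_rate" using C_sigma_pos K by (simp add: descent_rate_def)
  let ?aipp = "adap_aipp_pass \<sigma> chi s g \<rho>"
  have "halts ?aipp (adap_aipp_init Y0 lam0)" by (rule aipp_halts[OF Y0 lam0])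
  then obtain Y R N y \<theta> where
      ret: "returns ?aipp (adap_aipp_init Y0 lam0) (Y, R, N)"
    and \<theta>: "\<theta> = max (- lambda_min (G (gram Y))) 0"
    and y: "if \<theta> > 0 then is_v_min (G (gram Y)) y else y = 0"
    and out: "if G (gram Y) \<bullet> gram Y + \<theta> \<le> \<epsilon>
        then out = Stop (Y, s, \<theta>, add_effort c \<lparr>hlr_iterations = 1, min_eigenvectors = 1, fista_calls = N\<rparr>)
        else \<exists>\<alpha>. is_arg_min (\<lambda>\<alpha>. g (\<alpha> *\<^sub>R outer y + (1 - \<alpha>) *\<^sub>R gram Y)) (\<lambda>\<alpha>. \<alpha> \<in> {0..1}) \<alpha> \<and>
          out = Continue (let c' = add_effort c \<lparr>hlr_iterations = 1, min_eigenvectors = 1, fista_calls = N\<rparr>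
            in (if \<alpha> = 1 then (hcat 0 0 y, 1, c')
                 else (hcat s (sqrt (1 - \<alpha>) *\<^sub>R Y) (sqrt \<alpha> *\<^sub>R y), s + 1, c')))"
    using pass unfolding hlr_pass_def prod.case Let_def g_gradient inner_gram[symmetric] by blast
  note Y = aipp_returns[OF Y0 lam0 ret]
  have D: "gram Y \<in> Delta" by (rule gram_unit_ball_Delta[OF Y(1)])
  have dir: "fw_direction (G (gram Y)) \<theta> y" using \<theta> y by (simp add: fw_direction_def)
  show thesis
  proof (cases "G (gram Y) \<bullet> gram Y + \<theta> \<le> \<epsilon>")
    case True
    then show thesis using stop Y \<theta> out by auto
  next
    case False
    then obtain \<alpha> where \<alpha>: "is_arg_min (\<lambda>\<alpha>. g (\<alpha> *\<^sub>R outer y + (1 - \<alpha>) *\<^sub>R gram Y)) (\<lambda>\<alpha>. \<alpha> \<in> {0..1}) \<alpha>"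
      and out': "out = Continue (let c' = add_effort c \<lparr>hlr_iterations = 1, min_eigenvectors = 1, fista_calls = N\<rparr>
            in (if \<alpha> = 1 then (hcat 0 0 y, 1, c')
                 else (hcat s (sqrt (1 - \<alpha>) *\<^sub>R Y) (sqrt \<alpha> *\<^sub>R y), s + 1, c')))"
      using out by auto
    obtain Z s' where Z: "(Z, s') = (if \<alpha> = 1 then (hcat 0 0 y, 1)
      else (hcat s (sqrt (1 - \<alpha>) *\<^sub>R Y) (sqrt \<alpha> *\<^sub>R y), s + 1))" by (metis surj_pair)
    have \<alpha>01: "0 \<le> \<alpha>" "\<alpha> \<le> 1" using \<alpha> by (auto simp: is_arg_min_linorder)
    note factor = fw_factor[OF Y(1) D \<alpha>01 fw_direction_props(1)[OF dir] Z]
    note progress = fw_progress[OF D dir \<alpha> \<epsilon>, folded factor(1)]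
    have gap: "\<epsilon> < G (gram Y) \<bullet> gram Y + \<theta>" using False by simp
    have le: "g (gram Z) \<le> g (gram Y)" by (rule progress(2)[OF gap])
    then have "descent_rate * (g (gram Y0) - g (gram Y)) \<le> descent_rate * (g (gram Y0) - g (gram Z))"
      using rate by (intro mult_left_mono) auto
    moreover have "hlr_steps \<epsilon> (gram Y) \<le> hlr_steps \<epsilon> (gram Y0)"
      by (rule hlr_steps_mono[OF \<epsilon> D Y(2)])
    moreover have "out = Continue (Z, s', add_effort c \<lparr>hlr_iterations = 1, min_eigenvectors = 1, fista_calls = N\<rparr>)"
      using out' Z by (auto simp: Let_def split: if_splits)
    ultimately show thesis
      using continue[of Z s' N] factor(2) le Y(2,3) progress(3)[OF gap] by linarith
  qed
qed

lemma hlr_halts: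
  assumes "Y0 \<in> unit_ball s"
  shows "halts hlr (Y0, s, c)"
proof (rule halts_by_measure[where I = "\<lambda>(Y0, s, c). Y0 \<in> unit_ball s"
      and V = "\<lambda>(Y0, s, c). hlr_steps \<epsilon> (gram Y0)"])
  show "case (Y0, s, c) of (Y0, s, c) \<Rightarrow> Y0 \<in> unit_ball s" using assms by simp
  fix st :: "'n colmat \<times> nat \<times> effort"
  assume inv: "case st of (Y0, s, c) \<Rightarrow> Y0 \<in> unit_ball s"
  obtain Y0 s c where st: "st = (Y0, s, c)" by (cases st)
  have Y0: "Y0 \<in> unit_ball s" using inv by (simp add: st)
  let ?aipp = "adap_aipp_pass \<sigma> chi s g \<rho>"
  let ?c' = "\<lambda>N. add_effort c \<lparr>hlr_iterations = 1, min_eigenvectors = 1, fista_calls = N\<rparr>"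
  obtain Y R N where ret: "returns ?aipp (adap_aipp_init Y0 lam0) (Y, R, N)"
    using halts_imp_returns[OF aipp_halts[OF Y0 lam0]] by auto
  obtain y where y: "fw_direction (G (gram Y)) (max (- lambda_min (G (gram Y))) 0) y"
    by (rule fw_direction_exists)
  obtain \<alpha> where "is_arg_min (\<lambda>\<alpha>. g (\<alpha> *\<^sub>R outer y + (1 - \<alpha>) *\<^sub>R gram Y)) (\<lambda>\<alpha>. \<alpha> \<in> {0..1}) \<alpha>"
    using line_search_exists[of "outer y" "gram Y"] by blast
  then obtain out where out: "if G (gram Y) \<bullet> gram Y + max (- lambda_min (G (gram Y))) 0 \<le> \<epsilon>
      then out = Stop (Y, s, max (- lambda_min (G (gram Y))) 0, ?c' N)
      else \<exists>\<alpha>. is_arg_min (\<lambda>\<alpha>. g (\<alpha> *\<^sub>R outer y + (1 - \<alpha>) *\<^sub>R gram Y)) (\<lambda>\<alpha>. \<alpha> \<in> {0..1}) \<alpha> \<and>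
        out = Continue (if \<alpha> = 1 then (hcat 0 0 y, 1, ?c' N)
          else (hcat s (sqrt (1 - \<alpha>) *\<^sub>R Y) (sqrt \<alpha> *\<^sub>R y), s + 1, ?c' N))"
    by (cases "G (gram Y) \<bullet> gram Y + max (- lambda_min (G (gram Y))) 0 \<le> \<epsilon>")
      (simp_all only: if_True if_False, blast+)
  show "\<exists>out. hlr st out"
    unfolding st hlr_pass_def prod.case Let_def g_gradient inner_gram[symmetric]
    by (intro exI[of _ out] disjI2 exI conjI, rule ret,
      rule y[unfolded fw_direction_def, THEN conjunct2], rule out)
  show "\<not> hlr st Hang"
  proof
    assume "hlr st Hang"
    from Y0 this[unfolded st] show False by (cases rule: hlr_pass_cases) auto
  qed
  show "0 \<le> (case st of (Y0, s, c) \<Rightarrow> hlr_steps \<epsilon> (gram Y0))"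
    using hlr_steps_nonneg[OF \<epsilon> gram_unit_ball_Delta[OF Y0]] by (simp add: st)
  fix st' assume "hlr st (Continue st')"
  from Y0 this[unfolded st] show "(case st' of (Y0, s, c) \<Rightarrow> Y0 \<in> unit_ball s) \<and>
      (case st' of (Y0, s, c) \<Rightarrow> hlr_steps \<epsilon> (gram Y0)) + 1
        \<le> (case st of (Y0, s, c) \<Rightarrow> hlr_steps \<epsilon> (gram Y0))"
    by (cases rule: hlr_pass_cases) (auto simp: st)
qed

lemma hlr_returns:
  assumes "Y0 \<in> unit_ball s" "returns hlr (Y0, s, c) (Y, s', \<theta>, c')"
  shows "Y \<in> unit_ball s' \<and> \<theta> = max (- lambda_min (G (gram Y))) 0 \<and>
    G (gram Y) \<bullet> gram Y + \<theta> \<le> \<epsilon> \<and>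
    real (hlr_iterations c') \<le> real (hlr_iterations c) + 1 + hlr_steps \<epsilon> (gram Y0) \<and>
    min_eigenvectors c' + hlr_iterations c = min_eigenvectors c + hlr_iterations c' \<and>
    real (fista_calls c') \<le> real (fista_calls c)
      + (1 + log 2 (lam0 * K)) * (real (hlr_iterations c') - real (hlr_iterations c))
      + descent_rate * (g (gram Y0) - g (gram Y))"
  using assms(2,1)
proof (induction "(Y0, s, c)" "(Y, s', \<theta>, c')" arbitrary: Y0 s c)
  case (stop Y0 s c)
  have nonneg: "0 \<le> hlr_steps \<epsilon> (gram Y0)"
    by (rule hlr_steps_nonneg[OF \<epsilon> gram_unit_ball_Delta[OF stop(2)]])
  from stop(2,1) show ?case
    by (cases rule: hlr_pass_cases) (use nonneg in \<open>auto simp: add_effort_def\<close>)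
next
  case (continue st' Y0 s c)
  from continue(4,1) show ?case
  proof (cases rule: hlr_pass_cases)
    case (continue Z s1 N)
    note IH = \<open>\<And>Y0 s c. st' = (Y0, s, c) \<Longrightarrow> _ \<Longrightarrow> _\<close>
    show ?thesis
      using IH[of Z s1] continue by (auto simp: add_effort_def algebra_simps)
  qed auto
qed

end


section \<open>The augmented Lagrangian\<close>

lemma norm_linear_le:
  fixes \<A> :: "'a::euclidean_space \<Rightarrow> 'b::real_normed_vector"
  assumes "linear \<A>"
  shows "norm (\<A> x) \<le> onorm \<A> * norm x"
  using assms by (intro onorm) (simp add: linear_conv_bounded_linear)

lemma norm_adjoint_le:
  fixes \<A> :: "'a::euclidean_space \<Rightarrow> 'b::euclidean_space"
  assumes "linear \<A>"
  shows "norm (adjoint \<A> q) \<le> onorm \<A> * norm q"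
proof (cases "adjoint \<A> q = 0")
  case True
  then show ?thesis
    using assms by (simp add: onorm_pos_le linear_conv_bounded_linear)
next
  case False
  let ?x = "adjoint \<A> q"
  have "norm ?x * norm ?x = ?x \<bullet> ?x" by (simp add: power2_norm_eq_inner[symmetric] power2_eq_square)
  also have "\<dots> = \<A> ?x \<bullet> q" by (rule adjoint_works[OF assms])
  also have "\<dots> \<le> norm (\<A> ?x) * norm q" by (rule norm_cauchy_schwarz)
  also have "\<dots> \<le> (onorm \<A> * norm ?x) * norm q" by (intro mult_right_mono norm_linear_le assms) simp
  finally have "norm ?x * norm ?x \<le> norm ?x * (onorm \<A> * norm q)" by (simp add: mult_ac)
  then show ?thesis using False by simp
qed

lemma adjoint_diff:
  fixes \<A> :: "'a::euclidean_space \<Rightarrow> 'b::euclidean_space"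
  assumes "linear \<A>"
  shows "adjoint \<A> (p - q) = adjoint \<A> p - adjoint \<A> q"
  using adjoint_linear[OF assms] by (rule linear_diff)

lemma inner_adjoint_left:
  fixes \<A> :: "'a::euclidean_space \<Rightarrow> 'b::euclidean_space"
  assumes "linear \<A>"
  shows "adjoint \<A> q \<bullet> x = q \<bullet> \<A> x"
  using adjoint_works[OF assms, of x q] by (simp add: inner_commute)

text \<open>The gradient of the augmented Lagrangian at \<open>X\<close> involves \<open>p\<close> and \<open>X\<close> only through the
  updated multiplier.\<close>

definition aug_lagrangian_grad ::
  "'n::finite symmat \<Rightarrow> ('n symmat \<Rightarrow> real^'m) \<Rightarrow> real^'m \<Rightarrow> real \<Rightarrow> real^'m \<Rightarrow> 'n symmat \<Rightarrow> 'n symmat"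
  where "aug_lagrangian_grad C \<A> b \<beta> p X = C + adjoint \<A> (p + \<beta> *\<^sub>R (\<A> X - b))"

lemma aug_lagrangian_expand:
  assumes "linear \<A>"
  shows "aug_lagrangian C \<A> b \<beta> p Y = aug_lagrangian C \<A> b \<beta> p X
    + aug_lagrangian_grad C \<A> b \<beta> p X \<bullet> (Y - X) + \<beta> / 2 * (norm (\<A> (Y - X)))\<^sup>2"
proof -
  define r where "r = \<A> X - b"
  define d where "d = \<A> (Y - X)"
  have "\<A> Y - b = r + d" using assms by (simp add: r_def d_def linear_diff)
  then have "aug_lagrangian C \<A> b \<beta> p Y = C \<bullet> Y + p \<bullet> (r + d) + \<beta> / 2 * (norm (r + d))\<^sup>2"
    by (simp add: aug_lagrangian_def)
  also have "(norm (r + d))\<^sup>2 = (norm r)\<^sup>2 + 2 * (r \<bullet> d) + (norm d)\<^sup>2"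
    unfolding power2_norm_eq_inner by (simp add: inner_add_left inner_add_right inner_commute[of d r])
  finally have 1: "aug_lagrangian C \<A> b \<beta> p Y = C \<bullet> Y + p \<bullet> (r + d)
      + \<beta> / 2 * ((norm r)\<^sup>2 + 2 * (r \<bullet> d) + (norm d)\<^sup>2)" .
  have 2: "aug_lagrangian_grad C \<A> b \<beta> p X \<bullet> (Y - X) = C \<bullet> (Y - X) + (p + \<beta> *\<^sub>R r) \<bullet> d"
    by (simp add: aug_lagrangian_grad_def inner_add_left[of C] inner_adjoint_left[OF assms] r_def d_def)
  have 3: "aug_lagrangian C \<A> b \<beta> p X = C \<bullet> X + p \<bullet> r + \<beta> / 2 * (norm r)\<^sup>2"
    by (simp add: aug_lagrangian_def r_def)
  show ?thesis
    unfolding 1 2 3 d_def[symmetric]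
    by (simp add: inner_add_left inner_add_right inner_diff_right algebra_simps)
qed

lemma smooth_convex_aug_lagrangian:
  fixes C :: "'n::finite symmat" and \<A> :: "'n symmat \<Rightarrow> real^'m"
  assumes "linear \<A>" "0 < \<beta>"
  shows "smooth_convex (aug_lagrangian C \<A> b \<beta> p) (aug_lagrangian_grad C \<A> b \<beta> p) (\<beta> * (onorm \<A>)\<^sup>2)"
proof
  have on: "0 \<le> onorm \<A>" using assms by (simp add: onorm_pos_le linear_conv_bounded_linear)
  show "0 \<le> \<beta> * (onorm \<A>)\<^sup>2" using assms by simp
  fix X Y :: "'n symmat"
  show "aug_lagrangian C \<A> b \<beta> p X + aug_lagrangian_grad C \<A> b \<beta> p X \<bullet> (Y - X) \<le> aug_lagrangian C \<A> b \<beta> p Y"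
    using aug_lagrangian_expand[OF assms(1), of C b \<beta> p Y X] assms(2) by simp
  have "(norm (\<A> (Y - X)))\<^sup>2 \<le> (onorm \<A> * norm (Y - X))\<^sup>2"
    by (intro power_mono norm_linear_le assms) simp
  then have "\<beta> / 2 * (norm (\<A> (Y - X)))\<^sup>2 \<le> \<beta> / 2 * (onorm \<A> * norm (Y - X))\<^sup>2"
    using assms by (intro mult_left_mono) auto
  then show "aug_lagrangian C \<A> b \<beta> p Y \<le> aug_lagrangian C \<A> b \<beta> p X
      + aug_lagrangian_grad C \<A> b \<beta> p X \<bullet> (Y - X) + \<beta> * (onorm \<A>)\<^sup>2 / 2 * (norm (Y - X))\<^sup>2"
    using aug_lagrangian_expand[OF assms(1), of C b \<beta> p Y X] by (simp add: power_mult_distrib mult_ac)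
  have "aug_lagrangian_grad C \<A> b \<beta> p Y - aug_lagrangian_grad C \<A> b \<beta> p X = adjoint \<A> (\<beta> *\<^sub>R \<A> (Y - X))"
    using assms(1) by (simp add: aug_lagrangian_grad_def adjoint_diff[symmetric] linear_diff algebra_simps)
  then have "norm (aug_lagrangian_grad C \<A> b \<beta> p Y - aug_lagrangian_grad C \<A> b \<beta> p X)
      \<le> onorm \<A> * norm (\<beta> *\<^sub>R \<A> (Y - X))" 
    using norm_adjoint_le[OF assms(1), of "\<beta> *\<^sub>R \<A> (Y - X)"] by (simp only:)
  also have "\<dots> = onorm \<A> * \<beta> * norm (\<A> (Y - X))" using assms(2) by simp
  also have "\<dots> \<le> onorm \<A> * \<beta> * (onorm \<A> * norm (Y - X))"
    using on assms(2) by (intro mult_left_mono norm_linear_le assms(1)) auto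
  finally show "norm (aug_lagrangian_grad C \<A> b \<beta> p Y - aug_lagrangian_grad C \<A> b \<beta> p X)
      \<le> \<beta> * (onorm \<A>)\<^sup>2 * norm (Y - X)"
    by (simp add: power2_eq_square mult_ac)
qed

lemma aug_lagrangian_grad_bound:
  fixes C :: "'n::finite symmat" and \<A> :: "'n symmat \<Rightarrow> real^'m"
  assumes "linear \<A>" "0 < \<beta>" "norm X \<le> 9" "norm p \<le> q"
  shows "norm (aug_lagrangian_grad C \<A> b \<beta> p X)
    \<le> norm C + onorm \<A> * (9 * \<beta> * onorm \<A> + q + \<beta> * norm b)"
proof -
  have on: "0 \<le> onorm \<A>" using assms by (simp add: onorm_pos_le linear_conv_bounded_linear)
  have "norm (\<A> X - b) \<le> norm (\<A> X) + norm b" by (rule norm_triangle_ineq4)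
  also have "norm (\<A> X) \<le> onorm \<A> * norm X" by (rule norm_linear_le[OF assms(1)])
  also have "\<dots> \<le> onorm \<A> * 9" using on assms by (intro mult_left_mono) auto
  finally have "\<beta> * norm (\<A> X - b) \<le> \<beta> * (onorm \<A> * 9 + norm b)"
    using assms by (intro mult_left_mono) auto
  moreover have "norm (\<beta> *\<^sub>R (\<A> X - b)) = \<beta> * norm (\<A> X - b)" using assms by simp
  ultimately have "norm (p + \<beta> *\<^sub>R (\<A> X - b)) \<le> q + \<beta> * (onorm \<A> * 9 + norm b)"
    using norm_triangle_ineq[of p "\<beta> *\<^sub>R (\<A> X - b)"] assms(4) by linarith
  then have "onorm \<A> * norm (p + \<beta> *\<^sub>R (\<A> X - b)) \<le> onorm \<A> * (q + \<beta> * (onorm \<A> * 9 + norm b))"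
    using on by (intro mult_left_mono) auto
  moreover have "norm (aug_lagrangian_grad C \<A> b \<beta> p X)
      \<le> norm C + onorm \<A> * norm (p + \<beta> *\<^sub>R (\<A> X - b))"
    unfolding aug_lagrangian_grad_def
    using norm_triangle_ineq[of C] norm_adjoint_le[OF assms(1)] by (meson add_left_mono order_trans)
  ultimately show ?thesis by (simp add: algebra_simps)
qed


section \<open>HALLaR\<close>

text \<open>A primal-dual pair of semidefinite programs with optimal solutions of the same value.\<close>

locale sdp_pair =
  fixes C :: "'n::finite symmat" and \<A> :: "'n symmat \<Rightarrow> real^'m" and b :: "real^'m"
    and X_star :: "'n symmat" and p_star :: "real^'m" and \<theta>_star :: real
  assumes linear: "linear \<A>"
    and primal: "primal_optimal C \<A> b X_star"
    and dual: "dual_optimal C \<A> b (p_star, \<theta>_star)"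
    and no_gap: "C \<bullet> X_star = dual_value b (p_star, \<theta>_star)"
begin

lemma X_star: "X_star \<in> Delta" "\<A> X_star = b"
  using primal by (auto simp: primal_optimal_def is_arg_min_def primal_feasible_def)

text \<open>Strong duality: \<open>X_star\<close> minimizes the Lagrangian with multiplier \<open>p_star\<close> over
  \<^const>\<open>Delta\<close>.\<close>

lemma lagrangian_minimal:
  assumes "X \<in> Delta"
  shows "C \<bullet> X_star \<le> C \<bullet> X + p_star \<bullet> (\<A> X - b)"
proof -
  have feas: "psd (C + adjoint \<A> p_star + \<theta>_star *\<^sub>R sym_id)" "0 \<le> \<theta>_star"
    using dual by (auto simp: dual_optimal_def is_arg_max_def dual_feasible_def)
  have "0 \<le> X \<bullet> (C + adjoint \<A> p_star + \<theta>_star *\<^sub>R sym_id)"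
    using assms feas by (intro psd_inner_nonneg) (auto simp: Delta_def)
  also have "\<dots> = C \<bullet> X + p_star \<bullet> \<A> X + \<theta>_star * tr X"
    by (simp add: inner_add_right inner_sym_id inner_commute[of X] inner_adjoint_left[OF linear])
  also have "\<theta>_star * tr X \<le> \<theta>_star * 1"
    using feas assms by (intro mult_left_mono) (auto simp: Delta_def)
  finally show ?thesis
    using no_gap by (simp add: dual_value_def inner_diff_right inner_commute)
qed

lemma aug_lagrangian_lower:
  assumes "X \<in> Delta" "0 < \<beta>"
  shows "C \<bullet> X_star - (norm (p - p_star))\<^sup>2 / (2 * \<beta>) \<le> aug_lagrangian C \<A> b \<beta> p X"
proof -
  define r where "r = \<A> X - b"
  define q where "q = p - p_star"
  have "0 \<le> (norm (q + \<beta> *\<^sub>R r))\<^sup>2 / (2 * \<beta>)" using assms by simp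
  also have "\<dots> = (norm q)\<^sup>2 / (2 * \<beta>) + q \<bullet> r + \<beta> / 2 * (norm r)\<^sup>2"
    unfolding power2_norm_eq_inner using assms(2)
    by (simp add: inner_add_left inner_add_right inner_commute[of r q] field_simps)
  finally have "0 \<le> (norm q)\<^sup>2 / (2 * \<beta>) + q \<bullet> r + \<beta> / 2 * (norm r)\<^sup>2" .
  moreover have "q \<bullet> r = p \<bullet> r - p_star \<bullet> r" by (simp add: q_def inner_diff_left)
  ultimately show ?thesis
    using lagrangian_minimal[OF assms(1)]
    unfolding aug_lagrangian_def r_def[symmetric] q_def[symmetric] by linarith
qed

text \<open>The multiplier update is an approximate proximal point step for the dual problem.\<close>

lemma multiplier_step:
  assumes X: "X \<in> Delta" and \<beta>: "0 < \<beta>"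
    and G: "G = C + adjoint \<A> p'" and p': "p' = p + \<beta> *\<^sub>R (\<A> X - b)"
    and \<theta>: "\<theta> = max (- lambda_min G) 0" and gap: "G \<bullet> X + \<theta> \<le> \<epsilon>"
  shows "(norm (p' - p_star))\<^sup>2 + (norm (p' - p))\<^sup>2 \<le> (norm (p - p_star))\<^sup>2 + 2 * \<beta> * \<epsilon>"
proof -
  have "- \<theta> \<le> G \<bullet> X_star" by (rule inner_ge_neg_theta[OF \<theta> X_star(1)])
  then have "G \<bullet> X - G \<bullet> X_star \<le> \<epsilon>" using gap by linarith
  then have "C \<bullet> X - C \<bullet> X_star + p' \<bullet> (\<A> X - b) \<le> \<epsilon>"
    by (simp add: G inner_add_left inner_adjoint_left[OF linear] X_star inner_diff_right)
  then have "(p' - p_star) \<bullet> (\<A> X - b) \<le> \<epsilon>"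
    using lagrangian_minimal[OF X] by (simp add: inner_diff_left)
  then have "\<beta> * ((p' - p_star) \<bullet> (\<A> X - b)) \<le> \<beta> * \<epsilon>" using \<beta> by simp
  then have "(p' - p_star) \<bullet> (p' - p) \<le> \<beta> * \<epsilon>" by (simp add: p')
  moreover have "(norm (p - p_star))\<^sup>2
      = (norm (p' - p_star))\<^sup>2 - 2 * ((p' - p_star) \<bullet> (p' - p)) + (norm (p' - p))\<^sup>2"
  proof -
    have "p - p_star = (p' - p_star) - (p' - p)" by simp
    then have "(norm (p - p_star))\<^sup>2 = (norm ((p' - p_star) - (p' - p)))\<^sup>2" by simp
    then show ?thesis
      unfolding power2_norm_eq_inner
      by (simp only: inner_diff_left[of "p' - p_star" "p' - p"] inner_diff_right[of _ "p' - p_star" "p' - p"]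
        inner_commute[of "p' - p" "p' - p_star"])
  qed
  ultimately show ?thesis by linarith
qed

end

text \<open>A run of HALLaR on such a pair. The names \<open>tol\<close>, \<open>K\<close> and \<open>\<kappa>\<close> stand for the
  tolerance of HLR, the curvature bound and the bound for the number of halvings.\<close>

locale hallar = sdp_pair C \<A> b X_star p_star \<theta>_star
  for C :: "'n::finite symmat" and \<A> :: "'n symmat \<Rightarrow> real^'m" and b X_star p_star \<theta>_star +
  fixes \<sigma> chi \<epsilon>c \<epsilon>p \<beta> \<rho> lam0 :: real
  assumes params: "0 < \<sigma>" "\<sigma> < 1 / 2" "0 < chi" "chi < 1"
    "0 < \<epsilon>c" "0 < \<epsilon>p" "0 < \<beta>" "0 < \<rho>" "0 < lam0"
begin

abbreviation tol where "tol \<equiv> eps_bar \<epsilon>p \<epsilon>c \<beta>"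
abbreviation K where "K \<equiv> curvature_bar C \<A> b \<beta> tol lam0 p_star"
abbreviation \<kappa> where "\<kappa> \<equiv> kappa_bar C \<A> b \<beta> tol lam0 p_star"
abbreviation AL where "AL \<equiv> aug_lagrangian C \<A> b \<beta>"

text \<open>The number of calls of ADAP-FISTA charged to a unit decrease of an augmented Lagrangian.\<close>

definition rate where "rate = C_sigma \<sigma> * K / \<rho>\<^sup>2"

lemma tol_props: "0 < tol" "tol \<le> \<epsilon>c" "6 * tol \<le> \<epsilon>p\<^sup>2 * \<beta>"
  using params by (auto simp: eps_bar_def)

lemma K: "1 \<le> lam0 * K" "0 < K"
proof -
  have "1 / lam0 \<le> K" by (simp add: curvature_bar_def)
  then show "1 \<le> lam0 * K" using params by (simp add: field_simps)
  have "0 < 1 / lam0" using params by simp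
  then show "0 < K" using \<open>1 / lam0 \<le> K\<close> by linarith
qed

lemma rate_nonneg: "0 \<le> rate"
  using params K by (simp add: rate_def C_sigma_def)

lemma \<kappa>: "log 2 (lam0 * K) \<le> \<kappa>" "0 \<le> \<kappa>"
proof -
  have "0 \<le> ln (lam0 * K)" using K by simp
  then have "log0_plus (lam0 * K) / ln 2 = log 2 (lam0 * K)" by (simp add: log0_plus_def log_def)
  then show "log 2 (lam0 * K) \<le> \<kappa>" by (simp add: kappa_bar_def)
  moreover have "0 \<le> log 2 (lam0 * K)" using K by simp
  ultimately show "0 \<le> \<kappa>" by linarith
qed

lemma hlr_call:
  assumes "norm (p - p_star) \<le> norm p_star"
  shows "hlr_call (AL p) (aug_lagrangian_grad C \<A> b \<beta> p) (\<beta> * (onorm \<A>)\<^sup>2)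
    (G_bar C \<A> b \<beta> tol p_star) \<sigma> chi \<rho> K lam0 tol"
proof -
  interpret smooth_convex "AL p" "aug_lagrangian_grad C \<A> b \<beta> p" "\<beta> * (onorm \<A>)\<^sup>2"
    by (rule smooth_convex_aug_lagrangian[OF linear params(7)])
  have "norm p \<le> 2 * norm p_star" using norm_triangle_sub[of p p_star] assms by linarith
  also have "\<dots> = sqrt (4 * (norm p_star)\<^sup>2)" by (simp add: real_sqrt_mult)
  also have "\<dots> \<le> sqrt (4 * (norm p_star)\<^sup>2 + 2 * \<beta> * tol)"
    using params tol_props by (intro real_sqrt_le_mono) auto
  finally have p: "norm p \<le> sqrt (4 * (norm p_star)\<^sup>2 + 2 * \<beta> * tol)" .
  show ?thesis
  proof unfold_locales
    fix U :: "'n colmat" assume "norm U \<le> 3"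
    then have "(norm U)\<^sup>2 \<le> 3\<^sup>2" by (intro power_mono) auto
    then have "norm (gram U) \<le> 9" using norm_gram_le[of U] by simp
    then show "norm (aug_lagrangian_grad C \<A> b \<beta> p (gram U)) \<le> G_bar C \<A> b \<beta> tol p_star"
      unfolding G_bar_def by (intro aug_lagrangian_grad_bound linear params p)
  next
    show "4 * (2 * G_bar C \<A> b \<beta> tol p_star + 36 * (\<beta> * (onorm \<A>)\<^sup>2)) \<le> K"
      by (simp add: curvature_bar_def)
  qed (use params K tol_props in auto)
qed

lemma F_bar_ge: "3 * tol \<le> F_bar \<A> b \<beta> tol X0 p_star"
  using params tol_props by (simp add: F_bar_def)

text \<open>The term \<open>3 * tol\<close> in \<^const>\<open>F_bar\<close> makes the bound at least \<open>1 + 12\<close>, which covers HLR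
  when the curvature is small compared with the tolerance; the term
  \<open>4 * \<beta> * (onorm \<A>)\<^sup>2\<close> of the maximum covers the other case.\<close>

lemma hlr_steps_le_P_bar: "1 + max 12 (16 * (\<beta> * (onorm \<A>)\<^sup>2) / tol) \<le> P_bar \<A> b \<beta> tol X0 p_star"
proof -
  let ?F = "F_bar \<A> b \<beta> tol X0 p_star"
  define M where "M = Max {?F, sqrt (4 * \<beta> * (onorm \<A>)\<^sup>2 * ?F), 4 * \<beta> * (onorm \<A>)\<^sup>2}"
  have "3 * tol \<le> M" "4 * \<beta> * (onorm \<A>)\<^sup>2 \<le> M"
    using F_bar_ge[of X0] by (auto simp: M_def le_max_iff_disj)
  then have "3 \<le> M / tol" "4 * \<beta> * (onorm \<A>)\<^sup>2 / tol \<le> M / tol"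
    using tol_props(1) by (simp_all add: pos_le_divide_eq divide_right_mono)
  then have "1 + max 12 (16 * (\<beta> * (onorm \<A>)\<^sup>2) / tol) \<le> 1 + 4 * (M / tol)" by simp
  also have "\<dots> \<le> P_bar \<A> b \<beta> tol X0 p_star"
    unfolding P_bar_def Let_def M_def times_divide_eq_right by (rule le_of_int_ceiling)
  finally show ?thesis .
qed

abbreviation hlr_at
  where "hlr_at p \<equiv> hlr_pass \<sigma> chi (AL p) tol \<rho> lam0"

lemma hlr_at_facts:
  fixes X0 :: "'n symmat"
  assumes p: "norm (p - p_star) \<le> norm p_star" and U0: "U0 \<in> unit_ball s0"
  defines "P \<equiv> P_bar \<A> b \<beta> tol X0 p_star"
  shows "halts (hlr_at p) (U0, s0, no_effort)"
    and "returns (hlr_at p) (U0, s0, no_effort) (U, s, \<theta>, d) \<Longrightarrow>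
      U \<in> unit_ball s \<and> \<theta> = max (- lambda_min (aug_lagrangian_grad C \<A> b \<beta> p (gram U))) 0 \<and>
      aug_lagrangian_grad C \<A> b \<beta> p (gram U) \<bullet> gram U + \<theta> \<le> tol \<and>
      real (hlr_iterations d) \<le> P \<and> min_eigenvectors d = hlr_iterations d \<and>
      real (fista_calls d) \<le> (1 + \<kappa>) * P + rate * (AL p (gram U0) - AL p (gram U))"
proof -
  interpret H: hlr_call "AL p" "aug_lagrangian_grad C \<A> b \<beta> p" "\<beta> * (onorm \<A>)\<^sup>2"
    "G_bar C \<A> b \<beta> tol p_star" \<sigma> chi \<rho> K lam0 tol
    by (rule hlr_call[OF p])
  show "halts (hlr_at p) (U0, s0, no_effort)" by (rule H.hlr_halts[OF U0])
  assume ret: "returns (hlr_at p) (U0, s0, no_effort) (U, s, \<theta>, d)"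
  have "1 + H.hlr_steps tol (gram U0) \<le> P"
    using H.hlr_steps_le[OF tol_props(1) gram_unit_ball_Delta[OF U0]] hlr_steps_le_P_bar[of X0]
    unfolding P_def by linarith
  then have P: "real (hlr_iterations d) \<le> P"
    using H.hlr_returns[OF U0 ret] by (simp add: no_effort_def)
  have "(1 + log 2 (lam0 * K)) * real (hlr_iterations d) \<le> (1 + real_of_int \<kappa>) * real_of_int P"
    using P \<kappa> by (intro mult_mono) auto
  then show "U \<in> unit_ball s \<and> \<theta> = max (- lambda_min (aug_lagrangian_grad C \<A> b \<beta> p (gram U))) 0 \<and>
      aug_lagrangian_grad C \<A> b \<beta> p (gram U) \<bullet> gram U + \<theta> \<le> tol \<and>
      real (hlr_iterations d) \<le> P \<and> min_eigenvectors d = hlr_iterations d \<and>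
      real (fista_calls d) \<le> (1 + \<kappa>) * P + rate * (AL p (gram U0) - AL p (gram U))"
    using H.hlr_returns[OF U0 ret] P by (simp add: no_effort_def rate_def H.descent_rate_def)
qed

abbreviation hallar_run
  where "hallar_run \<equiv> hallar_pass \<sigma> chi C \<A> b \<epsilon>p \<epsilon>c \<beta> \<rho> lam0"

text \<open>In an iteration that continues, \<open>\<parallel>p' - p\<parallel> > \<beta> \<epsilon>p\<close> absorbs the error term
  \<open>2 \<beta> tol\<close> of the proximal point step.\<close>

lemma hallar_pass_cases:
  fixes X0 :: "'n symmat"
  assumes p: "norm (p - p_star) \<le> norm p_star" and U0: "U0 \<in> unit_ball s0"
    and pass: "hallar_run (U0, s0, p, t, c) out"
  defines "P \<equiv> P_bar \<A> b \<beta> tol X0 p_star"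
  obtains (stop) U d p' \<theta> where "out = Stop (gram U, p', \<theta>, t + 1, add_effort c d)"
      "approx_solution C \<A> b \<epsilon>p \<epsilon>c (gram U) p' \<theta>" "gram U \<in> Delta"
      "real (hlr_iterations d) \<le> P" "min_eigenvectors d = hlr_iterations d"
      "real (fista_calls d) \<le> (1 + \<kappa>) * P + rate * (AL p (gram U0) - AL p (gram U))"
  | (continue) U s d p' where "out = Continue (U, s, p', t + 1, add_effort c d)"
      "U \<in> unit_ball s" "norm (p' - p_star) \<le> norm p_star"
      "(norm (p' - p_star))\<^sup>2 + 2 / 3 * (norm (p' - p))\<^sup>2 \<le> (norm (p - p_star))\<^sup>2"
      "\<beta>\<^sup>2 * \<epsilon>p\<^sup>2 \<le> (norm (p' - p))\<^sup>2"
      "AL p' (gram U) = AL p (gram U) + (norm (p' - p))\<^sup>2 / \<beta>"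
      "real (hlr_iterations d) \<le> P" "min_eigenvectors d = hlr_iterations d"
      "real (fista_calls d) \<le> (1 + \<kappa>) * P + rate * (AL p (gram U0) - AL p (gram U))"
proof -
  obtain U s \<theta> d where ret: "returns (hlr_at p) (U0, s0, no_effort) (U, s, \<theta>, d)"
    and out: "out = (if norm (\<A> (gram U) - b) \<le> \<epsilon>p
           then Stop (gram U, p + \<beta> *\<^sub>R (\<A> (gram U) - b),
             max (- lambda_min (C + adjoint \<A> (p + \<beta> *\<^sub>R (\<A> (gram U) - b)))) 0, t + 1, add_effort c d)
           else Continue (U, s, p + \<beta> *\<^sub>R (\<A> (gram U) - b), t + 1, add_effort c d))"
    using pass hlr_at_facts(1)[OF p U0] unfolding hallar_pass_def prod.case Let_def by blast
  define r where "r = \<A> (gram U) - b"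
  define p' where "p' = p + \<beta> *\<^sub>R r"
  define G where "G = C + adjoint \<A> p'"
  have grad: "aug_lagrangian_grad C \<A> b \<beta> p (gram U) = G"
    by (simp add: aug_lagrangian_grad_def G_def p'_def r_def)
  note facts = hlr_at_facts(2)[OF p U0 ret, of X0, folded P_def, unfolded grad]
  have D: "gram U \<in> Delta" using facts gram_unit_ball_Delta by blast
  show thesis
  proof (cases "norm r \<le> \<epsilon>p")
    case True
    have \<theta>: "\<theta> = max (- lambda_min G) 0" "G \<bullet> gram U + \<theta> \<le> tol" using facts by auto
    have "approx_solution C \<A> b \<epsilon>p \<epsilon>c (gram U) p' \<theta>"
      unfolding approx_solution_def Let_def G_def[symmetric] r_def[symmetric]
    proof (intro conjI)
      show "norm r \<le> \<epsilon>p" by fact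
      show "tr (gram U) \<le> 1" "psd (gram U)" using D by (auto simp: Delta_def)
      show "psd (G + \<theta> *\<^sub>R sym_id)" by (rule psd_shift_lambda_min[OF \<theta>(1)])
      show "0 \<le> \<theta>" using \<theta> by simp
      have "gram U \<bullet> (G + \<theta> *\<^sub>R sym_id) + \<theta> * (1 - tr (gram U)) = G \<bullet> gram U + \<theta>"
        by (simp add: inner_add_right inner_sym_id inner_commute[of "gram U" G] algebra_simps)
      then show "gram U \<bullet> (G + \<theta> *\<^sub>R sym_id) + \<theta> * (1 - tr (gram U)) \<le> \<epsilon>c"
        using \<theta> tol_props by linarith
    qed
    moreover have "out = Stop (gram U, p', \<theta>, t + 1, add_effort c d)"
      using out True facts by (simp add: p'_def r_def G_def)
    ultimately show thesis using stop[of U p' \<theta> d] D facts by blast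
  next
    case False
    have diff: "p' - p = \<beta> *\<^sub>R r" by (simp add: p'_def)
    have nd: "(norm (p' - p))\<^sup>2 = \<beta>\<^sup>2 * (norm r)\<^sup>2" by (simp add: diff power_mult_distrib)
    have "\<epsilon>p\<^sup>2 \<le> (norm r)\<^sup>2" using False params by (intro power_mono) auto
    then have large: "\<beta>\<^sup>2 * \<epsilon>p\<^sup>2 \<le> (norm (p' - p))\<^sup>2" unfolding nd by (intro mult_left_mono) auto
    have "\<beta> * (6 * tol) \<le> \<beta> * (\<epsilon>p\<^sup>2 * \<beta>)" using params tol_props by (intro mult_left_mono) auto
    then have small: "2 * \<beta> * tol \<le> 1 / 3 * (norm (p' - p))\<^sup>2"
      using large by (simp add: power2_eq_square mult_ac)
    have "(norm (p' - p_star))\<^sup>2 + (norm (p' - p))\<^sup>2 \<le> (norm (p - p_star))\<^sup>2 + 2 * \<beta> * tol"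
      by (rule multiplier_step[OF D params(7) G_def]) (use facts in \<open>auto simp: p'_def r_def\<close>)
    then have decr: "(norm (p' - p_star))\<^sup>2 + 2 / 3 * (norm (p' - p))\<^sup>2 \<le> (norm (p - p_star))\<^sup>2"
      using small by linarith
    moreover have "0 \<le> 2 / 3 * (norm (p' - p))\<^sup>2" by simp
    ultimately have "(norm (p' - p_star))\<^sup>2 \<le> (norm (p - p_star))\<^sup>2" by linarith
    then have "norm (p' - p_star) \<le> norm (p - p_star)" by (rule power2_le_imp_le) simp
    then have "norm (p' - p_star) \<le> norm p_star" using p by linarith
    moreover have "AL p' (gram U) = AL p (gram U) + (norm (p' - p))\<^sup>2 / \<beta>"
      using params
      by (simp add: aug_lagrangian_def r_def[symmetric] p'_def inner_add_left power_mult_distrib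
        power2_norm_eq_inner power2_eq_square[of \<beta>])
    moreover have "out = Continue (U, s, p', t + 1, add_effort c d)"
      using out False by (simp add: p'_def r_def)
    ultimately show thesis using continue[of U s p' d] decr large facts by blast
  qed
qed

text \<open>A lower bound for the decrease of \<open>\<parallel>p - p_star\<parallel>\<^sup>2\<close> in an iteration that continues.\<close>

definition dec where "dec = 2 / 3 * \<beta>\<^sup>2 * \<epsilon>p\<^sup>2"

lemma dec_pos: "0 < dec"
  using params by (simp add: dec_def)

lemma hallar_halts:
  assumes "norm (p - p_star) \<le> norm p_star" "U0 \<in> unit_ball s0"
  shows "halts hallar_run (U0, s0, p, t, c)"
proof (rule halts_by_measure[where
      I = "\<lambda>(U0, s0, p, t, c). norm (p - p_star) \<le> norm p_star \<and> U0 \<in> unit_ball s0"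
      and V = "\<lambda>(U0, s0, p, t, c). (norm (p - p_star))\<^sup>2 / dec"])
  show "case (U0, s0, p, t, c) of (U0, s0, p, t, c) \<Rightarrow> norm (p - p_star) \<le> norm p_star \<and> U0 \<in> unit_ball s0"
    using assms by simp
  fix st :: "'n colmat \<times> nat \<times> (real^'m) \<times> nat \<times> effort"
  assume inv: "case st of (U0, s0, p, t, c) \<Rightarrow> norm (p - p_star) \<le> norm p_star \<and> U0 \<in> unit_ball s0"
  obtain U0 s0 p t c where st: "st = (U0, s0, p, t, c)" by (cases st)
  have i: "norm (p - p_star) \<le> norm p_star" "U0 \<in> unit_ball s0" using inv by (auto simp: st)
  obtain U s \<theta> d where "returns (hlr_at p) (U0, s0, no_effort) (U, s, \<theta>, d)"
    using halts_imp_returns[OF hlr_at_facts(1)[OF i]] by auto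
  then show "\<exists>out. hallar_run st out"
    unfolding st hallar_pass_def prod.case Let_def by blast
  show "\<not> hallar_run st Hang"
  proof
    assume "hallar_run st Hang"
    from i this[unfolded st] show False by (cases rule: hallar_pass_cases[where ?X0.0 = 0]) auto
  qed
  show "0 \<le> (case st of (U0, s0, p, t, c) \<Rightarrow> (norm (p - p_star))\<^sup>2 / dec)"
    using dec_pos by (simp add: st)
  fix st' assume "hallar_run st (Continue st')"
  from i this[unfolded st]
  show "(case st' of (U0, s0, p, t, c) \<Rightarrow> norm (p - p_star) \<le> norm p_star \<and> U0 \<in> unit_ball s0) \<and>
      (case st' of (U0, s0, p, t, c) \<Rightarrow> (norm (p - p_star))\<^sup>2 / dec) + 1
        \<le> (case st of (U0, s0, p, t, c) \<Rightarrow> (norm (p - p_star))\<^sup>2 / dec)"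
  proof (cases rule: hallar_pass_cases[where ?X0.0 = 0])
    case (continue U s d p')
    have "(norm (p' - p_star))\<^sup>2 + dec \<le> (norm (p - p_star))\<^sup>2"
      using continue(4,5) by (simp add: dec_def)
    then have "((norm (p' - p_star))\<^sup>2 + dec) / dec \<le> (norm (p - p_star))\<^sup>2 / dec"
      using dec_pos by (intro divide_right_mono) auto
    then show ?thesis using continue dec_pos by (simp add: st add_divide_distrib)
  qed auto
qed

text \<open>The augmented Lagrangian grows by \<open>\<parallel>p' - p\<parallel>\<^sup>2 / \<beta>\<close> at a multiplier update. This is paid by
  \<open>3 / (2 \<beta>)\<close> times the decrease of \<open>\<parallel>p - p_star\<parallel>\<^sup>2\<close>, so the total decrease within the
  calls of HLR is bounded by the quantity that \<open>rate\<close> multiplies.\<close>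

lemma hallar_returns:
  fixes X0 :: "'n symmat"
  assumes "returns hallar_run (U0, s0, p, t, c) (X, p', \<theta>, T, c')"
    and "norm (p - p_star) \<le> norm p_star" "U0 \<in> unit_ball s0"
  defines "P \<equiv> P_bar \<A> b \<beta> tol X0 p_star"
  shows "approx_solution C \<A> b \<epsilon>p \<epsilon>c X p' \<theta> \<and> t < T \<and>
    (real T - real t - 1) * dec \<le> (norm (p - p_star))\<^sup>2 \<and>
    real (hlr_iterations c') \<le> real (hlr_iterations c) + (real T - real t) * P \<and>
    real (min_eigenvectors c') \<le> real (min_eigenvectors c) + (real T - real t) * P \<and>
    real (fista_calls c') \<le> real (fista_calls c) + (real T - real t) * ((1 + \<kappa>) * P)
      + rate * (AL p (gram U0) - C \<bullet> X_star + 3 * (norm (p - p_star))\<^sup>2 / (2 * \<beta>))"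
  using assms(1-3)
proof (induction "(U0, s0, p, t, c)" "(X, p', \<theta>, T, c')" arbitrary: U0 s0 p t c)
  case (stop U0 s0 p t c)
  from stop(2,3,1) show ?case
  proof (cases rule: hallar_pass_cases[where ?X0.0 = X0])
    case (stop U d p1 \<theta>1)
    have "C \<bullet> X_star - (norm (p - p_star))\<^sup>2 / (2 * \<beta>) \<le> AL p (gram U)"
      using aug_lagrangian_lower stop(3) params by blast
    moreover have "(norm (p - p_star))\<^sup>2 / (2 * \<beta>) \<le> 3 * (norm (p - p_star))\<^sup>2 / (2 * \<beta>)"
      using params by (intro divide_right_mono) auto
    ultimately have "rate * (AL p (gram U0) - AL p (gram U))
        \<le> rate * (AL p (gram U0) - C \<bullet> X_star + 3 * (norm (p - p_star))\<^sup>2 / (2 * \<beta>))"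
      using rate_nonneg by (intro mult_left_mono) auto
    then show ?thesis using stop by (auto simp: add_effort_def P_def)
  qed auto
next
  case (continue st' U0 s0 p t c)
  note IH = continue(3)
  from continue(4,5,1) show ?case
  proof (cases rule: hallar_pass_cases[where ?X0.0 = X0])
    case (continue U s d p1)
    have st': "st' = (U, s, p1, t + 1, add_effort c d)" using continue(1) by simp
    note IH' = IH[OF st' continue(3,2)]
    have "3 * (norm (p1 - p_star))\<^sup>2 / (2 * \<beta>) + (norm (p1 - p))\<^sup>2 / \<beta>
        = 3 * ((norm (p1 - p_star))\<^sup>2 + 2 / 3 * (norm (p1 - p))\<^sup>2) / (2 * \<beta>)"
      using params by (simp add: field_simps)
    also have "\<dots> \<le> 3 * (norm (p - p_star))\<^sup>2 / (2 * \<beta>)"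
      using continue(4) params by (intro divide_right_mono mult_left_mono) auto
    finally have "rate * (AL p (gram U0) - AL p (gram U))
        + rate * (AL p1 (gram U) - C \<bullet> X_star + 3 * (norm (p1 - p_star))\<^sup>2 / (2 * \<beta>))
        \<le> rate * (AL p (gram U0) - C \<bullet> X_star + 3 * (norm (p - p_star))\<^sup>2 / (2 * \<beta>))"
      unfolding distrib_left[symmetric] continue(6)
      using rate_nonneg by (intro mult_left_mono) auto
    moreover have "(norm (p1 - p_star))\<^sup>2 + dec \<le> (norm (p - p_star))\<^sup>2"
      using continue(4,5) by (simp add: dec_def)
    ultimately show ?thesis
      using IH' continue(7-9) by (auto simp: add_effort_def P_def algebra_simps)
  qed auto
qed

end


theorem theorem3p2:
  fixes C :: "'n::finite symmat" and \<A> :: "'n symmat \<Rightarrow> real^'m" and b :: "real^'m"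
    and X_star :: "'n symmat" and p_star :: "real^'m" and \<theta>_star :: real
    and U0 :: "'n colmat" and s0 :: nat and p0 :: "real^'m"
    and \<sigma> chi \<epsilon>c \<epsilon>p \<beta> \<rho> lam0 :: real
  defines "\<epsilon> \<equiv> eps_bar \<epsilon>p \<epsilon>c \<beta>"
    and "X0 \<equiv> gram U0"
  assumes "0 < \<sigma>" "\<sigma> < 1 / 2" "0 < chi" "chi < 1"
    and "linear \<A>"
    and "primal_optimal C \<A> b X_star"
    and "dual_optimal C \<A> b (p_star, \<theta>_star)"
    and "C \<bullet> X_star = dual_value b (p_star, \<theta>_star)"
    and "U0 \<in> unit_ball s0"
    and "norm (p0 - p_star) \<le> norm p_star"
    and "0 < \<epsilon>c" "0 < \<epsilon>p" "0 < \<beta>" "0 < \<rho>" "0 < lam0"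
  shows "
    halts (hallar_pass \<sigma> chi C \<A> b \<epsilon>p \<epsilon>c \<beta> \<rho> lam0) (hallar_init U0 s0 p0) \<and>
    (\<forall>X p \<theta> T c.
      returns (hallar_pass \<sigma> chi C \<A> b \<epsilon>p \<epsilon>c \<beta> \<rho> lam0) (hallar_init U0 s0 p0)
        (X, p, \<theta>, T, c) \<longrightarrow>
      (let J = max 1 (J_bar \<beta> \<epsilon>p p_star);
           P = P_bar \<A> b \<beta> \<epsilon> X0 p_star;
           F = F_bar \<A> b \<beta> \<epsilon> X0 p_star;
           \<kappa> = kappa_bar C \<A> b \<beta> \<epsilon> lam0 p_star;
           gap = max 0 (C \<bullet> X0 + p0 \<bullet> (\<A> X0 - b) - C \<bullet> X_star)
       in approx_solution C \<A> b \<epsilon>p \<epsilon>c X p \<theta> \<and>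
          int T \<le> J \<and>
          int (hlr_iterations c) \<le> J * P \<and>
          int (min_eigenvectors c) \<le> J * P \<and>
          real (fista_calls c) \<le>
            J * ((1 + \<kappa>) * P) +
            C_sigma \<sigma> * (F + gap) * curvature_bar C \<A> b \<beta> \<epsilon> lam0 p_star / \<rho>\<^sup>2))"
proof -
  interpret hallar C \<A> b X_star p_star \<theta>_star \<sigma> chi \<epsilon>c \<epsilon>p \<beta> \<rho> lam0
    by (intro hallar.intro sdp_pair.intro hallar_axioms.intro) fact+
  have U0: "U0 \<in> unit_ball s0" and p0: "norm (p0 - p_star) \<le> norm p_star" by fact+
  have \<epsilon>_pos: "0 < \<epsilon>" unfolding \<epsilon>_def by (rule tol_props(1))
  let ?D = "(norm p_star)\<^sup>2"
  have D: "(norm (p0 - p_star))\<^sup>2 \<le> ?D" using p0 by (intro power_mono) auto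
  define J where "J = max 1 (J_bar \<beta> \<epsilon>p p_star)"
  define P where "P = P_bar \<A> b \<beta> \<epsilon> X0 p_star"
  define F where "F = F_bar \<A> b \<beta> \<epsilon> X0 p_star"
  define \<kappa>' where "\<kappa>' = kappa_bar C \<A> b \<beta> \<epsilon> lam0 p_star"
  define gap where "gap = max 0 (C \<bullet> X0 + p0 \<bullet> (\<A> X0 - b) - C \<bullet> X_star)"
  have "1 + 12 \<le> real_of_int P"
    using hlr_steps_le_P_bar[of X0] unfolding P_def \<epsilon>_def by linarith
  then have P: "0 \<le> P" by linarith
  have \<kappa>': "0 \<le> \<kappa>'" using \<kappa>(2) by (simp add: \<kappa>'_def \<epsilon>_def)
  \<comment> \<open>The left-hand side bounds the sum of all decreases of the augmented Lagrangians.\<close>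
  have total: "AL p0 X0 - C \<bullet> X_star + 3 * (norm (p0 - p_star))\<^sup>2 / (2 * \<beta>) \<le> F + gap"
  proof -
    have "3 * (norm (p0 - p_star))\<^sup>2 / (2 * \<beta>) \<le> 3 * ?D / (2 * \<beta>)"
      using D params by (intro divide_right_mono) auto
    also have "\<dots> = 3 / 2 * ?D / \<beta>" by simp
    also have "\<dots> \<le> (5 * ?D + norm p_star * sqrt (3 * ?D + 2 * \<beta> * \<epsilon>)) / \<beta>"
      using params(7) \<epsilon>_pos by (intro divide_right_mono) (auto intro!: add_increasing2)
    also have "\<dots> + \<beta> / 2 * (norm (\<A> X0 - b))\<^sup>2 \<le> F"
      using \<epsilon>_pos by (simp add: F_def F_bar_def)
    finally have "3 * (norm (p0 - p_star))\<^sup>2 / (2 * \<beta>) + \<beta> / 2 * (norm (\<A> X0 - b))\<^sup>2 \<le> F" by simp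
    then show ?thesis by (simp add: aug_lagrangian_def gap_def)
  qed
  have main: "approx_solution C \<A> b \<epsilon>p \<epsilon>c X p \<theta> \<and> int T \<le> J \<and>
      int (hlr_iterations c) \<le> J * P \<and> int (min_eigenvectors c) \<le> J * P \<and>
      real (fista_calls c) \<le> J * ((1 + \<kappa>') * P)
        + C_sigma \<sigma> * (F + gap) * curvature_bar C \<A> b \<beta> \<epsilon> lam0 p_star / \<rho>\<^sup>2"
    if ret: "returns hallar_run (hallar_init U0 s0 p0) (X, p, \<theta>, T, c)" for X p \<theta> T c
  proof -
    note r = hallar_returns[OF ret[unfolded hallar_init_def] p0 U0, of X0,
        folded X0_def \<epsilon>_def, folded P_def \<kappa>'_def]
    have T1: "1 \<le> T" using r by simp
    have "(real T - 1) * dec \<le> (norm (p0 - p_star))\<^sup>2" using r by simp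
    then have "(real T - 1) * dec \<le> ?D" using D by linarith
    then have T: "real T - 1 \<le> 3 * ?D / (2 * (\<beta>\<^sup>2 * \<epsilon>p\<^sup>2))"
      using params by (simp add: dec_def field_simps)
    have TJ: "int T \<le> J"
    proof (cases "T = 1")
      case False
      \<comment> \<open>The last iteration need not decrease \<open>\<parallel>p - p_star\<parallel>\<close>; the factor 2 between the two
        bounds pays for it.\<close>
      then have "real T \<le> 2 * (real T - 1)" using T1 by simp
      also have "\<dots> \<le> 3 * ?D / (\<beta>\<^sup>2 * \<epsilon>p\<^sup>2)" using T by simp
      also have "\<dots> \<le> J_bar \<beta> \<epsilon>p p_star" unfolding J_bar_def by (rule le_of_int_ceiling)
      finally show ?thesis unfolding J_def by linarith
    qed (simp add: J_def)
    have scale: "real T * real_of_int x \<le> real_of_int (J * x)" if "0 \<le> x" for x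
      using mult_right_mono[OF TJ that] by (metis of_int_le_iff of_int_mult of_int_of_nat_eq)
    have "real (hlr_iterations c) \<le> J * P" "real (min_eigenvectors c) \<le> J * P"
      using r scale[OF P] by (auto simp: no_effort_def)
    then have "int (hlr_iterations c) \<le> J * P" "int (min_eigenvectors c) \<le> J * P" by linarith+
    moreover have "real T * real_of_int ((1 + \<kappa>') * P) \<le> real_of_int (J * ((1 + \<kappa>') * P))"
      using P \<kappa>' by (intro scale) auto
    moreover have "rate * (AL p0 X0 - C \<bullet> X_star + 3 * (norm (p0 - p_star))\<^sup>2 / (2 * \<beta>))
        \<le> rate * (F + gap)"
      using total rate_nonneg by (intro mult_left_mono)
    moreover have "rate * (F + gap)
        = C_sigma \<sigma> * (F + gap) * curvature_bar C \<A> b \<beta> \<epsilon> lam0 p_star / \<rho>\<^sup>2"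
      by (simp add: rate_def \<epsilon>_def)
    ultimately show ?thesis using r TJ by (simp add: no_effort_def)
  qed
  show ?thesis
    using hallar_halts[OF p0 U0] main
    unfolding Let_def J_def P_def F_def \<kappa>'_def gap_def hallar_init_def by blast
qed

end
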